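(* For any $\alpha>\frac12$ and any integer $n\geq 1$, there exists an odd $\frac{2\pi}{n}$-periodic function $f_\alpha$, belonging to $C^{1/\alpha}(\mathbb{T})$ if $\alpha>1$ and to $C^{1,\frac1\alpha-1}(\mathbb{T})$ if $\alpha<1$, whose $n$-th Fourier coefficient does not vanish, $\widehat{(f_\alpha)}_n\neq 0$, and which solves the stationary generalized De Gregorio equation $$\alpha\,u\,\partial_x f_\alpha=f_\alpha\,\partial_x u,\qquad u=-\Lambda^{-1}f_\alpha\quad(\text{so that }\partial_x u=Hf_\alpha)$$ (in the weak sense given in the context). For $\alpha>1$, $f_\alpha$ can be taken as $f_\alpha(x)=\widetilde g_\alpha(nx)$, where $\widetilde g_\alpha$ is the odd extension to $\mathbb{T}$ of $-v_\alpha^{1/\alpha}$ and $v_\alpha\in C([0,\pi])$ is the only nonnegative solution, other than $0$, of $v=\Lambda^{-1}\big(v^{1/\alpha}\big)$ on $[0,\pi]$.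
   Context: $\mathbb{T}=\mathbb{R}/2\pi\mathbb{Z}$, identified with $(-\pi,\pi]$; $\widehat f_k$ are Fourier coefficients. On mean-zero functions on $\mathbb{T}$, $H$ is the Hilbert transform $\widehat{(Hf)}_k=-i\,\mathrm{sgn}(k)\widehat f_k$ ($k\ne0$), and $\Lambda^{-1}$ is the Fourier multiplier $\widehat{(\Lambda^{-1}f)}_k=\frac{1}{|k|}\widehat f_k$ ($k\neq0$), with zero mean. On a function $w$ on $[0,\pi]$, $\Lambda^{-1}$ acts by applying it to the odd extension of $w$ to $\mathbb{T}$ and restricting the result to $[0,\pi]$. Weak sense: with $u=-\Lambda^{-1}f$, the equation $\alpha u\,\partial_xf=f\,\partial_xu$ means $$-\alpha\int_{-\pi}^{\pi} f\,u\,\partial_x\psi\,dx=(\alpha+1)\int_{-\pi}^{\pi} f\,\partial_xu\,\psi\,dx\qquad\text{for every }\psi\in C^\infty(\mathbb{T}).$$ *)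

theory Defs
  imports "HOL-Analysis.Analysis"
begin

text \<open>
  Functions on the torus \<open>\<real>/2\<pi>\<int>\<close> are represented by \<open>2\<pi>\<close>-periodic functions on the real line.
\<close>

definition L2_torus :: "(real \<Rightarrow> real) set" where
  "L2_torus = {f. (\<forall>x. f (x + 2 * pi) = f x) \<and> f \<in> borel_measurable lebesgue \<and>
                  set_integrable lebesgue {-pi..pi} (\<lambda>x. (f x)\<^sup>2)}"

definition smooth_torus :: "(real \<Rightarrow> real) set" where
  "smooth_torus = {\<psi>. (\<forall>x. \<psi> (x + 2 * pi) = \<psi> x) \<and>
                      (\<forall>k x. (deriv ^^ k) \<psi> differentiable at x)}"

text \<open>
  For periodic functions, the Hoelder condition for the distance of the torus is the same as
  the condition for all pairs of real numbers.
\<close>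

definition holder :: "real \<Rightarrow> (real \<Rightarrow> real) \<Rightarrow> bool" where
  "holder \<beta> f \<longleftrightarrow> (\<exists>C. \<forall>x y. \<bar>f x - f y\<bar> \<le> C * \<bar>x - y\<bar> powr \<beta>)"

definition C_holder_torus :: "real \<Rightarrow> (real \<Rightarrow> real) set" where
  "C_holder_torus \<beta> = {f. (\<forall>x. f (x + 2 * pi) = f x) \<and> holder \<beta> f}"

definition C1_holder_torus :: "real \<Rightarrow> (real \<Rightarrow> real) set" where
  "C1_holder_torus \<beta> = {f. (\<forall>x. f (x + 2 * pi) = f x) \<and>
                           (\<forall>x. f differentiable at x) \<and> holder \<beta> (deriv f)}"

definition fourier_coeff :: "(real \<Rightarrow> real) \<Rightarrow> int \<Rightarrow> complex" where
  "fourier_coeff f k =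
     (LINT x:{-pi..pi}|lebesgue. complex_of_real (f x) * cis (- (of_int k * x))) / (2 * pi)"

text \<open>
  A multiplier determines its value only almost everywhere, so multipliers are
  relations between a mean-zero function \<open>f\<close> and a representative \<open>g\<close> of the result.
\<close>

definition fourier_multiplier ::
    "(int \<Rightarrow> complex) \<Rightarrow> (real \<Rightarrow> real) \<Rightarrow> (real \<Rightarrow> real) \<Rightarrow> bool" where
  "fourier_multiplier m f g \<longleftrightarrow>
     f \<in> L2_torus \<and> fourier_coeff f 0 = 0 \<and>
     g \<in> L2_torus \<and> fourier_coeff g 0 = 0 \<and>
     (\<forall>k. k \<noteq> 0 \<longrightarrow> fourier_coeff g k = m k * fourier_coeff f k)"

definition is_hilbert :: "(real \<Rightarrow> real) \<Rightarrow> (real \<Rightarrow> real) \<Rightarrow> bool" where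
  "is_hilbert = fourier_multiplier (\<lambda>k. - \<i> * of_int (sgn k))"

definition is_Lambda_inv :: "(real \<Rightarrow> real) \<Rightarrow> (real \<Rightarrow> real) \<Rightarrow> bool" where
  "is_Lambda_inv = fourier_multiplier (\<lambda>k. 1 / of_int \<bar>k\<bar>)"

definition is_weak_deriv :: "(real \<Rightarrow> real) \<Rightarrow> (real \<Rightarrow> real) \<Rightarrow> bool" where
  "is_weak_deriv u du \<longleftrightarrow>
     u \<in> L2_torus \<and> du \<in> L2_torus \<and>
     (\<forall>\<psi>\<in>smooth_torus.
        (LINT x:{-pi..pi}|lebesgue. u x * deriv \<psi> x) =
        - (LINT x:{-pi..pi}|lebesgue. du x * \<psi> x))"

definition weak_stationary_De_Gregorio :: "real \<Rightarrow> (real \<Rightarrow> real) \<Rightarrow> bool" where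
  "weak_stationary_De_Gregorio \<alpha> f \<longleftrightarrow>
     (\<exists>u du. is_Lambda_inv f (\<lambda>x. - u x) \<and> is_weak_deriv u du \<and> is_hilbert f du \<and>
        (\<forall>\<psi>\<in>smooth_torus.
           - \<alpha> * (LINT x:{-pi..pi}|lebesgue. f x * u x * deriv \<psi> x) =
           (\<alpha> + 1) * (LINT x:{-pi..pi}|lebesgue. f x * du x * \<psi> x)))"

text \<open>
  \<open>torus_rep x\<close> is the representative of \<open>x\<close> modulo \<open>2\<pi>\<close> in \<open>(-\<pi>,\<pi>]\<close>.  The extension below keeps the
  values of \<open>w\<close> on all of \<open>[0,\<pi>]\<close>, hence it is odd at every point only if \<open>w 0 = w \<pi> = 0\<close>.
\<close>

definition torus_rep :: "real \<Rightarrow> real" where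
  "torus_rep x = x - 2 * pi * of_int \<lceil>(x - pi) / (2 * pi)\<rceil>"

definition odd_ext :: "(real \<Rightarrow> real) \<Rightarrow> real \<Rightarrow> real" where
  "odd_ext w x = (let y = torus_rep x in if 0 \<le> y then w y else - w (- y))"

text \<open>
  Nonnegative solutions in \<open>C([0,\<pi>])\<close>, other than \<open>0\<close>, of \<open>v = \<Lambda>\<^sup>-\<^sup>1 (v\<^bsup>1/\<alpha>\<^esup>)\<close> on \<open>[0,\<pi>]\<close>.  Here \<open>V\<close> is a
  representative of the right-hand side that agrees with \<open>v\<close> on \<open>[0,\<pi>]\<close>; because \<open>v\<close> is continuous and
  the right-hand side has a continuous representative, asking for equality everywhere
  or almost everywhere on \<open>[0,\<pi>]\<close> amounts to the same.
\<close>

definition nonneg_fixed_point :: "real \<Rightarrow> (real \<Rightarrow> real) \<Rightarrow> bool" where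
  "nonneg_fixed_point \<alpha> v \<longleftrightarrow>
     continuous_on {0..pi} v \<and> (\<forall>x\<in>{0..pi}. 0 \<le> v x) \<and> (\<exists>x\<in>{0..pi}. v x \<noteq> 0) \<and>
     (\<exists>V. is_Lambda_inv (odd_ext (\<lambda>x. v x powr (1 / \<alpha>))) V \<and> (\<forall>x\<in>{0..pi}. v x = V x))"

definition stationary_profile :: "real \<Rightarrow> nat \<Rightarrow> (real \<Rightarrow> real) \<Rightarrow> bool" where
  "stationary_profile \<alpha> n f \<longleftrightarrow>
     (\<forall>x. f (- x) = - f x) \<and>
     (\<forall>x. f (x + 2 * pi / real n) = f x) \<and>
     (\<alpha> > 1 \<longrightarrow> f \<in> C_holder_torus (1 / \<alpha>)) \<and>
     (\<alpha> < 1 \<longrightarrow> f \<in> C1_holder_torus (1 / \<alpha> - 1)) \<and>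
     fourier_coeff f (int n) \<noteq> 0 \<and>
     weak_stationary_De_Gregorio \<alpha> f"

end

theory Submission
  imports Defs "HOL-Complex_Analysis.Great_Picard"
begin

text \<open>
  Put \<open>p = 1/\<alpha>\<close>, so that \<open>0 < p < 2\<close>.  Suppose that \<open>v\<close> is odd, \<open>2\<pi>\<close>-periodic and continuously
  differentiable, and that \<open>v = \<Lambda>\<^sup>-\<^sup>1 (sgn v \<bar>v\<bar>\<^sup>p)\<close>.  Then \<open>f = - sgn v \<bar>v\<bar>\<^sup>p\<close> has the velocity
  \<open>u = - \<Lambda>\<^sup>-\<^sup>1 f = v\<close>, and \<open>f u = - \<bar>v\<bar>\<^bsup>p+1\<^esup>\<close> has the derivative \<open>(p+1) f u'\<close>.  After division by
  \<open>p\<close>, testing this with \<open>\<psi>\<close> and integrating by parts is the weak form of \<open>\<alpha> u f' = f u'\<close>.  Passing to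
  \<open>f(n x)\<close> and \<open>v(n x)/n\<close> gives the period \<open>2\<pi>/n\<close>.  Hence everything rests on the scalar equation
  \<open>v = \<Lambda>\<^sup>-\<^sup>1 (v\<^sup>p)\<close> for \<open>v \<ge> 0\<close> on \<open>[0,\<pi>]\<close>.

  On odd functions \<open>\<Lambda>\<^sup>-\<^sup>1\<close> is the integral operator on \<open>[0,\<pi>]\<close> with the kernel
  \<open>ln (sin ((x+y)/2) / \<bar>sin ((x-y)/2)\<bar>) / \<pi>\<close>.  This kernel is nonnegative with a logarithmic
  singularity, and its Abel means have the sine series \<open>2/\<pi> \<Sum> r\<^sup>j/j sin jx sin jy\<close>.  The series converges
  geometrically for \<open>r < 1\<close>, and the limit \<open>r \<rightarrow> 1\<close> shows that the operator is symmetric and positive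
  semidefinite and divides the \<open>k\<close>-th sine coefficient by \<open>k\<close>.

  Existence (\<open>solution_exists\<close>) comes from the power iteration \<open>v \<mapsto> \<Lambda>\<^sup>-\<^sup>1 (v\<^sup>p)\<close>, normalized in the
  energy norm.  Convexity of \<open>t\<^bsup>p+1\<^esup>\<close> shows that \<open>\<integral> v\<^bsup>p+1\<^esup>\<close> grows in each step by at least a fixed
  multiple of the squared energy distance between consecutive iterates (\<open>energy_step\<close>).  Since these integrals
  are bounded, consecutive iterates merge, and by the theorem of Arzela and Ascoli a subsequence
  converges to a solution of \<open>\<Lambda>\<^sup>-\<^sup>1 (w\<^sup>p) = N w\<close>.  For \<open>p \<noteq> 1\<close> a scalar factor removes \<open>N\<close>; for \<open>p = 1\<close>
  the sine solves the equation.

  Regularity comes from second differences: that of the kernel equals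
  \<open>- ln \<bar>1 - sin\<^sup>2 (h/2) / sin\<^sup>2 (t/2)\<bar> / \<pi>\<close>, which is small in the mean
  (\<open>Lambda_op_second_diff\<close>), and a second difference of order \<open>h\<^bsup>1+b\<^esup>\<close> means a \<open>b\<close>-Hoelder derivative
  (\<open>zygmund_C1\<close>).  This is applied repeatedly to \<open>v = \<Lambda>\<^sup>-\<^sup>1 (v\<^sup>p)\<close> in \<open>u_C1\<close>; the last step needs \<open>p < 2\<close>.

  Uniqueness for \<open>p < 1\<close> (\<open>solution_le\<close>) is a comparison argument: all solutions are comparable to
  the sine, and \<open>t w \<le> u\<close> implies \<open>t\<^sup>p w \<le> u\<close>, which drives \<open>t\<close> to \<open>1\<close>.  It is applied to functions that
  solve the equation in the sense of Fourier coefficients; these satisfy the integral equation because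
  an integrable function with vanishing Fourier coefficients has vanishing integrals over intervals
  (\<open>integral_zero_of_fourier_coeff_zero\<close>).
\<close>

section \<open>Signed powers, power singularities and periodic integrals\<close>

definition signed_powr :: "real \<Rightarrow> real \<Rightarrow> real" where
  "signed_powr p x = sgn x * \<bar>x\<bar> powr p"

lemma signed_powr_0 [simp]: "signed_powr p 0 = 0"
  by (simp add: signed_powr_def)

lemma signed_powr_minus [simp]: "signed_powr p (- x) = - signed_powr p x"
  by (simp add: signed_powr_def)

lemma signed_powr_nonneg_eq: "0 \<le> x \<Longrightarrow> signed_powr p x = x powr p"
  by (cases "x = 0") (auto simp: signed_powr_def)

lemma abs_signed_powr: "\<bar>signed_powr p x\<bar> = \<bar>x\<bar> powr p"
  by (cases "x = 0") (auto simp: signed_powr_def abs_mult abs_sgn_eq)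

lemma isCont_signed_powr: "p > 0 \<Longrightarrow> isCont (signed_powr p) x"
proof (cases "x = 0")
  case False
  assume p: "p > 0"
  have "isCont (\<lambda>y. sgn y * \<bar>y\<bar> powr p) x"
    using False by (intro continuous_intros isCont_sgn) auto
  then show ?thesis by (simp add: signed_powr_def[abs_def])
next
  case True
  assume p: "p > 0"
  have "((\<lambda>y::real. \<bar>y\<bar> powr p) \<longlongrightarrow> \<bar>0\<bar> powr p) (at 0)"
    using p by (intro tendsto_powr' tendsto_rabs) (auto intro!: tendsto_eq_intros)
  then have "((\<lambda>y::real. \<bar>signed_powr p y\<bar>) \<longlongrightarrow> 0) (at 0)"
    using p by (simp add: abs_signed_powr)
  then have "(signed_powr p \<longlongrightarrow> 0) (at 0)"
    by (rule tendsto_rabs_zero_cancel)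
  then show ?thesis using True by (simp add: isCont_def)
qed

lemma continuous_on_signed_powr [continuous_intros]:
  "p > 0 \<Longrightarrow> continuous_on S f \<Longrightarrow> continuous_on S (\<lambda>x. signed_powr p (f x))"
  using continuous_on_compose2[of UNIV "signed_powr p" S f] isCont_signed_powr
  by (auto simp: continuous_at_imp_continuous_on)

lemma DERIV_signed_powr_nonzero:
  assumes "x \<noteq> 0"
  shows "(signed_powr p has_real_derivative p * \<bar>x\<bar> powr (p - 1)) (at x)"
proof (cases "x > 0")
  case True
  have "((\<lambda>x. x powr p) has_real_derivative p * x powr (p - 1)) (at x)"
    using has_real_derivative_powr[OF True] by simp
  then have "(signed_powr p has_real_derivative p * x powr (p - 1)) (at x)"
    by (rule has_field_derivative_transform_within_open[where S="{0<..}"])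
       (use True in \<open>auto simp: signed_powr_nonneg_eq\<close>)
  then show ?thesis using True by simp
next
  case False
  then have x: "x < 0" using assms by auto
  have "((\<lambda>x. - ((- x) powr p)) has_real_derivative p * (- x) powr (p - 1)) (at x)"
    using x by (auto intro!: derivative_eq_intros)
  then have "(signed_powr p has_real_derivative p * (- x) powr (p - 1)) (at x)"
    by (rule has_field_derivative_transform_within_open[where S="{..<0}"])
       (use x in \<open>auto simp: signed_powr_def\<close>)
  then show ?thesis using x by simp
qed

lemma DERIV_signed_powr:
  assumes "p > 1"
  shows "(signed_powr p has_real_derivative p * \<bar>x\<bar> powr (p - 1)) (at x)"
proof (cases "x = 0")
  case True
  have "((\<lambda>y::real. \<bar>y\<bar> powr (p - 1)) \<longlongrightarrow> \<bar>0\<bar> powr (p - 1)) (at 0)"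
    using assms by (intro tendsto_powr' tendsto_rabs) (auto intro!: tendsto_eq_intros)
  moreover have "\<forall>\<^sub>F y in at 0. \<bar>y\<bar> powr (p - 1) = (signed_powr p y - signed_powr p 0) / (y - 0)"
    by (auto simp: signed_powr_def powr_diff sgn_if eventually_at_filter)
  ultimately have "((\<lambda>y. (signed_powr p y - signed_powr p 0) / (y - 0)) \<longlongrightarrow> 0) (at 0)"
    using assms by (auto intro: Lim_transform_eventually)
  then show ?thesis using True by (simp add: has_field_derivative_iff)
qed (use DERIV_signed_powr_nonzero in auto)

text \<open>
  Dividing by \<open>a\<^sup>p\<close> turns this into \<open>1 \<le> s\<^sup>p + (1-s)\<^sup>p\<close> with \<open>s = b/a\<close>, which holds because
  \<open>s \<le> s\<^sup>p\<close> on \<open>[0,1]\<close>.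
\<close>

lemma powr_diff_le:
  fixes a b p :: real
  assumes "0 \<le> b" "b \<le> a" "0 < p" "p \<le> 1"
  shows "a powr p - b powr p \<le> (a - b) powr p"
proof (cases "a = 0")
  case False
  then have a: "a > 0" using assms by auto
  have *: "s \<le> s powr p" if "0 \<le> s" "s \<le> 1" for s :: real
    using powr_mono'[of p 1 s] that assms by (cases "s = 0") auto
  have "(b / a) + ((a - b) / a) \<le> (b / a) powr p + ((a - b) / a) powr p"
    using assms a by (intro add_mono *) (auto simp: field_simps)
  also have "\<dots> = (b powr p + (a - b) powr p) / a powr p"
    using assms a by (simp add: powr_divide add_divide_distrib)
  finally have "1 \<le> (b powr p + (a - b) powr p) / a powr p"
    using a by (simp add: field_simps)
  then show ?thesis using a by (simp add: field_simps)
qed (use assms in auto)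

lemma abs_powr_diff_le:
  fixes x y p :: real
  assumes "0 < p" "p \<le> 1"
  shows "\<bar>\<bar>x\<bar> powr p - \<bar>y\<bar> powr p\<bar> \<le> \<bar>x - y\<bar> powr p"
proof -
  have *: "\<bar>\<bar>x\<bar> powr p - \<bar>y\<bar> powr p\<bar> \<le> \<bar>x - y\<bar> powr p" if "\<bar>y\<bar> \<le> \<bar>x\<bar>" for x y :: real
  proof -
    have "\<bar>x\<bar> powr p - \<bar>y\<bar> powr p \<le> (\<bar>x\<bar> - \<bar>y\<bar>) powr p"
      using that assms by (intro powr_diff_le) auto
    also have "\<dots> \<le> \<bar>x - y\<bar> powr p"
      using that assms by (intro powr_mono2) auto
    finally show ?thesis
      using powr_mono2[of p "\<bar>y\<bar>" "\<bar>x\<bar>"] that assms by auto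
  qed
  show ?thesis
    using *[of x y] *[of y x] by (cases "\<bar>y\<bar> \<le> \<bar>x\<bar>") (auto simp: abs_minus_commute)
qed

lemma signed_powr_holder:
  assumes "0 < p" "p \<le> 1"
  shows "\<bar>signed_powr p x - signed_powr p y\<bar> \<le> 2 * \<bar>x - y\<bar> powr p"
proof (cases "sgn x = sgn y")
  case True
  then have "\<bar>signed_powr p x - signed_powr p y\<bar> \<le> \<bar>\<bar>x\<bar> powr p - \<bar>y\<bar> powr p\<bar>"
    by (cases "y = 0") (auto simp: signed_powr_def abs_mult abs_sgn_eq simp flip: right_diff_distrib)
  also have "\<dots> \<le> \<bar>x - y\<bar> powr p" by (rule abs_powr_diff_le[OF assms])
  finally show ?thesis using powr_ge_zero[of "\<bar>x - y\<bar>" p] by linarith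
next
  case False
  then have "\<bar>x\<bar> \<le> \<bar>x - y\<bar>" "\<bar>y\<bar> \<le> \<bar>x - y\<bar>"
    by (auto simp: sgn_if split: if_splits)
  then have "\<bar>x\<bar> powr p \<le> \<bar>x - y\<bar> powr p" "\<bar>y\<bar> powr p \<le> \<bar>x - y\<bar> powr p"
    using assms by (auto intro!: powr_mono2)
  then show ?thesis
    using abs_triangle_ineq4[of "signed_powr p x" "signed_powr p y"] by (simp add: abs_signed_powr)
qed

lemma integral_abs_powr:
  fixes a c l u R :: real
  assumes "0 < c" "c < 1" "l \<le> u" "a - R \<le> l" "u \<le> a + R"
  shows "integrable (lebesgue_on {l..u}) (\<lambda>t. \<bar>t - a\<bar> powr (- c))"
    and "(LINT t|lebesgue_on {l..u}. \<bar>t - a\<bar> powr (- c)) \<le> 2 * R powr (1 - c) / (1 - c)"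
proof -
  define F where "F t = signed_powr (1 - c) (t - a) / (1 - c)" for t
  have *: "((\<lambda>t. \<bar>t - a\<bar> powr (- c)) has_integral F u - F l) {l..u}"
  proof (rule fundamental_theorem_of_calculus_interior_strong[of "{a}"])
    show "continuous_on {l..u} F"
      unfolding F_def using assms by (intro continuous_intros) auto
    fix x assume x: "x \<in> {l<..<u} - {a}"
    have "(F has_real_derivative \<bar>x - a\<bar> powr (- c)) (at x)"
      unfolding F_def using x assms
      by (auto intro!: derivative_eq_intros DERIV_chain2[OF DERIV_signed_powr_nonzero])
    then show "(F has_vector_derivative \<bar>x - a\<bar> powr - c) (at x)"
      by (simp add: has_real_derivative_iff_has_vector_derivative)
  qed (use assms in auto)
  have ai: "(\<lambda>t. \<bar>t - a\<bar> powr (- c)) absolutely_integrable_on {l..u}"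
    using * by (intro nonnegative_absolutely_integrable_1) (auto simp: has_integral_integrable)
  then show "integrable (lebesgue_on {l..u}) (\<lambda>t. \<bar>t - a\<bar> powr (- c))"
    by (simp add: integrable_restrict_space set_integrable_def)
  have "(LINT t|lebesgue_on {l..u}. \<bar>t - a\<bar> powr (- c)) = integral {l..u} (\<lambda>t. \<bar>t - a\<bar> powr (- c))"
    by (intro lebesgue_integral_eq_integral \<open>integrable _ _\<close>) auto
  also have "\<dots> = F u - F l" using * by blast
  also have "\<dots> \<le> \<bar>F u\<bar> + \<bar>F l\<bar>" by linarith
  also have "\<dots> = \<bar>u - a\<bar> powr (1 - c) / (1 - c) + \<bar>l - a\<bar> powr (1 - c) / (1 - c)"
    using assms by (simp add: F_def abs_signed_powr)
  also have "\<dots> \<le> R powr (1 - c) / (1 - c) + R powr (1 - c) / (1 - c)"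
    using assms by (intro add_mono divide_right_mono powr_mono2) auto
  finally show "(LINT t|lebesgue_on {l..u}. \<bar>t - a\<bar> powr (- c)) \<le> 2 * R powr (1 - c) / (1 - c)"
    by simp
qed

text \<open>
  This follows from \<open>sin x \<ge> x - x\<^sup>3/6\<close>.  The range has to extend beyond \<open>\<pi>/2\<close>, because the bound is used
  for \<open>(t+h)/2\<close> with \<open>t \<le> \<pi>\<close> and \<open>h \<le> 1\<close>.
\<close>

lemma abs_sin_ge:
  fixes x :: real
  assumes "\<bar>x\<bar> \<le> 23/10"
  shows "\<bar>x\<bar> / 10 \<le> \<bar>sin x\<bar>"
proof -
  have *: "x / 10 \<le> sin x" if x: "0 \<le> x" "x \<le> 23/10" for x :: real
  proof -
    have "x - x ^ 3 / 6 \<le> sin x"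
    proof -
      have d2: "0 \<le> cos t - 1 + t\<^sup>2 / 2" if t: "t \<ge> 0" for t :: real
      proof -
        have "cos 0 - 1 + 0\<^sup>2 / 2 \<le> cos t - 1 + t\<^sup>2 / (2::real)"
          by (rule DERIV_nonneg_imp_nondecreasing[OF t])
             (auto intro!: exI derivative_eq_intros sin_x_le_x)
        then show ?thesis by simp
      qed
      have "sin 0 - 0 + 0 ^ 3 / 6 \<le> sin x - x + x ^ 3 / (6::real)"
        by (rule DERIV_nonneg_imp_nondecreasing[OF x(1)])
           (auto intro!: exI derivative_eq_intros d2 simp: power2_eq_square
                 dest: d2[unfolded power2_eq_square])
      then show ?thesis by simp
    qed
    moreover have "x * (x * x) \<le> x * (529/100)"
      using mult_mono[OF x(2) x(2)] x by (intro mult_left_mono) auto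
    ultimately show ?thesis using x by (simp add: power3_eq_cube)
  qed
  show ?thesis using *[of "\<bar>x\<bar>"] assms
    by (cases "x \<ge> 0") (auto simp: abs_if)
qed

lemma two_sin_half_squared: "2 * (sin (z / 2))\<^sup>2 = 1 - cos (z :: real)"
  using cos_double_sin[of "z / 2"] by simp

lemma sin_half_squared_diff:
  "(sin ((x + y) / 2))\<^sup>2 - (sin ((x - y) / 2))\<^sup>2 = sin x * sin (y :: real)"
proof -
  have "2 * ((sin ((x + y) / 2))\<^sup>2 - (sin ((x - y) / 2))\<^sup>2) = 2 * (sin x * sin y)"
    using two_sin_half_squared[of "x + y"] two_sin_half_squared[of "x - y"] cos_add[of x y] cos_diff[of x y]
    by (simp add: algebra_simps)
  then show ?thesis by simp
qed

lemma periodic_integer_shift: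
  fixes F :: "real \<Rightarrow> 'a"
  assumes per: "\<And>x. F (x + T) = F x"
  shows "F (x + of_int k * T) = F x"
proof -
  have n: "F (x + of_nat m * T) = F x" for x m
  proof (induction m)
    case (Suc m)
    have "F (x + of_nat (Suc m) * T) = F ((x + of_nat m * T) + T)" by (simp add: algebra_simps)
    then show ?case using Suc per by simp
  qed auto
  show ?thesis
  proof (cases "k \<ge> 0")
    case True
    then show ?thesis using n[of x "nat k"] by simp
  next
    case False
    then show ?thesis using n[of "x + of_int k * T" "nat (- k)"] by simp
  qed
qed

lemma has_integral_periodic_shift:
  fixes F :: "real \<Rightarrow> 'a::banach"
  assumes per: "\<And>x. F (x + T) = F x" and T: "T > 0"
    and I: "(F has_integral I) {a..a + T}"
  shows "(F has_integral I) {b..b + T}"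
proof -
  define k where "k = \<lceil>(b - a) / T\<rceil>"
  define c where "c = a + of_int k * T"
  have "(b - a) / T \<le> of_int k" "of_int k < (b - a) / T + 1"
    unfolding k_def by linarith+
  then have bc: "b \<le> c" "c \<le> b + T"
    using T by (auto simp: c_def field_simps)
  have sh: "(F has_integral J) {l + of_int j * T..u + of_int j * T}"
    if "(F has_integral J) {l..u}" for J l u j
  proof -
    have "((\<lambda>x. F (x + - (of_int j * T))) has_integral J) {l - - (of_int j * T)..u - - (of_int j * T)}"
      by (rule has_integral_shift_real_ivl[OF that])
    moreover have "F (x - of_int j * T) = F x" for x
      using periodic_integer_shift[of F T x "- j"] per by simp
    ultimately show ?thesis by simp
  qed
  have I': "(F has_integral I) {c..c + T}"
    using sh[OF I, of k] by (simp add: c_def algebra_simps)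
  have "F integrable_on {c..c+T}" using I' by blast
  then have i1: "F integrable_on {c..b + T}"  and i2: "F integrable_on {b + T..c + T}"
    using bc T by (auto intro: integrable_on_subinterval)
  have h1: "(F has_integral integral {c..b+T} F) {c..b+T}"
   and h2: "(F has_integral integral {b+T..c+T} F) {b+T..c+T}"
    using i1 i2 by blast+
  have h3: "(F has_integral integral {b+T..c+T} F) {b..c}"
    using sh[OF h2, of "-1"] by simp
  have "(F has_integral integral {b+T..c+T} F + integral {c..b+T} F) {b..b+T}"
    by (rule has_integral_combine[OF bc h3 h1])
  moreover have "(F has_integral integral {c..b+T} F + integral {b+T..c+T} F) {c..c+T}"
    by (rule has_integral_combine[OF _ _ h1 h2]) (use bc T in auto)
  then have "integral {c..b+T} F + integral {b+T..c+T} F = I"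
    using I' has_integral_unique by blast
  ultimately show ?thesis by (simp add: add.commute)
qed

lemma integral_periodic_reflect:
  fixes F :: "real \<Rightarrow> real"
  assumes per: "\<And>x. F (x + 2 * pi) = F x"
    and I: "integrable (lebesgue_on {-pi..pi}) F"
  shows "integrable (lebesgue_on {-pi..pi}) (\<lambda>t. F (x - t))"
    and "(LINT t|lebesgue_on {-pi..pi}. F (x - t)) = (LINT t|lebesgue_on {-pi..pi}. F t)"
proof -
  have gen: "((\<lambda>t. G (x - t)) has_integral J) {-pi..pi}"
    if per': "\<And>x. G (x + 2 * pi) = G x" and J: "(G has_integral J) {-pi..pi}" for G :: "real \<Rightarrow> real" and J
  proof -
    have "(G has_integral J) {x - pi..x - pi + 2 * pi}"
      by (rule has_integral_periodic_shift[where a="-pi"]) (use per' J in auto)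
    then have "((\<lambda>t. G (- t)) has_integral J) {- (x - pi + 2 * pi)..- (x - pi)}"
      by (subst has_integral_reflect_real)
    from has_integral_shift_real_ivl[OF this, of "- x"] show ?thesis by simp
  qed
  have hF: "(F has_integral (LINT t|lebesgue_on {-pi..pi}. F t)) {-pi..pi}"
    using has_integral_integral_lebesgue_on[OF I] by simp
  have "integrable (lebesgue_on {-pi..pi}) (\<lambda>t. \<bar>F t\<bar>)" using I by simp
  then have hA: "((\<lambda>t. \<bar>F t\<bar>) has_integral (LINT t|lebesgue_on {-pi..pi}. \<bar>F t\<bar>)) {-pi..pi}"
    using has_integral_integral_lebesgue_on[of "{-pi..pi}" "\<lambda>t. \<bar>F t\<bar>"] by simp
  note a = gen[OF per hF] 
  have b: "((\<lambda>t. \<bar>F (x - t)\<bar>) has_integral (LINT t|lebesgue_on {-pi..pi}. \<bar>F t\<bar>)) {-pi..pi}"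
    by (rule gen[of "\<lambda>t. \<bar>F t\<bar>"]) (use per hA in auto)
  have "(\<lambda>t. F (x - t)) absolutely_integrable_on {-pi..pi}"
    using a b by (intro absolutely_integrable_onI) (auto simp: has_integral_integrable)
  then show 1: "integrable (lebesgue_on {-pi..pi}) (\<lambda>t. F (x - t))"
    by (simp add: integrable_restrict_space set_integrable_def)
  show "(LINT t|lebesgue_on {-pi..pi}. F (x - t)) = (LINT t|lebesgue_on {-pi..pi}. F t)"
    using has_integral_integral_lebesgue_on[OF 1] a has_integral_unique by auto
qed

section \<open>The logarithmic kernel on odd functions\<close>

text \<open>
  As \<open>(1-r)\<^sup>2 + 4r sin\<^sup>2 (t/2) = \<bar>1 - r e\<^bsup>it\<^esup>\<bar>\<^sup>2\<close>, this is \<open>- ln \<bar>1 - r e\<^bsup>it\<^esup>\<bar> / \<pi> = \<Sum> r\<^sup>j cos(jt) / (j\<pi>)\<close>.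
  For \<open>r = 1\<close> it is the convolution kernel of \<open>\<Lambda>\<^sup>-\<^sup>1\<close> on the circle, for \<open>r < 1\<close> an Abel mean of it.  At the
  singularity \<open>r = 1\<close>, \<open>t = 0\<close> the value is \<open>0\<close>, as \<open>ln 0 = 0\<close>; this is a null set.
\<close>

definition log_kernel :: "real \<Rightarrow> real \<Rightarrow> real" where
  "log_kernel r t = - ln ((1 - r)\<^sup>2 + 4 * r * (sin (t / 2))\<^sup>2) / (2 * pi)"

text \<open>
  The kernel that remains on \<open>[0,\<pi>]\<close> after the convolution with an odd function is folded.
\<close>

definition odd_kernel :: "real \<Rightarrow> real \<Rightarrow> real \<Rightarrow> real" where
  "odd_kernel r x y = log_kernel r (x - y) - log_kernel r (x + y)"

text \<open>
  For \<open>r = 1\<close> this is \<open>\<Lambda>\<^sup>-\<^sup>1\<close> of the odd periodic extension of \<open>g\<close> from \<open>[0,\<pi>]\<close>, for \<open>r < 1\<close> an Abel mean.  As a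
  function of \<open>x\<close> it is odd and \<open>2\<pi>\<close>-periodic whatever \<open>g\<close> is.
\<close>

definition Lambda_op :: "real \<Rightarrow> (real \<Rightarrow> real) \<Rightarrow> real \<Rightarrow> real" where
  "Lambda_op r g x = (LINT y|lebesgue_on {0..pi}. odd_kernel r x y * g y)"

definition bdd_meas :: "(real \<Rightarrow> real) \<Rightarrow> bool" where
  "bdd_meas g \<longleftrightarrow> g \<in> borel_measurable (lebesgue_on {0..pi}) \<and> (\<exists>C. \<forall>x\<in>{0..pi}. \<bar>g x\<bar> \<le> C)"

definition sin_coeff :: "(real \<Rightarrow> real) \<Rightarrow> nat \<Rightarrow> real" where
  "sin_coeff g j = (LINT y|lebesgue_on {0..pi}. g y * sin (real j * y))"

text \<open>
  The inner product of \<open>H\<^bsup>-1/2\<^esup>\<close> on odd functions, up to a factor.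
\<close>

definition energy_form :: "(real \<Rightarrow> real) \<Rightarrow> (real \<Rightarrow> real) \<Rightarrow> real" where
  "energy_form g h = (LINT x|lebesgue_on {0..pi}. Lambda_op 1 g x * h x)"

lemma borel_imp_lebesgue_on:
  "f \<in> borel_measurable borel \<Longrightarrow> f \<in> borel_measurable (lebesgue_on S)"
  by (simp add: measurable_restrict_space1 measurable_completion)

lemma finite_measure_Icc: "finite_measure (lebesgue_on {a..b::real})"
  by (rule finite_measure_lebesgue_on) auto

lemma continuous_bdd_meas:
  assumes "continuous_on {0..pi} g"
  shows "bdd_meas g"
proof -
  have "compact (g ` {0..pi})" using assms by (intro compact_continuous_image) auto
  then obtain C where "\<forall>x\<in>{0..pi}. \<bar>g x\<bar> \<le> C"
    using compact_imp_bounded bounded_real by (metis (no_types) imageI)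
  then show ?thesis
    using assms by (auto simp: bdd_meas_def intro!: continuous_imp_measurable_on_sets_lebesgue)
qed

lemma bdd_meas_add: "bdd_meas g \<Longrightarrow> bdd_meas h \<Longrightarrow> bdd_meas (\<lambda>x. g x + h x)"
  unfolding bdd_meas_def
proof (intro conjI, goal_cases)
  case 2
  then obtain C D where C: "\<forall>x\<in>{0..pi}. \<bar>g x\<bar> \<le> C" and D: "\<forall>x\<in>{0..pi}. \<bar>h x\<bar> \<le> D" by auto
  have "\<bar>g x + h x\<bar> \<le> C + D" if "x \<in> {0..pi}" for x
    using C D that abs_triangle_ineq[of "g x" "h x"] by fastforce
  then show ?case by blast
qed (auto intro!: borel_measurable_add)

lemma bdd_meas_mult: "bdd_meas g \<Longrightarrow> bdd_meas h \<Longrightarrow> bdd_meas (\<lambda>x. g x * h x)"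
  unfolding bdd_meas_def
proof (intro conjI, goal_cases)
  case 2
  then obtain C D where C: "\<forall>x\<in>{0..pi}. \<bar>g x\<bar> \<le> C" and D: "\<forall>x\<in>{0..pi}. \<bar>h x\<bar> \<le> D" by auto
  have "\<bar>g x * h x\<bar> \<le> C * D" if "x \<in> {0..pi}" for x
    unfolding abs_mult using C D that order_trans[OF abs_ge_zero] by (intro mult_mono) blast+
  then show ?case by blast
qed (auto intro!: borel_measurable_times)

lemma bdd_meas_cmult: "bdd_meas g \<Longrightarrow> bdd_meas (\<lambda>x. c * g x)"
  by (rule bdd_meas_mult[of "\<lambda>x. c"]) (auto intro!: continuous_bdd_meas)

lemma bdd_meas_diff: "bdd_meas g \<Longrightarrow> bdd_meas h \<Longrightarrow> bdd_meas (\<lambda>x. g x - h x)"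
  using bdd_meas_add[of g "\<lambda>x. -1 * h x"] bdd_meas_cmult[of h "-1"] by simp

lemma bdd_meas_integrable: "bdd_meas g \<Longrightarrow> integrable (lebesgue_on {0..pi}) g"
  unfolding bdd_meas_def
  by (metis (no_types, lifting) AE_I2 finite_measure.integrable_const_bound finite_measure_Icc
      real_norm_def space_lebesgue_on)

lemma AE_lebesgue_on_neq:
  fixes c a b :: real
  shows "AE y in lebesgue_on {a..b}. y \<noteq> c"
proof -
  have "{c} \<inter> {a..b} \<in> null_sets lebesgue"
    using null_sets_completionI[of "{c} \<inter> {a..b}" lborel] by (auto intro!: finite_imp_null_set_lborel)
  then show ?thesis
    by (intro AE_I'[of "{c} \<inter> {a..b}"]) (auto simp: null_sets_restrict_space)
qed

lemma measurable_log_kernel [measurable]: "log_kernel r \<in> borel_measurable borel"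
  unfolding log_kernel_def[abs_def] by measurable

lemma measurable_odd_kernel: "(\<lambda>y. odd_kernel r x y) \<in> borel_measurable (lebesgue_on S)"
  unfolding odd_kernel_def by (intro borel_imp_lebesgue_on) measurable

lemma log_kernel_minus [simp]: "log_kernel r (- t) = log_kernel r t"
  by (simp add: log_kernel_def)

lemma log_kernel_periodic [simp]: "log_kernel r (t + 2 * pi) = log_kernel r t"
  by (simp add: log_kernel_def add_divide_distrib sin_periodic_pi)

lemma odd_kernel_minus [simp]: "odd_kernel r (- x) y = - odd_kernel r x y"
  using log_kernel_minus[of r "x + y"] log_kernel_minus[of r "x - y"]
  by (simp add: odd_kernel_def add.commute)

lemma odd_kernel_periodic [simp]: "odd_kernel r (x + 2 * pi) y = odd_kernel r x y"
  using log_kernel_periodic[of r "x + y"] log_kernel_periodic[of r "x - y"]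
  by (simp add: odd_kernel_def algebra_simps)

lemma sin_half_facts:
  assumes "x \<in> {0..pi}" "y \<in> {0..pi}" "x \<noteq> y"
  shows "0 < (sin ((x - y) / 2))\<^sup>2" "(sin ((x - y) / 2))\<^sup>2 \<le> (sin ((x + y) / 2))\<^sup>2"
    "(\<bar>x - y\<bar> / 20)\<^sup>2 \<le> (sin ((x - y) / 2))\<^sup>2"
proof -
  have "\<bar>(x - y) / 2\<bar> / 10 \<le> \<bar>sin ((x - y) / 2)\<bar>"
  proof (rule abs_sin_ge)
    have "\<bar>x - y\<bar> \<le> pi" using assms by auto
    then show "\<bar>(x - y) / 2\<bar> \<le> 23 / 10" using pi_less_4 by simp
  qed
  then have "\<bar>x - y\<bar> / 20 \<le> \<bar>sin ((x - y) / 2)\<bar>" by simp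
  then show *: "(\<bar>x - y\<bar> / 20)\<^sup>2 \<le> (sin ((x - y) / 2))\<^sup>2"
    using power_mono[of "\<bar>x - y\<bar> / 20" "\<bar>sin ((x - y) / 2)\<bar>" 2] by simp
  have "0 < (\<bar>x - y\<bar> / 20)\<^sup>2" using assms by simp
  then show "0 < (sin ((x - y) / 2))\<^sup>2" using * by linarith
  have "0 \<le> sin x * sin y"
    using assms by (intro mult_nonneg_nonneg sin_ge_zero) auto
  then show "(sin ((x - y) / 2))\<^sup>2 \<le> (sin ((x + y) / 2))\<^sup>2"
    using sin_half_squared_diff[of x y] by linarith
qed

text \<open>
  The two arguments of the logarithms are \<open>a + 4rS\<close> and \<open>a + 4rD\<close> with \<open>0 < D \<le> S\<close>, and their quotient
  lies between \<open>1\<close> and \<open>S/D\<close>.  So the kernel for \<open>r = 1\<close> dominates all its Abel means.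
\<close>

lemma odd_kernel_bounds:
  assumes "x \<in> {0..pi}" "y \<in> {0..pi}" "x \<noteq> y" "0 \<le> r" "r \<le> 1"
  shows "0 \<le> odd_kernel r x y" "odd_kernel r x y \<le> odd_kernel 1 x y"
proof -
  define a where "a = (1 - r)\<^sup>2"
  define S where "S = (sin ((x + y) / 2))\<^sup>2"
  define D where "D = (sin ((x - y) / 2))\<^sup>2"
  have D: "0 < D" "D \<le> S" using sin_half_facts[OF assms(1-3)] by (auto simp: S_def D_def)
  have a: "0 \<le> a" by (simp add: a_def)
  have pD: "0 < a + 4 * r * D"
    using D assms(4) a by (cases "r = 0") (auto simp: a_def intro: add_nonneg_pos)
  have le: "a + 4 * r * D \<le> a + 4 * r * S" using D assms by (simp add: mult_left_mono)
  have eq: "odd_kernel r x y = (ln (a + 4 * r * S) - ln (a + 4 * r * D)) / (2 * pi)"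
    by (simp add: odd_kernel_def log_kernel_def a_def S_def D_def diff_divide_distrib)
  show "0 \<le> odd_kernel r x y" unfolding eq using le pD by simp
  have eq1: "odd_kernel 1 x y = (ln (4 * S) - ln (4 * D)) / (2 * pi)"
    by (simp add: odd_kernel_def log_kernel_def S_def D_def diff_divide_distrib)
  have "ln ((a + 4 * r * S) * (4 * D)) \<le> ln ((4 * S) * (a + 4 * r * D))"
  proof (rule ln_mono)
    show "(a + 4 * r * S) * (4 * D) \<le> 4 * S * (a + 4 * r * D)"
      using mult_left_mono[OF D(2) a] by (simp add: algebra_simps)
    show "0 < (a + 4 * r * S) * (4 * D)" using D pD le by (intro mult_pos_pos) auto
  qed
  then have "ln (a + 4 * r * S) + ln (4 * D) \<le> ln (4 * S) + ln (a + 4 * r * D)"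
    using D pD le by (simp add: ln_mult)
  then show "odd_kernel r x y \<le> odd_kernel 1 x y"
    unfolding eq eq1 by (simp add: divide_right_mono)
qed

lemma abs_odd_kernel_mult_le:
  assumes "x \<in> {0..pi}" "y \<in> {0..pi}" "x \<noteq> y" "0 \<le> r" "r \<le> 1" "\<bar>z\<bar> \<le> C"
  shows "\<bar>odd_kernel r x y * z\<bar> \<le> odd_kernel 1 x y * C"
  unfolding abs_mult using odd_kernel_bounds[OF assms(1-5)] assms(6) by (intro mult_mono) auto

lemma odd_kernel_eq_ln:
  assumes "x \<in> {0..pi}" "y \<in> {0..pi}" "x \<noteq> y"
  shows "odd_kernel 1 x y = (ln ((sin ((x + y) / 2))\<^sup>2) - ln ((sin ((x - y) / 2))\<^sup>2)) / (2 * pi)"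
proof -
  define S where "S = (sin ((x + y) / 2))\<^sup>2"
  define D where "D = (sin ((x - y) / 2))\<^sup>2"
  have "0 < D" "D \<le> S" using sin_half_facts[OF assms] by (auto simp: S_def D_def)
  moreover have "odd_kernel 1 x y = (ln (4 * S) - ln (4 * D)) / (2 * pi)"
    by (simp add: odd_kernel_def log_kernel_def S_def D_def diff_divide_distrib)
  ultimately have "odd_kernel 1 x y = (ln S - ln D) / (2 * pi)" by (simp add: ln_mult)
  then show ?thesis by (simp add: S_def D_def)
qed

lemma odd_kernel_le_powr:
  assumes "x \<in> {0..pi}" "y \<in> {0..pi}" "x \<noteq> y" "0 < c" "c \<le> 1"
  shows "odd_kernel 1 x y \<le> 20 / c * \<bar>x - y\<bar> powr (- c)"
proof -
  define S where "S = (sin ((x + y) / 2))\<^sup>2"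
  define D where "D = (sin ((x - y) / 2))\<^sup>2"
  define z where "z = 20 / \<bar>x - y\<bar>"
  have D: "0 < D" "D \<le> S" "(1 / z)\<^sup>2 \<le> D" using sin_half_facts[OF assms(1-3)] by (auto simp: S_def D_def z_def)
  have S1: "S \<le> 1" by (simp add: S_def abs_square_le_1)
  have "\<bar>x - y\<bar> \<le> pi" using assms by auto
  then have z1: "1 \<le> z" using assms pi_less_4 by (auto simp: z_def field_simps)
  have "odd_kernel 1 x y = (ln S - ln D) / (2 * pi)" using odd_kernel_eq_ln[OF assms(1-3)] by (simp add: S_def D_def)
  also have "\<dots> \<le> (0 - ln ((1 / z)\<^sup>2)) / (2 * pi)"
    using D S1 z1 by (intro divide_right_mono diff_mono ln_mono) auto
  also have "\<dots> = ln z / pi" using z1 by (simp add: ln_realpow ln_div)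
  also have "\<dots> \<le> ln z / 1" using z1 pi_gt3 by (intro divide_left_mono) auto
  also have "\<dots> \<le> z powr c / c" using ln_powr_bound[OF z1 assms(4)] by simp
  also have "\<dots> = 20 powr c * \<bar>x - y\<bar> powr (- c) / c"
    using assms by (simp add: z_def powr_divide powr_minus divide_simps)
  also have "\<dots> \<le> 20 * \<bar>x - y\<bar> powr (- c) / c"
    using assms powr_mono[of c 1 "20::real"] by (intro divide_right_mono mult_right_mono) auto
  finally show ?thesis by simp
qed

text \<open>
  A logarithm is weaker than any negative power: for \<open>c \<le> 1/(2q)\<close> the \<open>q\<close>-th power of the kernel is at most a
  multiple of \<open>\<bar>x - y\<bar>\<^bsup>-cq\<^esup>\<close>, where \<open>cq \<le> 1/2\<close>.
\<close>

lemma integral_odd_kernel_powr: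
  assumes "q > 0"
  shows "\<exists>A\<ge>0. \<forall>x\<in>{0..pi}. integrable (lebesgue_on {0..pi}) (\<lambda>y. \<bar>odd_kernel 1 x y\<bar> powr q) \<and>
           (LINT y|lebesgue_on {0..pi}. \<bar>odd_kernel 1 x y\<bar> powr q) \<le> A"
proof -
  define c where "c = min 1 (1 / (2 * q))"
  have c: "0 < c" "c \<le> 1" "0 < c * q" "c * q < 1" using assms by (auto simp: c_def min_def field_simps)
  define C where "C = (20 / c) powr q"
  define A where "A = C * (2 * pi powr (1 - c * q) / (1 - c * q))"
  have "integrable (lebesgue_on {0..pi}) (\<lambda>y. \<bar>odd_kernel 1 x y\<bar> powr q) \<and>
           (LINT y|lebesgue_on {0..pi}. \<bar>odd_kernel 1 x y\<bar> powr q) \<le> A" if x: "x \<in> {0..pi}" for x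
  proof -
  note I = integral_abs_powr[OF c(3,4), of 0 pi x pi]
  have le: "AE y in lebesgue_on {0..pi}. \<bar>odd_kernel 1 x y\<bar> powr q \<le> C * \<bar>y - x\<bar> powr (- (c * q))"
    using AE_lebesgue_on_neq[of x 0 pi] AE_space
  proof eventually_elim
    case (elim y)
    then have y: "y \<in> {0..pi}" "x \<noteq> y" by auto
    have "\<bar>odd_kernel 1 x y\<bar> powr q \<le> (20 / c * \<bar>x - y\<bar> powr (- c)) powr q"
      using odd_kernel_le_powr[OF x y c(1,2)] odd_kernel_bounds(1)[OF x y, of 1] assms
      by (intro powr_mono2) auto
    also have "\<dots> = C * \<bar>y - x\<bar> powr (- (c * q))"
      using c y powr_mult[of "20 / c" "\<bar>x - y\<bar> powr (- c)" q]
      by (simp add: C_def powr_powr abs_minus_commute)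
    finally show ?case .
  qed
  have iC: "integrable (lebesgue_on {0..pi}) (\<lambda>y. C * \<bar>y - x\<bar> powr (- (c * q)))"
    using I x by auto
  have int: "integrable (lebesgue_on {0..pi}) (\<lambda>y. \<bar>odd_kernel 1 x y\<bar> powr q)"
  proof (rule Bochner_Integration.integrable_bound[OF iC])
    show "(\<lambda>y. \<bar>odd_kernel 1 x y\<bar> powr q) \<in> borel_measurable (lebesgue_on {0..pi})"
      unfolding odd_kernel_def by (intro borel_imp_lebesgue_on) measurable
    show "AE y in lebesgue_on {0..pi}. norm (\<bar>odd_kernel 1 x y\<bar> powr q) \<le> norm (C * \<bar>y - x\<bar> powr - (c * q))"
      using le by eventually_elim (auto simp: C_def)
  qed
  have "(LINT y|lebesgue_on {0..pi}. \<bar>odd_kernel 1 x y\<bar> powr q)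
      \<le> (LINT y|lebesgue_on {0..pi}. C * \<bar>y - x\<bar> powr (- (c * q)))"
    by (rule integral_mono_AE[OF int iC le])
  also have "\<dots> = C * (LINT y|lebesgue_on {0..pi}. \<bar>y - x\<bar> powr (- (c * q)))" by simp
  also have "\<dots> \<le> A" unfolding A_def using I x by (intro mult_left_mono) (auto simp: C_def)
  finally show ?thesis using int by simp
  qed
  then show ?thesis using c by (intro exI[of _ A]) (auto simp: A_def C_def)
qed

lemma integrable_odd_kernel:
  assumes "x \<in> {0..pi}"
  shows "integrable (lebesgue_on {0..pi}) (odd_kernel 1 x)"
proof -
  have "integrable (lebesgue_on {0..pi}) (\<lambda>y. \<bar>odd_kernel 1 x y\<bar> powr 1)"
    using integral_odd_kernel_powr[OF zero_less_one] assms by blast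
  then have "integrable (lebesgue_on {0..pi}) (\<lambda>y. \<bar>odd_kernel 1 x y\<bar>)" by simp
  then show ?thesis using integrable_norm_iff[of "odd_kernel 1 x"] measurable_odd_kernel[of 1 x] by simp
qed

lemma odd_kernel_mult_integrable:
  assumes x: "x \<in> {0..pi}" and g: "bdd_meas g" and r: "0 \<le> r" "r \<le> 1"
  shows "integrable (lebesgue_on {0..pi}) (\<lambda>y. odd_kernel r x y * g y)"
proof -
  obtain C where C: "\<forall>x\<in>{0..pi}. \<bar>g x\<bar> \<le> C" and gm: "g \<in> borel_measurable (lebesgue_on {0..pi})"
    using g by (auto simp: bdd_meas_def)
  have i: "integrable (lebesgue_on {0..pi}) (\<lambda>y. odd_kernel 1 x y * C)"
    using integrable_odd_kernel[OF x] by simp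
  show ?thesis
  proof (rule Bochner_Integration.integrable_bound[OF i])
    show "(\<lambda>y. odd_kernel r x y * g y) \<in> borel_measurable (lebesgue_on {0..pi})"
      by (intro borel_measurable_times measurable_odd_kernel gm)
    show "AE y in lebesgue_on {0..pi}. norm (odd_kernel r x y * g y) \<le> norm (odd_kernel 1 x y * C)"
      using AE_lebesgue_on_neq[of x 0 pi] AE_space
    proof eventually_elim
      case (elim y)
      then show ?case
        using abs_odd_kernel_mult_le[OF x, of y r "g y" C] C r by auto
    qed
  qed
qed

lemma Lambda_op_minus [simp]: "Lambda_op r g (- x) = - Lambda_op r g x"
  by (simp add: Lambda_op_def)

lemma Lambda_op_periodic [simp]: "Lambda_op r g (x + 2 * pi) = Lambda_op r g x"
  by (simp add: Lambda_op_def)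

lemma Lambda_op_0 [simp]: "Lambda_op r g 0 = 0"
  using Lambda_op_minus[of r g 0] by simp

lemma Lambda_op_pi [simp]: "Lambda_op r g pi = 0"
  using Lambda_op_minus[of r g pi] Lambda_op_periodic[of r g "-pi"] by simp

lemma Lambda_op_mono:
  assumes "x \<in> {0..pi}" "bdd_meas g" "bdd_meas h" "\<And>y. y \<in> {0..pi} \<Longrightarrow> g y \<le> h y"
  shows "Lambda_op 1 g x \<le> Lambda_op 1 h x"
  unfolding Lambda_op_def
proof (rule integral_mono_AE)
  show "AE y in lebesgue_on {0..pi}. odd_kernel 1 x y * g y \<le> odd_kernel 1 x y * h y"
    using AE_lebesgue_on_neq[of x 0 pi] AE_space
    by eventually_elim (use odd_kernel_bounds(1)[OF assms(1), of _ 1] assms in \<open>auto intro!: mult_left_mono\<close>)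
qed (use odd_kernel_mult_integrable assms in auto)

lemma Lambda_op_cmult: "Lambda_op r (\<lambda>x. c * g x) x = c * Lambda_op r g x"
  unfolding Lambda_op_def by (subst integral_mult_right_zero[symmetric]) (simp add: mult_ac)

lemma Lambda_op_diff:
  assumes "x \<in> {0..pi}" "bdd_meas g" "bdd_meas h"
  shows "Lambda_op 1 (\<lambda>y. g y - h y) x = Lambda_op 1 g x - Lambda_op 1 h x"
  unfolding Lambda_op_def using odd_kernel_mult_integrable assms by (simp add: right_diff_distrib)

lemma Lambda_op_nonneg:
  assumes "x \<in> {0..pi}" "bdd_meas g" "\<And>y. y \<in> {0..pi} \<Longrightarrow> 0 \<le> g y"
  shows "0 \<le> Lambda_op 1 g x"
proof -
  have "Lambda_op 1 (\<lambda>_. 0) x \<le> Lambda_op 1 g x"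
    by (rule Lambda_op_mono) (use assms in \<open>auto intro!: continuous_bdd_meas\<close>)
  then show ?thesis by (simp add: Lambda_op_def)
qed

definition kernel_mass :: real where
  "kernel_mass = (SUP x\<in>{0..pi}. LINT y|lebesgue_on {0..pi}. \<bar>odd_kernel 1 x y\<bar>)"

lemma abs_Lambda_op_le:
  assumes r: "0 \<le> r" "r \<le> 1" and g: "bdd_meas g"
    and C: "\<And>y. y \<in> {0..pi} \<Longrightarrow> \<bar>g y\<bar> \<le> C" and x: "x \<in> {0..pi}"
  shows "\<bar>Lambda_op r g x\<bar> \<le> kernel_mass * C"
proof -
  obtain A where A: "\<forall>x\<in>{0..pi}. (LINT y|lebesgue_on {0..pi}. \<bar>odd_kernel 1 x y\<bar> powr 1) \<le> A"
    using integral_odd_kernel_powr[OF zero_less_one] by blast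
  have mass: "(LINT y|lebesgue_on {0..pi}. \<bar>odd_kernel 1 x y\<bar>) \<le> kernel_mass"
    unfolding kernel_mass_def using A by (intro cSUP_upper x bdd_aboveI[of _ A]) auto
  have "0 \<le> C" using C[of 0] by simp
  have "\<bar>Lambda_op r g x\<bar> \<le> (LINT y|lebesgue_on {0..pi}. \<bar>odd_kernel r x y * g y\<bar>)"
    unfolding Lambda_op_def using integral_norm_bound[of "lebesgue_on {0..pi}" "\<lambda>y. odd_kernel r x y * g y"] by simp
  also have "\<dots> \<le> (LINT y|lebesgue_on {0..pi}. \<bar>odd_kernel 1 x y\<bar> * C)"
  proof (rule integral_mono_AE)
    show "AE y in lebesgue_on {0..pi}. \<bar>odd_kernel r x y * g y\<bar> \<le> \<bar>odd_kernel 1 x y\<bar> * C"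
      using AE_lebesgue_on_neq[of x 0 pi] AE_space
      by eventually_elim (use abs_odd_kernel_mult_le[OF x] odd_kernel_bounds(1)[OF x] C r in auto)
  qed (use odd_kernel_mult_integrable[OF x g r] integrable_odd_kernel[OF x] in auto)
  also have "\<dots> \<le> kernel_mass * C" using mass \<open>0 \<le> C\<close> by (simp add: mult_right_mono)
  finally show ?thesis .
qed

definition abel_radius :: "nat \<Rightarrow> real" where "abel_radius m = 1 - 1 / (real m + 2)"

lemma abel_bounds: "0 \<le> abel_radius m" "abel_radius m < 1" and abel_lim: "abel_radius \<longlonglongrightarrow> 1"
proof -
  show "0 \<le> abel_radius m" "abel_radius m < 1" by (auto simp: abel_radius_def field_simps)
  have "(\<lambda>m. 1 - 1 / (real (m + 2))) \<longlonglongrightarrow> 1 - 0"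
    by (intro tendsto_diff tendsto_const LIMSEQ_ignore_initial_segment[OF lim_1_over_n])
  then show "abel_radius \<longlonglongrightarrow> 1" by (simp add: abel_radius_def[abs_def] add.commute)
qed

lemma Lambda_op_abel_lim:
  assumes x: "x \<in> {0..pi}" and g: "bdd_meas g"
  shows "(\<lambda>m. Lambda_op (abel_radius m) g x) \<longlonglongrightarrow> Lambda_op 1 g x"
proof -
  obtain C where C: "\<forall>x\<in>{0..pi}. \<bar>g x\<bar> \<le> C" and gm: "g \<in> borel_measurable (lebesgue_on {0..pi})"
    using g by (auto simp: bdd_meas_def)
  have m: "(\<lambda>y. odd_kernel r x y * g y) \<in> borel_measurable (lebesgue_on {0..pi})" for r
    by (intro borel_measurable_times measurable_odd_kernel gm)
  show ?thesis unfolding Lambda_op_def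
  proof (rule integral_dominated_convergence)
    show "(\<lambda>y. odd_kernel 1 x y * g y) \<in> borel_measurable (lebesgue_on {0..pi})" by (rule m)
    show "(\<lambda>y. odd_kernel (abel_radius m) x y * g y) \<in> borel_measurable (lebesgue_on {0..pi})" for m by (rule m)
    show "integrable (lebesgue_on {0..pi}) (\<lambda>y. odd_kernel 1 x y * C)"
      using integrable_odd_kernel[OF x] by simp
    show "AE y in lebesgue_on {0..pi}. norm (odd_kernel (abel_radius m) x y * g y) \<le> odd_kernel 1 x y * C" for m
      using AE_lebesgue_on_neq[of x 0 pi] AE_space
      by eventually_elim (use abs_odd_kernel_mult_le[OF x, of _ "abel_radius m"] abel_bounds[of m] C in auto)
    show "AE y in lebesgue_on {0..pi}. (\<lambda>m. odd_kernel (abel_radius m) x y * g y) \<longlonglongrightarrow> odd_kernel 1 x y * g y"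
      using AE_lebesgue_on_neq[of x 0 pi] AE_space
    proof eventually_elim
      case (elim y)
      then have y: "y \<in> {0..pi}" "x \<noteq> y" by auto
      have *: "(\<lambda>m. log_kernel (abel_radius m) t) \<longlonglongrightarrow> log_kernel 1 t" if "(sin (t / 2))\<^sup>2 > 0" for t
        unfolding log_kernel_def by (intro tendsto_intros abel_lim) (use that in auto)
      show ?case unfolding odd_kernel_def
        by (intro tendsto_intros *) (use sin_half_facts[OF x y] in linarith)+
    qed
  qed
qed

section \<open>Sine series of the kernel\<close>

text \<open>
  Termwise integration.  The weight \<open>C\<close> is a constant for the kernel, and the modulus of an unbounded
  function for Fourier series.
\<close>

lemma sums_integral_geometric:
  fixes f :: "nat \<Rightarrow> 'a \<Rightarrow> real"
  assumes C: "integrable M C" and f: "\<And>j. f j \<in> borel_measurable M"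
    and b: "\<And>j x. x \<in> space M \<Longrightarrow> \<bar>f j x\<bar> \<le> C x * r ^ j" and r: "0 \<le> r" "r < 1"
    and s: "\<And>x. x \<in> space M \<Longrightarrow> (\<lambda>j. f j x) sums F x"
  shows "(\<lambda>j. integral\<^sup>L M (f j)) sums integral\<^sup>L M F" and "F \<in> borel_measurable M"
proof -
  have C0: "0 \<le> C x" if "x \<in> space M" for x using b[OF that, of 0] by simp
  have iC: "integrable M (\<lambda>x. C x * r ^ j)" for j using C by simp
  have int: "integrable M (f j)" for j
    by (rule Bochner_Integration.integrable_bound[OF iC f])
       (use b C0 r in \<open>auto intro!: AE_I2 simp: abs_mult\<close>)
  have "(\<lambda>j. integral\<^sup>L M (f j)) sums (LINT x|M. (\<Sum>j. f j x))"
  proof (rule sums_integral[OF int])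
    show "AE x in M. summable (\<lambda>j. norm (f j x))"
    proof (rule AE_I2)
      fix x assume x: "x \<in> space M"
      show "summable (\<lambda>j. norm (f j x))"
      proof (rule summable_comparison_test)
        show "\<exists>N. \<forall>n\<ge>N. norm (norm (f n x)) \<le> C x * r ^ n"
          using b[OF x] by simp
        show "summable (\<lambda>n. C x * r ^ n)" using r by (intro summable_mult) simp
      qed
    qed
    show "summable (\<lambda>j. LINT x|M. norm (f j x))"
    proof (rule summable_comparison_test)
      show "\<exists>N. \<forall>n\<ge>N. norm (LINT x|M. norm (f n x)) \<le> (LINT x|M. C x) * r ^ n"
      proof (intro exI allI impI)
        fix n
        have "(LINT x|M. norm (f n x)) \<le> (LINT x|M. C x * r ^ n)"
          using b int iC by (intro integral_mono) auto
        then show "norm (LINT x|M. norm (f n x)) \<le> (LINT x|M. C x) * r ^ n" by simp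
      qed
      show "summable (\<lambda>n. (LINT x|M. C x) * r ^ n)"
        using r by (intro summable_mult) simp
    qed
  qed
  also have "(LINT x|M. (\<Sum>j. f j x)) = integral\<^sup>L M F"
    using s by (intro Bochner_Integration.integral_cong) (auto simp: sums_iff)
  finally show "(\<lambda>j. integral\<^sup>L M (f j)) sums integral\<^sup>L M F" .
  have "(\<lambda>x. \<Sum>j. f j x) \<in> borel_measurable M" using f by measurable
  then show "F \<in> borel_measurable M"
    using s by (subst measurable_cong[where g="\<lambda>x. \<Sum>j. f j x"]) (auto simp: sums_iff)
qed

lemma norm_one_minus_rcis:
  "(cmod (1 - of_real r * cis t))\<^sup>2 = (1 - r)\<^sup>2 + 4 * r * (sin (t / 2))\<^sup>2"
proof -
  have c: "cos t = 1 - 2 * (sin (t / 2))\<^sup>2" using two_sin_half_squared[of t] by simp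
  have "(cmod (1 - of_real r * cis t))\<^sup>2 = (1 - r * cos t)\<^sup>2 + (r * sin t)\<^sup>2"
    by (simp add: cmod_power2)
  also have "\<dots> = 1 - 2 * r * cos t + r\<^sup>2 * ((sin t)\<^sup>2 + (cos t)\<^sup>2)"
    by (simp add: power2_eq_square algebra_simps del: sin_cos_squared_add sin_cos_squared_add2 sin_cos_squared_add3)
  also have "\<dots> = 1 - 2 * r * cos t + r\<^sup>2" by simp
  also have "\<dots> = (1 - r)\<^sup>2 + 4 * r * (sin (t / 2))\<^sup>2"
    unfolding c by (simp add: power2_eq_square algebra_simps)
  finally show ?thesis .
qed

text \<open>
  The real part of this series is the logarithmic kernel.  The imaginary part is the sawtooth function,
  which later separates functions by their Fourier coefficients.
\<close>

lemma Ln_one_minus_sums: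
  assumes "0 \<le> r" "r < 1"
  shows "(\<lambda>j. of_real (r ^ j / real j) * cis (real j * t)) sums (- Ln (1 - of_real r * cis t))"
proof -
  have "cmod (- (of_real r * cis t)) < 1" using assms by (simp add: norm_mult)
  from Ln_series'[OF this]
  have "(\<lambda>j. - ((of_real r * cis t) ^ j / of_nat j)) sums Ln (1 - of_real r * cis t)" by simp
  from sums_minus[OF this]
  have "(\<lambda>j. (of_real r * cis t) ^ j / of_nat j) sums (- Ln (1 - of_real r * cis t))" by simp
  moreover have "(of_real r * cis t) ^ j / of_nat j = of_real (r ^ j / real j) * cis (real j * t)" for j
    by (simp add: power_mult_distrib Complex.DeMoivre)
  ultimately show ?thesis by simp
qed

lemma log_kernel_sums:
  assumes "0 \<le> r" "r < 1"
  shows "(\<lambda>j. r ^ j / real j * cos (real j * t) / pi) sums log_kernel r t"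
proof -
  have nz: "1 - of_real r * cis t \<noteq> 0"
  proof
    assume "1 - of_real r * cis t = 0"
    then have "cmod 1 = cmod (of_real r * cis t)" by simp
    then show False using assms by (simp add: norm_mult)
  qed
  have "(\<lambda>j. Re (of_real (r ^ j / real j) * cis (real j * t))) sums Re (- Ln (1 - of_real r * cis t))"
    by (rule sums_Re[OF Ln_one_minus_sums[OF assms]])
  also have "Re (- Ln (1 - of_real r * cis t)) = - (ln ((cmod (1 - of_real r * cis t))\<^sup>2) / 2)"
    using nz by (simp add: ln_realpow)
  also have "\<dots> = log_kernel r t * pi"
    by (simp add: norm_one_minus_rcis log_kernel_def)
  finally have "(\<lambda>j. r ^ j / real j * cos (real j * t)) sums (log_kernel r t * pi)"
    by simp
  from sums_divide[OF this, of pi] show ?thesis by simp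
qed

lemma odd_kernel_sums:
  assumes "0 \<le> r" "r < 1"
  shows "(\<lambda>j. 2 / pi * (r ^ j / real j) * sin (real j * x) * sin (real j * y)) sums odd_kernel r x y"
proof -
  have "(\<lambda>j. r ^ j / real j * cos (real j * (x - y)) / pi - r ^ j / real j * cos (real j * (x + y)) / pi) sums odd_kernel r x y"
    unfolding odd_kernel_def by (intro sums_diff log_kernel_sums assms)
  moreover have "r ^ j / real j * cos (real j * (x - y)) / pi - r ^ j / real j * cos (real j * (x + y)) / pi
     = 2 / pi * (r ^ j / real j) * sin (real j * x) * sin (real j * y)" for j
  proof -
    have "cos (real j * (x - y)) - cos (real j * (x + y)) = 2 * (sin (real j * x) * sin (real j * y))"
      by (simp add: right_diff_distrib distrib_left cos_add cos_diff)
    then have "r ^ j / real j / pi * (cos (real j * (x - y)) - cos (real j * (x + y)))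
      = r ^ j / real j / pi * (2 * (sin (real j * x) * sin (real j * y)))" by simp
    then show ?thesis by (simp add: algebra_simps)
  qed
  ultimately show ?thesis by simp
qed

lemma sin_cos_measurable:
  "(\<lambda>y. sin (c * y :: real)) \<in> borel_measurable (lebesgue_on S)"
  "(\<lambda>y. cos (c * y :: real)) \<in> borel_measurable (lebesgue_on S)"
  by (intro borel_imp_lebesgue_on borel_measurable_continuous_onI continuous_intros)+

lemma bdd_meas_sin [simp]: "bdd_meas (\<lambda>y. sin (c * y))"
  by (intro continuous_bdd_meas continuous_intros)

lemma abs_coeff_le:
  assumes "0 \<le> r" "\<bar>z\<bar> \<le> C"
  shows "\<bar>2 / pi * (r ^ j / real j) * z\<bar> \<le> C * r ^ j"
proof -
  have "2 / pi \<le> 1" using pi_gt3 by simp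
  moreover have "r ^ j / real j \<le> r ^ j"
    using assms by (cases "j = 0") (auto simp: divide_simps mult_le_cancel_left1)
  ultimately have "2 / pi * (r ^ j / real j) \<le> 1 * r ^ j"
    using assms by (intro mult_mono) auto
  then have "2 / pi * (r ^ j / real j) * \<bar>z\<bar> \<le> r ^ j * C"
    using assms by (intro mult_mono) auto
  then show ?thesis using assms by (simp add: abs_mult mult.commute)
qed

lemma abs_sin_coeff_le:
  assumes "bdd_meas g" "\<And>y. y \<in> {0..pi} \<Longrightarrow> \<bar>g y\<bar> \<le> C"
  shows "\<bar>sin_coeff g j\<bar> \<le> C * pi"
proof -
  have i: "integrable (lebesgue_on {0..pi}) (\<lambda>y. g y * sin (real j * y))"
    by (intro bdd_meas_integrable bdd_meas_mult assms bdd_meas_sin)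
  have "\<bar>sin_coeff g j\<bar> \<le> (LINT y|lebesgue_on {0..pi}. \<bar>g y * sin (real j * y)\<bar>)"
    unfolding sin_coeff_def using integral_norm_bound[of "lebesgue_on {0..pi}" "\<lambda>y. g y * sin (real j * y)"] by simp
  also have "\<dots> \<le> (LINT y|lebesgue_on {0..pi}. C)"
  proof (rule integral_mono)
    fix y assume "y \<in> space (lebesgue_on {0..pi})"
    then have "\<bar>g y\<bar> * \<bar>sin (real j * y)\<bar> \<le> C * 1"
      using assms(2)[of y] by (intro mult_mono) auto
    then show "\<bar>g y * sin (real j * y)\<bar> \<le> C" by (simp add: abs_mult)
  qed (use i finite_measure.integrable_const[OF finite_measure_Icc] in auto)
  also have "\<dots> = C * pi" by (simp add: measure_restrict_space)
  finally show ?thesis .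
qed

lemma Lambda_op_sums:
  assumes r: "0 \<le> r" "r < 1" and g: "bdd_meas g"
  shows "(\<lambda>j. 2 / pi * (r ^ j / real j) * (sin (real j * x) * sin_coeff g j)) sums Lambda_op r g x"
proof -
  obtain C where C: "\<forall>x\<in>{0..pi}. \<bar>g x\<bar> \<le> C" and gm: "g \<in> borel_measurable (lebesgue_on {0..pi})"
    using g by (auto simp: bdd_meas_def)
  have "(\<lambda>j. LINT y|lebesgue_on {0..pi}. 2 / pi * (r ^ j / real j) * (sin (real j * x) * sin (real j * y) * g y))
      sums (LINT y|lebesgue_on {0..pi}. odd_kernel r x y * g y)"
  proof (rule sums_integral_geometric[OF finite_measure.integrable_const[OF finite_measure_Icc]])
    show "(\<lambda>y. 2 / pi * (r ^ j / real j) * (sin (real j * x) * sin (real j * y) * g y)) \<in> borel_measurable (lebesgue_on {0..pi})" for j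
      by (intro borel_measurable_times gm sin_cos_measurable(1) borel_measurable_const)
    show "\<bar>2 / pi * (r ^ j / real j) * (sin (real j * x) * sin (real j * y) * g y)\<bar> \<le> C * r ^ j"
      if "y \<in> space (lebesgue_on {0..pi})" for j y
    proof (rule abs_coeff_le[OF r(1)])
      have "(\<bar>sin (real j * x)\<bar> * \<bar>sin (real j * y)\<bar>) * \<bar>g y\<bar> \<le> (1 * 1) * C"
        using that C by (intro mult_mono) auto
      then show "\<bar>sin (real j * x) * sin (real j * y) * g y\<bar> \<le> C" by (simp add: abs_mult)
    qed
    show "(\<lambda>j. 2 / pi * (r ^ j / real j) * (sin (real j * x) * sin (real j * y) * g y)) sums (odd_kernel r x y * g y)" for y
      using sums_mult2[OF odd_kernel_sums[OF r, of x y], of "g y"] by (simp add: mult_ac)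
  qed (use r in auto)
  moreover have "(LINT y|lebesgue_on {0..pi}. 2 / pi * (r ^ j / real j) * (sin (real j * x) * sin (real j * y) * g y))
     = 2 / pi * (r ^ j / real j) * (sin (real j * x) * sin_coeff g j)" for j
    unfolding sin_coeff_def
    by (simp flip: integral_mult_right_zero add: mult_ac)
  ultimately show ?thesis unfolding Lambda_op_def by (simp only:)
qed

text \<open>
  Both integrations are carried out termwise, and the result is visibly symmetric in \<open>g\<close> and \<open>h\<close> and
  nonnegative for \<open>g = h\<close>.  Thus no change of the order of integration is needed.
\<close>

lemma integral_Lambda_op_sums:
  assumes r: "0 \<le> r" "r < 1" and g: "bdd_meas g" and h: "bdd_meas h"
  shows "(\<lambda>j. 2 / pi * (r ^ j / real j) * (sin_coeff g j * sin_coeff h j)) sums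
           (LINT x|lebesgue_on {0..pi}. Lambda_op r g x * h x)" (is ?A)
    and "(\<lambda>x. Lambda_op r g x * h x) \<in> borel_measurable (lebesgue_on {0..pi})" (is ?B)
proof -
  obtain C where C: "\<forall>x\<in>{0..pi}. \<bar>g x\<bar> \<le> C"
    using g by (auto simp: bdd_meas_def)
  obtain D where D: "\<forall>x\<in>{0..pi}. \<bar>h x\<bar> \<le> D" and hm: "h \<in> borel_measurable (lebesgue_on {0..pi})"
    using h by (auto simp: bdd_meas_def)
  define f where "f j x = 2 / pi * (r ^ j / real j) * (sin_coeff g j * (h x * sin (real j * x)))" for j x
  have C0: "0 \<le> C" using C by force
  have fm: "f j \<in> borel_measurable (lebesgue_on {0..pi})" for j
    unfolding f_def by (intro borel_measurable_times hm sin_cos_measurable(1) borel_measurable_const)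
  have fb: "\<bar>f j x\<bar> \<le> (C * pi * D) * r ^ j" if "x \<in> space (lebesgue_on {0..pi})" for j x
    unfolding f_def
  proof (rule abs_coeff_le[OF r(1)])
    have "\<bar>sin_coeff g j\<bar> * (\<bar>h x\<bar> * \<bar>sin (real j * x)\<bar>) \<le> (C * pi) * (D * 1)"
      using that D C0 abs_sin_coeff_le[OF g, of C j] C by (intro mult_mono) auto
    then show "\<bar>sin_coeff g j * (h x * sin (real j * x))\<bar> \<le> C * pi * D" by (simp add: abs_mult)
  qed
  have fs: "(\<lambda>j. f j x) sums (Lambda_op r g x * h x)" for x
    using sums_mult2[OF Lambda_op_sums[OF r g, of x], of "h x"] by (simp add: f_def mult_ac)
  note * = sums_integral_geometric[OF finite_measure.integrable_const[OF finite_measure_Icc] fm fb r fs]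
  have "(LINT x|lebesgue_on {0..pi}. f j x) = 2 / pi * (r ^ j / real j) * (sin_coeff g j * sin_coeff h j)" for j
    unfolding f_def sin_coeff_def[of h] by simp
  then show ?A using *(1) by simp
  show ?B using *(2) .
qed

lemma Lambda_op_bdd_meas:
  assumes "bdd_meas g"
  shows "bdd_meas (Lambda_op 1 g)"
proof -
  have "(\<lambda>x. Lambda_op 1 g x) \<in> borel_measurable (lebesgue_on {0..pi})"
  proof (rule borel_measurable_LIMSEQ_real)
    show "(\<lambda>m. Lambda_op (abel_radius m) g x) \<longlonglongrightarrow> Lambda_op 1 g x" if "x \<in> space (lebesgue_on {0..pi})" for x
      using that Lambda_op_abel_lim assms by simp
    show "Lambda_op (abel_radius m) g \<in> borel_measurable (lebesgue_on {0..pi})" for m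
      using integral_Lambda_op_sums(2)[OF abel_bounds assms, of "\<lambda>_. 1"] continuous_bdd_meas[of "\<lambda>_. 1"] by simp
  qed
  moreover obtain C where C: "\<forall>x\<in>{0..pi}. \<bar>g x\<bar> \<le> C" using assms by (auto simp: bdd_meas_def)
  then have "\<forall>x\<in>{0..pi}. \<bar>Lambda_op 1 g x\<bar> \<le> kernel_mass * C" using abs_Lambda_op_le[of 1 g C] assms by simp
  ultimately show ?thesis by (auto simp: bdd_meas_def)
qed

lemma energy_form_lim:
  assumes g: "bdd_meas g" and h: "bdd_meas h"
  shows "(\<lambda>m. \<Sum>j. 2 / pi * (abel_radius m ^ j / real j) * (sin_coeff g j * sin_coeff h j)) \<longlonglongrightarrow> energy_form g h"
proof -
  obtain C where C: "\<forall>x\<in>{0..pi}. \<bar>g x\<bar> \<le> C" using g by (auto simp: bdd_meas_def)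
  obtain D where D: "\<forall>x\<in>{0..pi}. \<bar>h x\<bar> \<le> D" and hm: "h \<in> borel_measurable (lebesgue_on {0..pi})"
    using h by (auto simp: bdd_meas_def)
  have "(\<lambda>m. LINT x|lebesgue_on {0..pi}. Lambda_op (abel_radius m) g x * h x) \<longlonglongrightarrow> energy_form g h"
    unfolding energy_form_def
  proof (rule integral_dominated_convergence[where w="\<lambda>_. kernel_mass * C * D"])
    show "(\<lambda>x. Lambda_op 1 g x * h x) \<in> borel_measurable (lebesgue_on {0..pi})"
      using Lambda_op_bdd_meas[OF g] hm by (auto simp: bdd_meas_def)
    show "(\<lambda>x. Lambda_op (abel_radius m) g x * h x) \<in> borel_measurable (lebesgue_on {0..pi})" for m
      by (rule integral_Lambda_op_sums(2)[OF abel_bounds g h])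
    show "integrable (lebesgue_on {0..pi}) (\<lambda>_. kernel_mass * C * D)"
      by (rule finite_measure.integrable_const[OF finite_measure_Icc])
    show "AE x in lebesgue_on {0..pi}. norm (Lambda_op (abel_radius m) g x * h x) \<le> kernel_mass * C * D" for m
    proof (rule AE_I2)
      fix x assume "x \<in> space (lebesgue_on {0..pi})"
      then have x: "x \<in> {0..pi}" by simp
      have "\<bar>Lambda_op (abel_radius m) g x\<bar> \<le> kernel_mass * C" using abs_Lambda_op_le[OF _ _ g _ x, of _ C] C abel_bounds[of m] by simp
      then have "\<bar>Lambda_op (abel_radius m) g x\<bar> * \<bar>h x\<bar> \<le> (kernel_mass * C) * D"
        using D x by (intro mult_mono) auto
      then show "norm (Lambda_op (abel_radius m) g x * h x) \<le> kernel_mass * C * D" by (simp add: abs_mult)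
    qed
    show "AE x in lebesgue_on {0..pi}. (\<lambda>m. Lambda_op (abel_radius m) g x * h x) \<longlonglongrightarrow> Lambda_op 1 g x * h x"
      using Lambda_op_abel_lim[OF _ g] by (intro AE_I2 tendsto_intros) auto
  qed
  then show ?thesis
    using integral_Lambda_op_sums(1)[OF abel_bounds g h] by (simp add: sums_iff)
qed

lemma energy_form_commute:
  assumes "bdd_meas g" "bdd_meas h"
  shows "energy_form g h = energy_form h g"
  using LIMSEQ_unique[OF energy_form_lim[OF assms]] energy_form_lim[OF assms(2,1)] by (simp add: mult_ac)

lemma energy_form_nonneg:
  assumes "bdd_meas g"
  shows "0 \<le> energy_form g g"
proof (rule LIMSEQ_le_const[OF energy_form_lim[OF assms assms]], intro exI allI impI)
  fix m
  show "0 \<le> (\<Sum>j. 2 / pi * (abel_radius m ^ j / real j) * (sin_coeff g j * sin_coeff g j))"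
    by (intro suminf_nonneg sums_summable[OF integral_Lambda_op_sums(1)[OF abel_bounds assms assms]]
          mult_nonneg_nonneg[of "_ * _" "_ * _"]) (use abel_bounds[of m] in auto)
qed

lemma sin_coeff_sin:
  assumes "k \<ge> 1"
  shows "sin_coeff (\<lambda>y. sin (real k * y)) j = (if j = k then pi / 2 else 0)"
proof -
  have h: "(LINT y|lebesgue_on {0..pi}. cos (real_of_int i * y)) = (if i = 0 then pi else 0)" for i
  proof -
    have "continuous_on {0..pi} (\<lambda>y. cos (real_of_int i * y))" by (intro continuous_intros)
    then have int: "integrable (lebesgue_on {0..pi}) (\<lambda>y. cos (real_of_int i * y))"
      by (intro bdd_meas_integrable continuous_bdd_meas)
    have "((\<lambda>y. cos (real_of_int i * y)) has_integral (if i = 0 then pi else 0)) {0..pi}"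
    proof (cases "i = 0")
      case True
      then show ?thesis using has_integral_const_real[of "1::real" 0 pi] by simp
    next
      case False
      have "((\<lambda>y. cos (real_of_int i * y)) has_integral (sin (real_of_int i * pi) / i - sin (real_of_int i * 0) / i)) {0..pi}"
        using False by (intro fundamental_theorem_of_calculus)
           (auto intro!: derivative_eq_intros simp flip: has_real_derivative_iff_has_vector_derivative)
      then show ?thesis using False by (simp add: sin_int_times_real mult.commute)
    qed
    then show ?thesis using lebesgue_integral_eq_integral[OF int] by auto
  qed
  have i: "integrable (lebesgue_on {0..pi}) (\<lambda>y. cos (real_of_int i * y))" for i
    by (intro bdd_meas_integrable continuous_bdd_meas continuous_intros)
  have "sin_coeff (\<lambda>y. sin (real k * y)) j
      = (LINT y|lebesgue_on {0..pi}. (cos (real_of_int (int k - int j) * y) - cos (real_of_int (int k + int j) * y)) / 2)"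
    unfolding sin_coeff_def
    by (intro Bochner_Integration.integral_cong) (auto simp: sin_times_sin left_diff_distrib distrib_right)
  also have "\<dots> = ((if int k - int j = 0 then pi else 0) - (if int k + int j = 0 then pi else 0)) / 2"
    using i[of "int k - int j"] i[of "int k + int j"] h[of "int k - int j"] h[of "int k + int j"] by simp
  finally show ?thesis using assms by auto
qed

text \<open>
  By orthogonality of the sines only one term of the sine series is left.
\<close>

lemma Lambda_op_sin:
  assumes k: "k \<ge> 1" and x: "x \<in> {0..pi}"
  shows "Lambda_op 1 (\<lambda>y. sin (real k * y)) x = sin (real k * x) / real k"
proof -
  have "Lambda_op r (\<lambda>y. sin (real k * y)) x = r ^ k * sin (real k * x) / real k" if r: "0 \<le> r" "r < 1" for r
  proof -
    have "(\<lambda>j. if j = k then r ^ k * sin (real k * x) / real k else 0) sums Lambda_op r (\<lambda>y. sin (real k * y)) x"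
      using Lambda_op_sums[OF r bdd_meas_sin[of "real k"], of x]
      by (rule sums_cong[THEN iffD1, rotated]) (auto simp: sin_coeff_sin[OF k])
    then show ?thesis using sums_single[of k "\<lambda>_. r ^ k * sin (real k * x) / real k"] sums_unique2 by blast
  qed
  then have "(\<lambda>m. abel_radius m ^ k * sin (real k * x) / real k) \<longlonglongrightarrow> Lambda_op 1 (\<lambda>y. sin (real k * y)) x"
    using Lambda_op_abel_lim[OF x bdd_meas_sin[of "real k"]] abel_bounds by simp
  moreover have "(\<lambda>m. abel_radius m ^ k * sin (real k * x) / real k) \<longlonglongrightarrow> 1 ^ k * sin (real k * x) / real k"
    by (intro tendsto_intros abel_lim) (use k in auto)
  ultimately show ?thesis using LIMSEQ_unique by fastforce
qed

text \<open>
  Symmetry of the energy form moves \<open>\<Lambda>\<^sup>-\<^sup>1\<close> to the sine, which is an eigenfunction.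
\<close>

lemma sin_coeff_Lambda_op:
  assumes "bdd_meas g" "k \<ge> 1"
  shows "sin_coeff (Lambda_op 1 g) k = sin_coeff g k / real k"
proof -
  have "sin_coeff (Lambda_op 1 g) k = energy_form g (\<lambda>y. sin (real k * y))"
    by (simp add: sin_coeff_def energy_form_def)
  also have "\<dots> = energy_form (\<lambda>y. sin (real k * y)) g"
    by (rule energy_form_commute) (use assms in auto)
  also have "\<dots> = (LINT x|lebesgue_on {0..pi}. (g x * sin (real k * x)) / real k)"
    unfolding energy_form_def by (intro Bochner_Integration.integral_cong) (auto simp: Lambda_op_sin[OF assms(2)])
  finally show ?thesis by (simp add: sin_coeff_def)
qed

section \<open>Second differences of the kernel\<close>

lemma integrable_lebesgue_on_iff:
  fixes F :: "real \<Rightarrow> real"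
  shows "integrable (lebesgue_on {a..b}) F \<longleftrightarrow> F absolutely_integrable_on {a..b}"
  by (simp add: integrable_restrict_space set_integrable_def)

lemma integral_reflect_lebesgue_on:
  fixes F :: "real \<Rightarrow> real"
  assumes "integrable (lebesgue_on {0..a}) (\<lambda>t. F (- t))"
  shows "integrable (lebesgue_on {-a..0}) F"
    and "(LINT t|lebesgue_on {-a..0}. F t) = (LINT t|lebesgue_on {0..a}. F (- t))"
proof -
  have 1: "((\<lambda>t. F (- t)) has_integral (LINT t|lebesgue_on {0..a}. F (- t))) {0..a}"
    using has_integral_integral_lebesgue_on[OF assms] by simp
  have 2: "((\<lambda>t. \<bar>F (- t)\<bar>) has_integral (LINT t|lebesgue_on {0..a}. \<bar>F (- t)\<bar>)) {0..a}"
    using has_integral_integral_lebesgue_on[of "{0..a}" "\<lambda>t. \<bar>F (- t)\<bar>"] assms by simp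
  have 3: "(F has_integral (LINT t|lebesgue_on {0..a}. F (- t))) {-a..0}"
    by (rule has_integral_reflect_real[THEN iffD1]) (unfold minus_zero minus_minus, rule 1)
  have 4: "((\<lambda>t. \<bar>F t\<bar>) has_integral (LINT t|lebesgue_on {0..a}. \<bar>F (- t)\<bar>)) {-a..0}"
    by (rule has_integral_reflect_real[THEN iffD1]) (unfold minus_zero minus_minus, rule 2)
  show *: "integrable (lebesgue_on {-a..0}) F"
    unfolding integrable_lebesgue_on_iff
    using 3 4 by (intro absolutely_integrable_onI) (auto simp: has_integral_integrable)
  show "(LINT t|lebesgue_on {-a..0}. F t) = (LINT t|lebesgue_on {0..a}. F (- t))"
    using has_integral_integral_lebesgue_on[OF *] 3 has_integral_unique by auto
qed

lemma integral_combine_lebesgue_on: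
  fixes F :: "real \<Rightarrow> real"
  assumes "a \<le> b" "b \<le> c" "integrable (lebesgue_on {a..b}) F" "integrable (lebesgue_on {b..c}) F"
  shows "integrable (lebesgue_on {a..c}) F"
    and "(LINT t|lebesgue_on {a..c}. F t) = (LINT t|lebesgue_on {a..b}. F t) + (LINT t|lebesgue_on {b..c}. F t)"
proof -
  note 1 = has_integral_combine[OF assms(1,2) has_integral_integral_lebesgue_on[OF assms(3)]
      has_integral_integral_lebesgue_on[OF assms(4)]]
  have "integrable (lebesgue_on {a..b}) (\<lambda>t. \<bar>F t\<bar>)" "integrable (lebesgue_on {b..c}) (\<lambda>t. \<bar>F t\<bar>)"
    using assms by auto
  note 2 = has_integral_combine[OF assms(1,2) has_integral_integral_lebesgue_on[OF this(1)]
      has_integral_integral_lebesgue_on[OF this(2)]]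
  show *: "integrable (lebesgue_on {a..c}) F"
    unfolding integrable_lebesgue_on_iff
    using 1 2 by (intro absolutely_integrable_onI) (auto simp: has_integral_integrable)
  show "(LINT t|lebesgue_on {a..c}. F t) = (LINT t|lebesgue_on {a..b}. F t) + (LINT t|lebesgue_on {b..c}. F t)"
    using has_integral_integral_lebesgue_on[OF *] 1 has_integral_unique by auto
qed

lemma integrable_subinterval_lebesgue_on:
  fixes F :: "real \<Rightarrow> real"
  assumes "integrable (lebesgue_on {a..b}) F" "{c..d} \<subseteq> {a..b}"
  shows "integrable (lebesgue_on {c..d}) F"
  using assms unfolding integrable_lebesgue_on_iff
  by (meson absolutely_integrable_on_subinterval)

lemma integrable_log_kernel: "integrable (lebesgue_on {-pi..pi}) (log_kernel 1)"
proof -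
  have I: "integrable (lebesgue_on {-pi..pi}) (\<lambda>t. \<bar>t - 0\<bar> powr (- (1/2)))"
    by (rule integral_abs_powr[where R=pi]) auto
  have i2: "integrable (lebesgue_on {-pi..pi}) (\<lambda>t. 40 * \<bar>t\<bar> powr (- (1/2)) + 2)"
    using I finite_measure.integrable_const[OF finite_measure_Icc] by (auto intro!: Bochner_Integration.integrable_add)
  show ?thesis
  proof (rule Bochner_Integration.integrable_bound[OF i2])
    show "log_kernel 1 \<in> borel_measurable (lebesgue_on {-pi..pi})"
      by (intro borel_imp_lebesgue_on) measurable
    show "AE t in lebesgue_on {-pi..pi}. norm (log_kernel 1 t) \<le> norm (40 * \<bar>t\<bar> powr (- (1/2)) + 2)"
      using AE_lebesgue_on_neq[of 0 "-pi" pi] AE_space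
    proof eventually_elim
      case (elim t)
      then have t: "t \<noteq> 0" "\<bar>t\<bar> \<le> pi" by auto
      define z where "z = 20 / \<bar>t\<bar>"
      have z: "1 \<le> z" using t pi_less_4 by (auto simp: z_def field_simps)
      define D where "D = (sin (t / 2))\<^sup>2"
      have "\<bar>t / 2\<bar> / 10 \<le> \<bar>sin (t / 2)\<bar>" by (rule abs_sin_ge) (use t pi_less_4 in simp)
      then have "\<bar>t\<bar> / 20 \<le> \<bar>sin (t / 2)\<bar>" by simp
      then have "(\<bar>t\<bar> / 20)\<^sup>2 \<le> D"
        using power_mono[of "\<bar>t\<bar> / 20" "\<bar>sin (t / 2)\<bar>" 2] by (simp add: D_def)
      then have D: "(1 / z)\<^sup>2 \<le> D" by (simp add: z_def)
      have D1: "D \<le> 1" by (simp add: D_def abs_square_le_1)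
      have D0: "0 < D" using D z by (smt (verit) zero_less_divide_1_iff zero_less_power)
      have eq: "log_kernel 1 t = - (ln 4 + ln D) / (2 * pi)"
        using D0 by (simp add: log_kernel_def D_def ln_mult)
      have "- (2 * ln z) \<le> ln D" using ln_mono[OF D] D0 z by (simp add: ln_realpow ln_div)
      moreover have "ln z \<le> 10 * \<bar>t\<bar> powr (- (1/2))"
      proof -
        have "ln z \<le> z powr (1/2) / (1/2)" by (rule ln_powr_bound[OF z]) simp
        also have "\<dots> = 2 * (20 powr (1/2) * \<bar>t\<bar> powr (- (1/2)))"
          using t by (simp add: z_def powr_divide powr_minus divide_simps)
        also have "\<dots> \<le> 2 * (5 * \<bar>t\<bar> powr (- (1/2)))"
          using powr_mono2[of "1/2" 20 25] by (intro mult_left_mono mult_right_mono) (auto simp: powr_half_sqrt)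
        finally show ?thesis by simp
      qed
      moreover have "ln D \<le> 0" using D1 D0 by simp
      moreover have "0 \<le> ln (4::real)" "ln (4::real) \<le> 3" using ln_le_minus_one[of "4::real"] by auto
      ultimately have "\<bar>ln 4 + ln D\<bar> \<le> 20 * \<bar>t\<bar> powr (- (1/2)) + 3"
        by (smt (verit) powr_ge_zero)
      then have "\<bar>log_kernel 1 t\<bar> * (2 * pi) \<le> 20 * \<bar>t\<bar> powr (- (1/2)) + 3"
        unfolding eq by (simp add: abs_divide)
      moreover have "\<bar>log_kernel 1 t\<bar> * 2 \<le> \<bar>log_kernel 1 t\<bar> * (2 * pi)"
        using pi_gt3 by (intro mult_left_mono) auto
      ultimately have "\<bar>log_kernel 1 t\<bar> \<le> 40 * \<bar>t\<bar> powr (- (1/2)) + 2"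
        using powr_ge_zero[of "\<bar>t\<bar>" "-(1/2)"] by linarith
      then show ?case by simp
    qed
  qed
qed

lemma integrable_log_kernel_shift:
  "integrable (lebesgue_on {-pi..pi}) (\<lambda>t. log_kernel 1 (x - t))"
  "integrable (lebesgue_on {-pi..pi}) (\<lambda>t. log_kernel 1 (x + t))"
  "(LINT t|lebesgue_on {-pi..pi}. log_kernel 1 (x + t)) = (LINT t|lebesgue_on {-pi..pi}. log_kernel 1 t)"
proof -
  show "integrable (lebesgue_on {-pi..pi}) (\<lambda>t. log_kernel 1 (x - t))" for x
    by (rule integral_periodic_reflect(1)) (auto simp: integrable_log_kernel)
  from this[of "-x"] show "integrable (lebesgue_on {-pi..pi}) (\<lambda>t. log_kernel 1 (x + t))"
    using log_kernel_minus[of 1 "x + t" for t] by simp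
  have "(LINT t|lebesgue_on {-pi..pi}. log_kernel 1 (- x - t)) = (LINT t|lebesgue_on {-pi..pi}. log_kernel 1 t)"
    by (rule integral_periodic_reflect(2)) (auto simp: integrable_log_kernel)
  then show "(LINT t|lebesgue_on {-pi..pi}. log_kernel 1 (x + t)) = (LINT t|lebesgue_on {-pi..pi}. log_kernel 1 t)"
    using log_kernel_minus[of 1 "x + t" for t] by simp
qed

text \<open>
  The unfolded form, as a convolution over the whole circle: only here can translations in \<open>x\<close> be
  shifted to the other factor.
\<close>

lemma Lambda_op_full_circle:
  assumes f: "bdd_meas f" and odd: "\<And>x. f (- x) = - f x"
  shows "integrable (lebesgue_on {-pi..pi}) (\<lambda>t. log_kernel 1 (x - t) * f t)"
    and "Lambda_op 1 f x = (LINT t|lebesgue_on {-pi..pi}. log_kernel 1 (x - t) * f t)"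
proof -
  obtain C where C: "\<forall>x\<in>{0..pi}. \<bar>f x\<bar> \<le> C" and fm: "f \<in> borel_measurable (lebesgue_on {0..pi})"
    using f by (auto simp: bdd_meas_def)
  have *: "integrable (lebesgue_on {0..pi}) (\<lambda>t. G t * f t)"
    if G: "integrable (lebesgue_on {-pi..pi}) G" for G
  proof -
    have G': "integrable (lebesgue_on {0..pi}) G"
      by (rule integrable_subinterval_lebesgue_on[OF G]) auto
    then have "integrable (lebesgue_on {0..pi}) (\<lambda>t. G t * C)" by simp
    then show ?thesis
    proof (rule Bochner_Integration.integrable_bound)
      show "(\<lambda>t. G t * f t) \<in> borel_measurable (lebesgue_on {0..pi})"
        using G' fm by (intro borel_measurable_times) auto
      show "AE t in lebesgue_on {0..pi}. norm (G t * f t) \<le> norm (G t * C)"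
      proof (rule AE_I2)
        fix t assume "t \<in> space (lebesgue_on {0..pi})"
        then have "\<bar>f t\<bar> \<le> \<bar>C\<bar>" using C by force
        then show "norm (G t * f t) \<le> norm (G t * C)" by (simp add: abs_mult mult_left_mono)
      qed
    qed
  qed
  have i1: "integrable (lebesgue_on {0..pi}) (\<lambda>t. log_kernel 1 (x - t) * f t)"
    by (intro * integrable_log_kernel_shift)
  have i2: "integrable (lebesgue_on {0..pi}) (\<lambda>t. log_kernel 1 (x + t) * f t)"
    by (intro * integrable_log_kernel_shift)
  define F where "F t = log_kernel 1 (x - t) * f t" for t
  have i3: "integrable (lebesgue_on {0..pi}) (\<lambda>t. F (- t))"
    using i2 by (simp add: F_def odd)
  note r = integral_reflect_lebesgue_on[OF i3]
  note c = integral_combine_lebesgue_on[OF _ _ r(1), of pi]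
  show "integrable (lebesgue_on {-pi..pi}) (\<lambda>t. log_kernel 1 (x - t) * f t)"
    using c(1) i1 by (simp add: F_def[abs_def])
  have "(LINT t|lebesgue_on {-pi..pi}. F t) = (LINT t|lebesgue_on {0..pi}. F (- t)) + (LINT t|lebesgue_on {0..pi}. F t)"
    using c(2) i1 r(2) by (simp add: F_def[abs_def])
  also have "\<dots> = (LINT t|lebesgue_on {0..pi}. log_kernel 1 (x - t) * f t - log_kernel 1 (x + t) * f t)"
    using i1 i2 by (simp add: F_def odd)
  also have "\<dots> = Lambda_op 1 f x" by (simp add: Lambda_op_def odd_kernel_def left_diff_distrib)
  finally show "Lambda_op 1 f x = (LINT t|lebesgue_on {-pi..pi}. log_kernel 1 (x - t) * f t)"
    by (simp add: F_def)
qed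

lemma ln_one_plus_le_powr:
  fixes z e :: real
  assumes "0 < z" "0 < e" "e \<le> 1"
  shows "ln (1 + z) \<le> z powr e / e"
proof -
  have "(1 + z) powr e - z powr e \<le> (1 + z - z) powr e"
    by (rule powr_diff_le) (use assms in auto)
  then have le: "(1 + z) powr e \<le> 1 + z powr e" by simp
  have "e * ln (1 + z) = ln ((1 + z) powr e)" using assms by (simp add: ln_powr)
  also have "\<dots> \<le> ln (1 + z powr e)" using le assms by (intro ln_mono) auto
  also have "\<dots> \<le> z powr e" using ln_add_one_self_le_self[of "z powr e"] by simp
  finally show ?thesis using assms by (simp add: field_simps)
qed

text \<open>
  The two signs follow from \<open>\<bar>A - B\<bar> \<le> A (1 + B/A)\<close> and \<open>A \<le> \<bar>A - B\<bar> (1 + B/\<bar>A - B\<bar>)\<close>, since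
  \<open>ln (1 + z) \<le> z\<^sup>e / e\<close>.
\<close>

lemma abs_ln_diff_le:
  fixes A B e :: real
  assumes "0 < A" "0 < B" "A \<noteq> B" "0 < e" "e \<le> 1"
  shows "\<bar>ln A - ln \<bar>A - B\<bar>\<bar> \<le> ((B / A) powr e + (B / \<bar>A - B\<bar>) powr e) / e"
proof -
  have D: "0 < \<bar>A - B\<bar>" using assms by auto
  have "A * (1 + B / A) = A + B" using assms by (simp add: field_simps)
  then have "ln \<bar>A - B\<bar> \<le> ln (A * (1 + B / A))"
    using assms D by (intro ln_mono) auto
  also have "\<dots> = ln A + ln (1 + B / A)"
    using assms by (intro ln_mult_pos) (auto intro: add_pos_pos)
  finally have 1: "ln \<bar>A - B\<bar> - ln A \<le> (B / A) powr e / e"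
    using ln_one_plus_le_powr[of "B / A" e] assms by simp
  have "\<bar>A - B\<bar> * (1 + B / \<bar>A - B\<bar>) = \<bar>A - B\<bar> + B" using D by (simp add: field_simps)
  then have "ln A \<le> ln (\<bar>A - B\<bar> * (1 + B / \<bar>A - B\<bar>))"
    using assms D by (intro ln_mono) auto
  also have "\<dots> = ln \<bar>A - B\<bar> + ln (1 + B / \<bar>A - B\<bar>)"
    using assms D by (intro ln_mult_pos) (auto intro: add_pos_pos)
  finally have 2: "ln A - ln \<bar>A - B\<bar> \<le> (B / \<bar>A - B\<bar>) powr e / e"
    using ln_one_plus_le_powr[of "B / \<bar>A - B\<bar>" e] assms D by simp
  have "0 \<le> (B / A) powr e / e" "0 \<le> (B / \<bar>A - B\<bar>) powr e / e" using assms by auto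
  then show ?thesis using 1 2 by (simp add: add_divide_distrib)
qed

definition log_kernel_diff2 :: "real \<Rightarrow> real \<Rightarrow> real" where
  "log_kernel_diff2 h t = log_kernel 1 (t + h) + log_kernel 1 (t - h) - 2 * log_kernel 1 t"

lemma log_kernel_diff2_minus: "log_kernel_diff2 h (- t) = log_kernel_diff2 h t"
  using log_kernel_minus[of 1 "t - h"] log_kernel_minus[of 1 "t + h"] by (simp add: log_kernel_diff2_def)

text \<open>
  With \<open>A = sin\<^sup>2 (t/2)\<close> and \<open>B = sin\<^sup>2 (h/2)\<close> the identity \<open>sin ((t+h)/2) sin ((t-h)/2) = A - B\<close> turns the
  second difference into \<open>(ln A - ln \<bar>A - B\<bar>) / \<pi>\<close>.  The exponent \<open>e = a/2\<close> in \<open>abs_ln_diff_le\<close> produces the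
  factor \<open>h\<^sup>a\<close>, at the price of singularities at \<open>t = 0\<close> and \<open>t = h\<close>.  Near \<open>t = h\<close> only the factor
  \<open>\<bar>t - h\<bar>\<^bsup>-a/2\<^esup>\<close> is singular; the remaining factor \<open>(t+h)\<^bsup>\<gamma>-a/2\<^esup>\<close> is at most \<open>\<bar>t - h\<bar>\<^bsup>\<gamma>-a/2\<^esup>\<close> because \<open>\<gamma> < a/2\<close>.
\<close>

lemma log_kernel_diff2_pos_bound:
  assumes g: "0 \<le> \<gamma>" "\<gamma> < a / 2" "a - \<gamma> < 1"
    and h: "0 < h" "h \<le> 1" and t: "0 < t" "t \<le> pi" "t \<noteq> h"
  shows "\<bar>log_kernel_diff2 h t\<bar> * t powr \<gamma>
     \<le> 20 / a * 10 powr a * h powr a * (t powr (\<gamma> - a) + \<bar>t - h\<bar> powr (\<gamma> - a))"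
proof -
  define A where "A = (sin (t / 2))\<^sup>2"
  define B where "B = (sin (h / 2))\<^sup>2"
  define P where "P = sin ((t + h) / 2)"
  define Q where "Q = sin ((t - h) / 2)"
  have a: "0 < a" "a < 2" using g by auto
  have sl: "\<bar>x\<bar> / 20 \<le> \<bar>sin (x / 2)\<bar>" if "\<bar>x\<bar> \<le> 46/10" for x :: real
    using abs_sin_ge[of "x / 2"] that by simp
  have p: "pi < 36/10" using pi_less_4 pi_approx by simp
  have AB: "A - B = P * Q"
    using sin_half_squared_diff[of "(t + h) / 2" "(t - h) / 2"] by (simp add: A_def B_def P_def Q_def field_simps)
  have At: "t / 20 \<le> \<bar>sin (t / 2)\<bar>" using sl[of t] t p by auto
  have P0: "(t + h) / 20 \<le> \<bar>P\<bar>" using sl[of "t + h"] t h p by (auto simp: P_def)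
  have Q0: "\<bar>t - h\<bar> / 20 \<le> \<bar>Q\<bar>" using sl[of "t - h"] t h p by (auto simp: Q_def abs_if)
  have "h / 20 \<le> \<bar>sin (h / 2)\<bar>" using sl[of h] h by auto
  then have B0: "0 < B" using h by (auto simp: B_def)
  have A0: "0 < A" using At t by (auto simp: A_def)
  have PQ0: "0 < \<bar>P\<bar>" "0 < \<bar>Q\<bar>" using P0 Q0 t h by (smt (verit) divide_pos_pos)+
  have Bh: "B \<le> (h / 2)\<^sup>2"
    using abs_sin_x_le_abs_x[of "h / 2"] by (simp only: B_def abs_le_square_iff)
  have "log_kernel_diff2 h t = (2 * ln (4 * A) - ln (4 * P\<^sup>2) - ln (4 * Q\<^sup>2)) / (2 * pi)"
    by (simp add: log_kernel_diff2_def log_kernel_def A_def P_def Q_def add_divide_distrib diff_divide_distrib)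
  also have "2 * ln (4 * A) - ln (4 * P\<^sup>2) - ln (4 * Q\<^sup>2) = 2 * (ln A - ln (\<bar>P\<bar> * \<bar>Q\<bar>))"
  proof -
    have "ln (P\<^sup>2) = 2 * ln \<bar>P\<bar>" "ln (Q\<^sup>2) = 2 * ln \<bar>Q\<bar>"
      using ln_realpow[of "\<bar>P\<bar>" 2] ln_realpow[of "\<bar>Q\<bar>" 2] by auto
    then show ?thesis using A0 PQ0 by (simp add: ln_mult)
  qed
  finally have eq: "log_kernel_diff2 h t = (ln A - ln \<bar>A - B\<bar>) / pi"
    unfolding AB abs_mult by (simp add: field_simps)
  have AB': "A \<noteq> B" using AB PQ0 by auto
  have "\<bar>log_kernel_diff2 h t\<bar> \<le> \<bar>ln A - ln \<bar>A - B\<bar>\<bar> / 1"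
    unfolding eq abs_divide using pi_gt3 by (intro divide_left_mono) auto
  also have "\<dots> \<le> ((B / A) powr (a / 2) + (B / \<bar>A - B\<bar>) powr (a / 2)) / (a / 2)"
    using abs_ln_diff_le[OF A0 B0 AB', of "a / 2"] a by simp
  finally have 1: "\<bar>log_kernel_diff2 h t\<bar> \<le> 2 / a * ((B / A) powr (a / 2) + (B / \<bar>A - B\<bar>) powr (a / 2))"
    by (simp add: algebra_simps add_divide_distrib)
  have sq: "(z\<^sup>2) powr (a / 2) = z powr a" if "z > 0" for z :: real
  proof -
    have "z\<^sup>2 = z powr 2" using that powr_realpow[of z 2] by simp
    then show ?thesis by (simp add: powr_powr)
  qed
  have "B / A \<le> (10 * h / t)\<^sup>2"
  proof -
    have "(t / 20)\<^sup>2 \<le> A" using power_mono[OF At, of 2] t by (simp add: A_def)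
    then have "B / A \<le> (h / 2)\<^sup>2 / (t / 20)\<^sup>2" using Bh B0 t by (intro frac_le) auto
    then show ?thesis using t by (simp add: power2_eq_square field_simps)
  qed
  then have "(B / A) powr (a / 2) \<le> ((10 * h / t)\<^sup>2) powr (a / 2)"
    using A0 B0 a by (intro powr_mono2) auto
  also have "\<dots> = 10 powr a * h powr a * t powr (- a)"
    using h t by (simp add: sq powr_mult powr_divide powr_minus divide_simps)
  finally have "(B / A) powr (a / 2) * t powr \<gamma> \<le> 10 powr a * h powr a * t powr (- a) * t powr \<gamma>"
    by (rule mult_right_mono) auto
  moreover have "t powr (- a) * t powr \<gamma> = t powr (\<gamma> - a)" by (simp flip: powr_add)
  ultimately have 2: "(B / A) powr (a / 2) * t powr \<gamma> \<le> 10 powr a * h powr a * t powr (\<gamma> - a)"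
    by (simp add: mult.assoc)
  have "B / \<bar>A - B\<bar> \<le> (10 * h)\<^sup>2 / ((t + h) * \<bar>t - h\<bar>)"
  proof -
    have "((t + h) / 20) * (\<bar>t - h\<bar> / 20) \<le> \<bar>P\<bar> * \<bar>Q\<bar>"
      using P0 Q0 t h by (intro mult_mono) auto
    then have "B / \<bar>A - B\<bar> \<le> (h / 2)\<^sup>2 / (((t + h) / 20) * (\<bar>t - h\<bar> / 20))"
      unfolding AB abs_mult using Bh B0 t h by (intro frac_le) auto
    then show ?thesis using t h by (simp add: power2_eq_square field_simps)
  qed
  then have "(B / \<bar>A - B\<bar>) powr (a / 2) \<le> ((10 * h)\<^sup>2 / ((t + h) * \<bar>t - h\<bar>)) powr (a / 2)"
    using AB' B0 a by (intro powr_mono2) auto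
  also have "\<dots> = 10 powr a * h powr a * ((t + h) powr (- (a / 2)) * \<bar>t - h\<bar> powr (- (a / 2)))"
    using h t by (simp add: powr_divide powr_mult sq power_mult_distrib powr_minus divide_simps)
  finally have "(B / \<bar>A - B\<bar>) powr (a / 2) * t powr \<gamma>
     \<le> 10 powr a * h powr a * ((t + h) powr (- (a / 2)) * \<bar>t - h\<bar> powr (- (a / 2))) * (t + h) powr \<gamma>"
    using t h g by (intro mult_mono powr_mono2) auto
  also have "\<dots> = 10 powr a * h powr a * ((t + h) powr (\<gamma> - a / 2) * \<bar>t - h\<bar> powr (- (a / 2)))"
  proof -
    have "(t + h) powr (- (a / 2)) * (t + h) powr \<gamma> = (t + h) powr (\<gamma> - a / 2)"
      by (simp flip: powr_add)
    then show ?thesis by (simp add: mult_ac)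
  qed
  also have "\<dots> \<le> 10 powr a * h powr a * (\<bar>t - h\<bar> powr (\<gamma> - a / 2) * \<bar>t - h\<bar> powr (- (a / 2)))"
    using t h g by (intro mult_left_mono mult_right_mono powr_mono2') auto
  also have "\<bar>t - h\<bar> powr (\<gamma> - a / 2) * \<bar>t - h\<bar> powr (- (a / 2)) = \<bar>t - h\<bar> powr (\<gamma> - a)"
    by (simp flip: powr_add)
  finally have 3: "(B / \<bar>A - B\<bar>) powr (a / 2) * t powr \<gamma> \<le> 10 powr a * h powr a * \<bar>t - h\<bar> powr (\<gamma> - a)" .
  have "\<bar>log_kernel_diff2 h t\<bar> * t powr \<gamma> \<le> 2 / a * ((B / A) powr (a / 2) + (B / \<bar>A - B\<bar>) powr (a / 2)) * t powr \<gamma>"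
    using 1 by (intro mult_right_mono) auto
  also have "\<dots> = 2 / a * ((B / A) powr (a / 2) * t powr \<gamma> + (B / \<bar>A - B\<bar>) powr (a / 2) * t powr \<gamma>)"
    by (simp add: algebra_simps)
  also have "\<dots> \<le> 2 / a * (10 powr a * h powr a * t powr (\<gamma> - a) + 10 powr a * h powr a * \<bar>t - h\<bar> powr (\<gamma> - a))"
    using a by (intro mult_left_mono add_mono 2 3) auto
  also have "\<dots> = 2 / a * (10 powr a * h powr a * (t powr (\<gamma> - a) + \<bar>t - h\<bar> powr (\<gamma> - a)))"
    by (simp add: algebra_simps)
  also have "\<dots> \<le> 20 / a * (10 powr a * h powr a * (t powr (\<gamma> - a) + \<bar>t - h\<bar> powr (\<gamma> - a)))"
    using a by (intro mult_right_mono divide_right_mono) auto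
  finally show ?thesis by (simp add: mult.assoc)
qed

lemma log_kernel_diff2_bound:
  assumes g: "0 \<le> \<gamma>" "\<gamma> < a / 2" "a - \<gamma> < 1"
    and h: "0 < h" "h \<le> 1" and t: "t \<noteq> 0" "\<bar>t\<bar> \<le> pi" "t \<noteq> h" "t \<noteq> - h"
  shows "\<bar>log_kernel_diff2 h t\<bar> * \<bar>t\<bar> powr \<gamma>
     \<le> 20 / a * 10 powr a * h powr a * (\<bar>t - 0\<bar> powr (- (a - \<gamma>)) + \<bar>t - h\<bar> powr (- (a - \<gamma>)) + \<bar>t - - h\<bar> powr (- (a - \<gamma>)))"
proof -
  have a: "0 < a" using g by auto
  define c where "c = 20 / a * 10 powr a * h powr a"
  have c0: "0 \<le> c" using a by (auto simp: c_def)
  have *: "\<bar>log_kernel_diff2 h \<bar>t\<bar>\<bar> * \<bar>t\<bar> powr \<gamma> \<le> c * (\<bar>t\<bar> powr (\<gamma> - a) + \<bar>\<bar>t\<bar> - h\<bar> powr (\<gamma> - a))"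
    unfolding c_def by (rule log_kernel_diff2_pos_bound[OF g h]) (use t in auto)
  have e: "log_kernel_diff2 h \<bar>t\<bar> = log_kernel_diff2 h t"
    by (cases "t \<ge> 0") (auto simp: log_kernel_diff2_minus abs_if)
  have "\<bar>\<bar>t\<bar> - h\<bar> powr (\<gamma> - a) \<le> \<bar>t - h\<bar> powr (\<gamma> - a) + \<bar>t + h\<bar> powr (\<gamma> - a)"
    by (cases "t \<ge> 0") (auto simp: abs_minus_commute[of "- t" h] add.commute)
  then have "c * (\<bar>t\<bar> powr (\<gamma> - a) + \<bar>\<bar>t\<bar> - h\<bar> powr (\<gamma> - a)) \<le> c * (\<bar>t\<bar> powr (\<gamma> - a) + (\<bar>t - h\<bar> powr (\<gamma> - a) + \<bar>t + h\<bar> powr (\<gamma> - a)))"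
    using c0 by (intro mult_left_mono add_left_mono) auto
  with * show ?thesis by (simp add: e c_def add.assoc)
qed

lemma log_kernel_diff2_periodic: "log_kernel_diff2 h (t + 2 * pi) = log_kernel_diff2 h t"
  using log_kernel_periodic[of 1 "t + h"] log_kernel_periodic[of 1 "t - h"] log_kernel_periodic[of 1 t]
  by (simp add: log_kernel_diff2_def algebra_simps del: log_kernel_periodic)

text \<open>
  The second difference of the kernel has mean zero, so that \<open>f(x-t)\<close> may be replaced by \<open>f(x-t) - f(x)\<close>,
  and the Hoelder bound of \<open>f\<close> makes the singularity at \<open>t = 0\<close> integrable (\<open>a - \<gamma> < 1\<close>).  The constant does not
  depend on \<open>f\<close>; the equicontinuity of the power iteration relies on this.
\<close>

lemma Lambda_op_second_diff:
  assumes g: "0 \<le> \<gamma>" "\<gamma> < a / 2" "a - \<gamma> < 1"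
  shows "\<exists>C\<ge>0. \<forall>f B. bdd_meas f \<longrightarrow> (\<forall>x. f (- x) = - f x) \<longrightarrow> (\<forall>x. f (x + 2 * pi) = f x) \<longrightarrow>
     (\<forall>x y. \<bar>f x - f y\<bar> \<le> B * \<bar>x - y\<bar> powr \<gamma>) \<longrightarrow>
     (\<forall>x. \<forall>h\<in>{0<..1}. \<bar>Lambda_op 1 f (x + h) + Lambda_op 1 f (x - h) - 2 * Lambda_op 1 f x\<bar> \<le> C * B * h powr a)"
proof -
  define c where "c = a - \<gamma>"
  have c: "0 < c" "c < 1" using g by (auto simp: c_def)
  define R where "R = pi + 1"
  define I where "I = 2 * R powr (1 - c) / (1 - c)"
  define C1 where "C1 = 20 / a * 10 powr a"
  have C1: "0 \<le> C1" using g by (auto simp: C1_def)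
  have I0: "0 \<le> I" using c by (auto simp: I_def)
  have "\<bar>Lambda_op 1 f (x + h) + Lambda_op 1 f (x - h) - 2 * Lambda_op 1 f x\<bar> \<le> C1 * (3 * I) * B * h powr a"
    if f: "bdd_meas f" and odd: "\<And>x. f (- x) = - f x" and per: "\<And>x. f (x + 2 * pi) = f x"
      and hol: "\<And>x y. \<bar>f x - f y\<bar> \<le> B * \<bar>x - y\<bar> powr \<gamma>" and h: "0 < h" "h \<le> 1" for f B x h
  proof -
    let ?M = "lebesgue_on {-pi..pi}"
    let ?D = "log_kernel_diff2 h"
    have B0: "0 \<le> B" using hol[of 0 1] by simp
    have iD: "integrable ?M ?D"
      using integrable_log_kernel_shift(2)[of h] integrable_log_kernel_shift(2)[of "- h"] integrable_log_kernel
      by (auto simp: log_kernel_diff2_def[abs_def] add.commute)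
    have D0: "(LINT t|?M. ?D t) = 0"
      using integrable_log_kernel_shift(2,3)[of h] integrable_log_kernel_shift(2,3)[of "- h"] integrable_log_kernel
      by (simp add: log_kernel_diff2_def[abs_def] add.commute)
    note F = Lambda_op_full_circle[OF f odd]
    define G where "G t = ?D (x - t) * f t" for t
    have G_eq: "G t = log_kernel 1 (x + h - t) * f t + log_kernel 1 (x - h - t) * f t - 2 * (log_kernel 1 (x - t) * f t)" for t
      by (simp add: G_def log_kernel_diff2_def algebra_simps)
    have iG: "integrable ?M G"
      unfolding G_eq[abs_def] by (intro Bochner_Integration.integrable_add Bochner_Integration.integrable_diff
          integrable_mult_right F(1))
    have "integrable ?M (\<lambda>t. G (x - t))"
    proof (rule integral_periodic_reflect(1))
      show "G (t + 2 * pi) = G t" for t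
        using log_kernel_diff2_periodic[of h "x - (t + 2 * pi)"] by (simp add: G_def per)
    qed (rule iG)
    then have i: "integrable ?M (\<lambda>t. ?D t * f (x - t))" by (simp add: G_def)
    have iE: "integrable ?M (\<lambda>t. ?D t * (f (x - t) - f x))"
      using i iD by (simp add: right_diff_distrib)
    have "Lambda_op 1 f (x + h) + Lambda_op 1 f (x - h) - 2 * Lambda_op 1 f x = (LINT t|?M. G t)"
      unfolding G_eq F(2) using F(1) by simp
    also have "(LINT t|?M. G t) = (LINT t|?M. G (x - t))"
    proof (rule integral_periodic_reflect(2)[symmetric])
      show "G (t + 2 * pi) = G t" for t
        using log_kernel_diff2_periodic[of h "x - (t + 2 * pi)"] by (simp add: G_def per)
    qed (rule iG)
    also have "\<dots> = (LINT t|?M. ?D t * (f (x - t) - f x))"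
    proof -
      have "(LINT t|?M. ?D t * (f (x - t) - f x)) = (LINT t|?M. ?D t * f (x - t) - f x * ?D t)"
        by (simp add: algebra_simps)
      also have "\<dots> = (LINT t|?M. ?D t * f (x - t)) - f x * (LINT t|?M. ?D t)"
        using i iD by simp
      finally show ?thesis by (simp add: D0 G_def)
    qed
    finally have eq: "Lambda_op 1 f (x + h) + Lambda_op 1 f (x - h) - 2 * Lambda_op 1 f x = (LINT t|?M. ?D t * (f (x - t) - f x))" .
    \<comment> \<open>The integral of this dominating function is bounded uniformly in \<open>h\<close>.\<close>
    define N where "N t = \<bar>t - 0\<bar> powr (- c) + \<bar>t - h\<bar> powr (- c) + \<bar>t - - h\<bar> powr (- c)" for t
    have p: "integrable ?M (\<lambda>t. \<bar>t - d\<bar> powr (- c))" "(LINT t|?M. \<bar>t - d\<bar> powr (- c)) \<le> I" if "\<bar>d\<bar> \<le> 1" for d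
      using integral_abs_powr[OF c, of "-pi" pi d R] that unfolding I_def R_def by auto
    have iN: "integrable ?M N"
      unfolding N_def[abs_def] using p[of 0] p[of h] p[of "-h"] h by (intro Bochner_Integration.integrable_add) auto
    have N: "(LINT t|?M. N t) \<le> 3 * I"
      unfolding N_def using p[of 0] p[of h] p[of "-h"] h by simp
    have AE: "AE t in ?M. norm (?D t * (f (x - t) - f x)) \<le> C1 * h powr a * B * N t"
      using AE_lebesgue_on_neq[of 0 "-pi" pi] AE_lebesgue_on_neq[of h "-pi" pi] AE_lebesgue_on_neq[of "-h" "-pi" pi] AE_space
    proof eventually_elim
      case (elim t)
      then have t: "t \<noteq> 0" "\<bar>t\<bar> \<le> pi" "t \<noteq> h" "t \<noteq> - h" by auto
      have "norm (?D t * (f (x - t) - f x)) \<le> \<bar>?D t\<bar> * (B * \<bar>t\<bar> powr \<gamma>)"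
        using hol[of "x - t" x] by (auto simp: abs_mult intro!: mult_left_mono)
      also have "\<dots> = B * (\<bar>?D t\<bar> * \<bar>t\<bar> powr \<gamma>)" by simp
      also have "\<dots> \<le> B * (C1 * h powr a * N t)"
        using log_kernel_diff2_bound[OF g h t] B0 unfolding C1_def N_def c_def by (intro mult_left_mono) auto
      finally show ?case by (simp add: mult_ac)
    qed
    have iB: "integrable ?M (\<lambda>t. C1 * h powr a * B * N t)" using iN by simp
    have "\<bar>LINT t|?M. ?D t * (f (x - t) - f x)\<bar> \<le> (LINT t|?M. norm (?D t * (f (x - t) - f x)))"
      using integral_norm_bound[of ?M "\<lambda>t. ?D t * (f (x - t) - f x)"] by simp
    also have "\<dots> \<le> (LINT t|?M. C1 * h powr a * B * N t)"
      by (rule integral_mono_AE[OF integrable_norm[OF iE] iB AE])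
    also have "\<dots> = C1 * h powr a * B * (LINT t|?M. N t)" by simp
    also have "\<dots> \<le> C1 * h powr a * B * (3 * I)"
      using N C1 B0 by (intro mult_left_mono) auto
    finally show ?thesis unfolding eq by (simp add: mult_ac)
  qed
  then show ?thesis using C1 I0 by (intro exI[of _ "C1 * (3 * I)"]) auto
qed

text \<open>
  A first difference of step \<open>h\<close> is half of one of step \<open>2h\<close>, up to a second difference of step \<open>h\<close>.  In units
  of \<open>\<surd>h\<close> this is a recursion with the factor \<open>\<surd>2/2 < 1\<close>, hence the bound passes from step \<open>2h\<close> to step \<open>h\<close>.
\<close>

lemma holder_half_of_second_diff:
  fixes v :: "real \<Rightarrow> real"
  assumes bd: "\<And>x. \<bar>v x\<bar> \<le> M" and A: "0 \<le> A"
    and d: "\<And>x h. 0 < h \<Longrightarrow> h \<le> 1 \<Longrightarrow> \<bar>v (x + h) + v (x - h) - 2 * v x\<bar> \<le> A * h powr (1/2)"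
  shows "\<bar>v x - v y\<bar> \<le> 2 * (M + A) * \<bar>x - y\<bar> powr (1/2)"
proof -
  \<comment> \<open>\<open>B \<ge> 2M\<close> covers steps of length at least \<open>1\<close>, and \<open>B \<ge> 2A\<close> makes the halving step work.\<close>
  define B where "B = 2 * (M + A)"
  have M: "0 \<le> M" using bd[of 0] by auto
  \<comment> \<open>The number \<open>n\<close> counts the doublings that lead from \<open>h\<close> to a step of length at least \<open>1\<close>.\<close>
  have *: "\<bar>v (x + h) - v x\<bar> \<le> B * sqrt h" if "0 < h" "1 \<le> h * 2 ^ n" for n x h
    using that
  proof (induction n arbitrary: x h)
    case 0
    have "\<bar>v (x + h) - v x\<bar> \<le> 2 * M" using bd[of "x + h"] bd[of x] by linarith
    also have "\<dots> \<le> B * 1" using A by (simp add: B_def)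
    also have "\<dots> \<le> B * sqrt h" using 0 A M by (intro mult_left_mono) (auto simp: B_def)
    finally show ?case .
  next
    case (Suc n)
    show ?case
    proof (cases "h \<le> 1")
      case False
      have "\<bar>v (x + h) - v x\<bar> \<le> 2 * M" using bd[of "x + h"] bd[of x] by linarith
      also have "\<dots> \<le> B * 1" using A by (simp add: B_def)
      also have "\<dots> \<le> B * sqrt h" using False A M by (intro mult_left_mono) (auto simp: B_def)
      finally show ?thesis .
    next
      case True
      have ih: "\<bar>v (x + 2 * h) - v x\<bar> \<le> B * sqrt (2 * h)"
        using Suc.IH[of "2 * h" x] Suc.prems by simp
      have "\<bar>v (x + h + h) + v (x + h - h) - 2 * v (x + h)\<bar> \<le> A * h powr (1/2)"
        by (rule d) (use Suc.prems True in auto)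
      then have dd: "\<bar>v (x + 2 * h) + v x - 2 * v (x + h)\<bar> \<le> A * sqrt h"
        using Suc.prems by (simp add: powr_half_sqrt add.assoc flip: mult_2)
      have "2 * \<bar>v (x + h) - v x\<bar> \<le> B * sqrt (2 * h) + A * sqrt h"
        using ih dd by (smt (verit))
      also have "\<dots> \<le> B * (3/2 * sqrt h) + (B / 2) * sqrt h"
      proof (intro add_mono mult_left_mono mult_right_mono)
        have "sqrt 2 \<le> 3/2" by (rule real_le_lsqrt) (auto simp: power2_eq_square)
        then show "sqrt (2 * h) \<le> 3/2 * sqrt h"
          using Suc.prems by (simp add: real_sqrt_mult mult_right_mono)
      qed (use A M Suc.prems in \<open>auto simp: B_def\<close>)
      finally show ?thesis by simp
    qed
  qed
  have **: "\<bar>v (x + h) - v x\<bar> \<le> B * h powr (1/2)" if "h > 0" for x h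
  proof -
    obtain n where "1 / h < 2 ^ n" using real_arch_pow[of 2 "1 / h"] by auto
    then have "1 \<le> h * 2 ^ n" using that by (simp add: field_simps)
    then show ?thesis using *[of h n x] that by (simp add: powr_half_sqrt)
  qed
  consider "x < y" | "x = y" | "y < x" by linarith
  then show ?thesis
    using **[of "y - x" x] **[of "x - y" y]
    by cases (auto simp: B_def abs_minus_commute)
qed

text \<open>
  The difference quotients of steps \<open>h\<close> and \<open>h/2\<close> at \<open>x\<close> differ by a second difference divided by \<open>h\<close>, so
  the quotients for \<open>h, h/2, h/4, \<dots>\<close> converge geometrically, uniformly in \<open>x\<close>.  The limit is the derivative of
  \<open>v\<close>, because the quotients are the derivatives of averages of \<open>v\<close>, which converge to \<open>v\<close>.  It is Hoelder
  continuous, since the quotient at \<open>x\<close> of step \<open>y - x\<close> is also the quotient at \<open>y\<close> of step \<open>x - y\<close>.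
\<close>

lemma zygmund_C1:
  fixes v :: "real \<Rightarrow> real"
  assumes cont: "\<And>x. isCont v x" and A: "0 \<le> A" and b: "0 < b"
    and d: "\<And>x h. 0 < h \<Longrightarrow> h \<le> 1 \<Longrightarrow> \<bar>v (x + h) + v (x - h) - 2 * v x\<bar> \<le> A * h powr (1 + b)"
  shows "\<exists>w C. (\<forall>x. (v has_real_derivative w x) (at x)) \<and> 0 \<le> C \<and>
            (\<forall>x y. \<bar>x - y\<bar> \<le> 1 \<longrightarrow> \<bar>w x - w y\<bar> \<le> C * \<bar>x - y\<bar> powr b)"
proof -
  define D where "D h x = (v (x + h) - v x) / h" for h x
  define q where "q = (1/2::real) powr b"
  have q: "0 < q" "q < 1" using b powr_less_mono2[of b "1/2" 1] by (auto simp: q_def)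
  define C where "C = A / (1 - q)"
  have C0: "0 \<le> C" using A q by (simp add: C_def)
  have halve: "\<bar>D h x - D (h / 2) x\<bar> \<le> A * \<bar>h\<bar> powr b" if h: "h \<noteq> 0" "\<bar>h\<bar> \<le> 1" for h x
  proof -
    define k where "k = \<bar>h\<bar> / 2"
    have k: "0 < k" "k \<le> 1" using h by (auto simp: k_def)
    have "\<bar>v (x + h / 2 + k) + v (x + h / 2 - k) - 2 * v (x + h / 2)\<bar> \<le> A * k powr (1 + b)" by (rule d[OF k])
    moreover have "v (x + h / 2 + k) + v (x + h / 2 - k) = v (x + h) + v x"
      by (cases "h > 0") (auto simp: k_def add.commute)
    ultimately have "\<bar>v (x + h) + v x - 2 * v (x + h / 2)\<bar> \<le> A * k powr (1 + b)" by simp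
    also have "\<dots> \<le> A * (\<bar>h\<bar> * \<bar>h\<bar> powr b)"
    proof (intro mult_left_mono A)
      have "k powr (1 + b) \<le> \<bar>h\<bar> powr (1 + b)" using k b by (intro powr_mono2) (auto simp: k_def)
      then show "k powr (1 + b) \<le> \<bar>h\<bar> * \<bar>h\<bar> powr b" using h by (simp add: powr_add)
    qed
    finally have "\<bar>v (x + h) + v x - 2 * v (x + h / 2)\<bar> / \<bar>h\<bar> \<le> A * \<bar>h\<bar> powr b"
      using h by (simp add: field_simps)
    moreover have "D h x - D (h / 2) x = (v (x + h) + v x - 2 * v (x + h / 2)) / h"
      using h by (simp add: D_def field_simps)
    ultimately show ?thesis by (simp add: abs_divide)
  qed
  have tele: "\<bar>D h x - D (h / 2 ^ n) x\<bar> \<le> A * \<bar>h\<bar> powr b * (\<Sum>i<n. q ^ i)" if h: "h \<noteq> 0" "\<bar>h\<bar> \<le> 1" for h x n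
  proof (induction n)
    case (Suc n)
    have "\<bar>D (h / 2 ^ n) x - D (h / 2 ^ n / 2) x\<bar> \<le> A * \<bar>h / 2 ^ n\<bar> powr b"
    proof (rule halve)
      have "\<bar>h\<bar> \<le> 2 ^ n" using h(2) one_le_power[of "2::real" n] by linarith
      then show "\<bar>h / 2 ^ n\<bar> \<le> 1" by (simp add: abs_divide)
    qed (use h in auto)
    also have "\<bar>h / 2 ^ n\<bar> powr b = \<bar>h\<bar> powr b * q ^ n"
    proof -
      have "\<bar>h / 2 ^ n\<bar> = \<bar>h\<bar> * (1/2) ^ n" by (simp add: abs_divide power_divide)
      moreover have "((1/2::real) ^ n) powr b = q ^ n"
        by (induction n) (simp_all add: q_def powr_mult powr_divide)
      ultimately show ?thesis by (simp add: powr_mult)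
    qed
    finally have "\<bar>D (h / 2 ^ n) x - D (h / 2 ^ Suc n) x\<bar> \<le> A * \<bar>h\<bar> powr b * q ^ n" by (simp add: mult_ac)
    with Suc show ?case by (simp add: distrib_left) 
  qed simp
  have tele': "\<bar>D h x - D (h / 2 ^ n) x\<bar> \<le> C * \<bar>h\<bar> powr b" if h: "h \<noteq> 0" "\<bar>h\<bar> \<le> 1" for h x n
  proof -
    have "(\<Sum>i<n. q ^ i) \<le> (\<Sum>i. q ^ i)" using q by (intro sum_le_suminf summable_geometric) auto
    also have "\<dots> = 1 / (1 - q)" using q by (simp add: suminf_geometric)
    finally have "A * \<bar>h\<bar> powr b * (\<Sum>i<n. q ^ i) \<le> A * \<bar>h\<bar> powr b * (1 / (1 - q))"
      using A by (intro mult_left_mono) auto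
    with tele[OF h, of x n] show ?thesis by (simp add: C_def)
  qed
  define e where "e n = (1/2::real) ^ n" for n :: nat
  have e: "0 < e n" "e n \<le> 1" "e (m + n) = e m / 2 ^ n" for m n
    by (auto simp: e_def power_le_one power_add power_divide)
  have e_lim: "e \<longlonglongrightarrow> 0" unfolding e_def by (rule LIMSEQ_power_zero) auto
  have eb_lim: "(\<lambda>n. C * e n powr b) \<longlonglongrightarrow> 0"
    using tendsto_mult[OF tendsto_const tendsto_powr'[OF e_lim tendsto_const, of b], of C] b e(1)
    by (auto simp: less_imp_le)
  have De: "\<bar>D (e n) x - D (e m) x\<bar> \<le> C * e n powr b" if "n \<le> m" for n m x
    using tele'[of "e n" x "m - n"] e(1,2)[of n] e(3)[of n "m - n"] that by simp
  have "convergent (\<lambda>n. D (e n) x)" for x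
  proof (rule Cauchy_convergent, rule metric_CauchyI)
    fix r :: real assume "r > 0"
    then obtain N where N: "C * e N powr b < r / 2"
      using order_tendstoD(2)[OF eb_lim, of "r / 2"] by (auto simp: eventually_sequentially)
    have "dist (D (e m) x) (D (e n) x) < r" if "N \<le> m" "N \<le> n" for m n
      using De[OF that(1), of x] De[OF that(2), of x] N by (simp add: dist_real_def)
    then show "\<exists>N. \<forall>m\<ge>N. \<forall>n\<ge>N. dist (D (e m) x) (D (e n) x) < r" by blast
  qed
  then obtain w where w: "(\<lambda>n. D (e n) x) \<longlonglongrightarrow> w x" for x
    unfolding convergent_def by metis
  have wD: "\<bar>D (e n) x - w x\<bar> \<le> C * e n powr b" for n x
  proof (rule LIMSEQ_le_const2)
    show "(\<lambda>m. \<bar>D (e n) x - D (e m) x\<bar>) \<longlonglongrightarrow> \<bar>D (e n) x - w x\<bar>" by (intro tendsto_intros w)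
    show "\<exists>N. \<forall>m\<ge>N. \<bar>D (e n) x - D (e m) x\<bar> \<le> C * e n powr b" using De by blast
  qed
  have deriv: "(v has_real_derivative w x) (at x)" for x
  proof -
    obtain V where V: "\<And>y. y \<in> {x - 3..x + 3} \<Longrightarrow> (V has_vector_derivative v y) (at y within {x - 3..x + 3})"
      using antiderivative_continuous[of "x - 3" "x + 3" v] cont continuous_at_imp_continuous_on by blast
    have V': "(V has_real_derivative v y) (at y)" if "\<bar>y - x\<bar> \<le> 2" for y
      using V[of y] that at_within_interior[of y "{x - 3..x + 3}"]
      by (auto simp: has_real_derivative_iff_has_vector_derivative abs_le_iff)
    define S where "S = {x - 1..x + 1}"
    \<comment> \<open>\<open>F n\<close> averages \<open>v\<close> over an interval of length \<open>e n\<close>, and its derivative is the difference quotient of \<open>v\<close>.\<close>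
    define F where "F n y = (V (y + e n) - V y) / e n" for n y
    have F': "(F n has_derivative (\<lambda>h. D (e n) y * h)) (at y within S)" if "y \<in> S" for n y
    proof -
      have y: "\<bar>y - x\<bar> \<le> 2" "\<bar>y + e n - x\<bar> \<le> 2" using that e(1,2)[of n] by (auto simp: S_def abs_le_iff)
      have "((\<lambda>y. V (y + e n)) has_real_derivative v (y + e n)) (at y)"
        using DERIV_shift[of V "v (y + e n)" y "e n"] V'[OF y(2)] by simp
      then have "(F n has_real_derivative D (e n) y) (at y)"
        unfolding F_def D_def by (intro DERIV_cdivide DERIV_diff V'[OF y(1)])
      then show ?thesis by (simp add: has_field_derivative_def has_derivative_at_withinI mult_commute_abs)
    qed
    have lim: "(\<lambda>n. F n y) \<longlonglongrightarrow> v y" if "y \<in> S" for y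
    proof -
      have "((\<lambda>h. (V (y + h) - V y) / h) \<longlongrightarrow> v y) (at 0)"
        using V'[of y] that by (auto simp: S_def DERIV_def abs_le_iff)
      moreover have "filterlim e (at 0) sequentially"
        using e_lim e(1) by (intro filterlim_atI) (auto intro!: eventuallyI simp: less_imp_neq[OF e(1), symmetric])
      ultimately show ?thesis unfolding F_def by (rule filterlim_compose)
    qed
    have "\<exists>g. \<forall>y\<in>S. (\<lambda>n. F n y) \<longlonglongrightarrow> g y \<and> (g has_derivative (\<lambda>h. w y * h)) (at y within S)"
    proof (rule has_derivative_sequence[where f' = "\<lambda>n y h. D (e n) y * h" and ?x0.0 = x and l = "v x"])
      show "\<forall>\<^sub>F n in sequentially. \<forall>y\<in>S. \<forall>h. norm (D (e n) y * h - w y * h) \<le> r * norm h" if "r > 0" for r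
        using order_tendstoD(2)[OF eb_lim that]
      proof eventually_elim
        case (elim n)
        then show ?case using wD[of n]
          by (auto simp: abs_mult simp flip: left_diff_distrib intro!: mult_right_mono order_trans[OF wD])
      qed
    qed (use F' lim in \<open>auto simp: S_def\<close>)
    then obtain g where g: "\<And>y. y \<in> S \<Longrightarrow> (\<lambda>n. F n y) \<longlonglongrightarrow> g y"
      "\<And>y. y \<in> S \<Longrightarrow> (g has_derivative (\<lambda>h. w y * h)) (at y within S)" by blast
    have gv: "g y = v y" if "y \<in> S" for y using g(1)[OF that] lim[OF that] LIMSEQ_unique by blast
    have "(v has_derivative (\<lambda>h. w x * h)) (at x within S)"
      by (rule has_derivative_transform[OF _ _ g(2)]) (auto simp: S_def gv[unfolded S_def])
    moreover have "at x within S = at x" by (rule at_within_interior) (auto simp: S_def)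
    ultimately show ?thesis by (simp add: has_field_derivative_def mult_commute_abs)
  qed
  have wD': "\<bar>D h x - w x\<bar> \<le> C * \<bar>h\<bar> powr b" if h: "h \<noteq> 0" "\<bar>h\<bar> \<le> 1" for h x
  proof (rule LIMSEQ_le_const2)
    have "((\<lambda>h. (v (x + h) - v x) / h) \<longlongrightarrow> w x) (at 0)" using deriv[of x] by (simp add: DERIV_def)
    moreover have "(\<lambda>n. h * e n) \<longlonglongrightarrow> h * 0" by (intro tendsto_intros e_lim)
    then have "filterlim (\<lambda>n. h / 2 ^ n) (at 0) sequentially"
      using h by (intro filterlim_atI) (auto simp: e_def power_divide)
    ultimately have "(\<lambda>n. D (h / 2 ^ n) x) \<longlonglongrightarrow> w x" unfolding D_def by (rule filterlim_compose)
    then show "(\<lambda>n. \<bar>D h x - D (h / 2 ^ n) x\<bar>) \<longlonglongrightarrow> \<bar>D h x - w x\<bar>" by (intro tendsto_intros)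
    show "\<exists>N. \<forall>n\<ge>N. \<bar>D h x - D (h / 2 ^ n) x\<bar> \<le> C * \<bar>h\<bar> powr b" using tele'[OF h] by blast
  qed
  have "\<bar>w x - w y\<bar> \<le> (2 * C) * \<bar>x - y\<bar> powr b" if "\<bar>x - y\<bar> \<le> 1" for x y
  proof (cases "x = y")
    case False
    have "D (y - x) x = D (x - y) y"
      using False by (simp add: D_def divide_simps) (simp add: algebra_simps)
    then show ?thesis
      using wD'[of "y - x" x] wD'[of "x - y" y] False that by (simp add: abs_minus_commute)
  qed simp
  then show ?thesis using deriv C0 by (intro exI[of _ w] exI[of _ "2 * C"]) auto
qed

section \<open>Hoelder regularity of the potential\<close>

text \<open>
  Every point is congruent to some \<open>z \<in> [-\<pi>,\<pi>]\<close> modulo \<open>2\<pi>\<close>.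
\<close>

lemma odd_periodic_bound:
  fixes F :: "real \<Rightarrow> real"
  assumes odd: "\<And>x. F (- x) = - F x" and per: "\<And>x. F (x + 2 * pi) = F x"
    and b: "\<And>y. y \<in> {0..pi} \<Longrightarrow> \<bar>F y\<bar> \<le> C"
  shows "\<bar>F x\<bar> \<le> C"
proof -
  define k where "k = \<lfloor>(x + pi) / (2 * pi)\<rfloor>"
  define z where "z = x - of_int k * (2 * pi)"
  have "of_int k \<le> (x + pi) / (2 * pi)" "(x + pi) / (2 * pi) < of_int k + 1"
    unfolding k_def by linarith+
  then have z: "- pi \<le> z" "z \<le> pi" by (auto simp: z_def field_simps)
  have "F x = F z"
    using periodic_integer_shift[of F "2 * pi" z k, OF per] by (simp add: z_def)
  then show ?thesis using b[of z] b[of "- z"] odd[of z] z by (cases "0 \<le> z") auto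
qed

lemma odd_periodic_eqI:
  fixes F G :: "real \<Rightarrow> real"
  assumes "\<And>x. F (- x) = - F x" "\<And>x. F (x + 2 * pi) = F x"
    and "\<And>x. G (- x) = - G x" "\<And>x. G (x + 2 * pi) = G x"
    and "\<And>y. y \<in> {0..pi} \<Longrightarrow> F y = G y"
  shows "F x = G x"
proof -
  have "\<bar>F x - G x\<bar> \<le> 0"
    by (rule odd_periodic_bound[of "\<lambda>x. F x - G x"]) (simp_all add: assms)
  then show ?thesis by simp
qed

lemma Lambda_op_cong: "(\<And>y. y \<in> {0..pi} \<Longrightarrow> f y = g y) \<Longrightarrow> Lambda_op r f x = Lambda_op r g x"
  unfolding Lambda_op_def by (intro Bochner_Integration.integral_cong) auto

lemma bdd_meas_bound:
  assumes "bdd_meas f" obtains M where "0 \<le> M" "\<And>y. y \<in> {0..pi} \<Longrightarrow> \<bar>f y\<bar> \<le> M"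
proof -
  obtain M where M: "\<forall>x\<in>{0..pi}. \<bar>f x\<bar> \<le> M" using assms by (auto simp: bdd_meas_def)
  then have "0 \<le> M" by force
  then show ?thesis using that M by blast
qed

text \<open>
  The case \<open>\<gamma> = 0\<close>, \<open>a = 1/2\<close> of \<open>Lambda_op_second_diff\<close>: for a bounded function \<open>\<bar>f x - f y\<bar> \<le> 2M \<bar>x - y\<bar>\<^sup>0\<close>,
  also for \<open>x = y\<close>, where both sides are \<open>0\<close>.
\<close>

lemma Lambda_op_holder_half:
  "\<exists>C\<ge>0. \<forall>f M. bdd_meas f \<longrightarrow> (\<forall>x. f (- x) = - f x) \<longrightarrow> (\<forall>x. f (x + 2 * pi) = f x) \<longrightarrow>
     (\<forall>y\<in>{0..pi}. \<bar>f y\<bar> \<le> M) \<longrightarrow> (\<forall>x y. \<bar>Lambda_op 1 f x - Lambda_op 1 f y\<bar> \<le> C * M * \<bar>x - y\<bar> powr (1/2))"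
proof -
  have "\<exists>C\<ge>0. \<forall>f B. bdd_meas f \<longrightarrow> (\<forall>x. f (- x) = - f x) \<longrightarrow> (\<forall>x. f (x + 2 * pi) = f x) \<longrightarrow>
     (\<forall>x y. \<bar>f x - f y\<bar> \<le> B * \<bar>x - y\<bar> powr 0) \<longrightarrow>
     (\<forall>x. \<forall>h\<in>{0<..1}. \<bar>Lambda_op 1 f (x + h) + Lambda_op 1 f (x - h) - 2 * Lambda_op 1 f x\<bar> \<le> C * B * h powr (1/2))"
    by (rule Lambda_op_second_diff) auto
  then obtain C1 where C1: "0 \<le> C1" "\<forall>f B. bdd_meas f \<longrightarrow> (\<forall>x. f (- x) = - f x) \<longrightarrow> (\<forall>x. f (x + 2 * pi) = f x) \<longrightarrow>
     (\<forall>x y. \<bar>f x - f y\<bar> \<le> B * \<bar>x - y\<bar> powr 0) \<longrightarrow>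
     (\<forall>x. \<forall>h\<in>{0<..1}. \<bar>Lambda_op 1 f (x + h) + Lambda_op 1 f (x - h) - 2 * Lambda_op 1 f x\<bar> \<le> C1 * B * h powr (1/2))"
    by blast
  have "\<bar>Lambda_op 1 f x - Lambda_op 1 f y\<bar> \<le> (2 * (kernel_mass + 2 * C1)) * M * \<bar>x - y\<bar> powr (1/2)"
    if f: "bdd_meas f" "\<forall>x. f (- x) = - f x" "\<forall>x. f (x + 2 * pi) = f x" and M: "\<forall>y\<in>{0..pi}. \<bar>f y\<bar> \<le> M" for f M x y
  proof -
    have M0: "0 \<le> M" using M by force
    have fb: "\<bar>f x\<bar> \<le> M" for x by (rule odd_periodic_bound) (use f M in auto)
    have "\<bar>f x - f y\<bar> \<le> 2 * M * \<bar>x - y\<bar> powr 0" for x y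
      using fb[of x] fb[of y] by (cases "x = y") auto
    then have d: "\<bar>Lambda_op 1 f (x + h) + Lambda_op 1 f (x - h) - 2 * Lambda_op 1 f x\<bar> \<le> C1 * (2 * M) * h powr (1/2)"
      if "0 < h" "h \<le> 1" for x h
      using C1(2)[THEN spec[of _ f], THEN spec[of _ "2 * M"]] f that by auto
    have "\<bar>Lambda_op 1 f x\<bar> \<le> kernel_mass * M" if "x \<in> {0..pi}" for x
      using abs_Lambda_op_le[of 1 f M x] f(1) M that by simp
    then have "\<bar>Lambda_op 1 f x\<bar> \<le> kernel_mass * M" for x
      using odd_periodic_bound[of "Lambda_op 1 f" "kernel_mass * M" x] by simp
    from holder_half_of_second_diff[OF this _ d] show ?thesis
      using C1(1) M0 by (simp add: algebra_simps)
  qed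
  moreover have "0 \<le> kernel_mass"
    using abs_Lambda_op_le[of 1 "\<lambda>_. 0" 1 0] continuous_bdd_meas[of "\<lambda>_. 0"] by simp
  ultimately show ?thesis using C1(1) by (intro exI[of _ "2 * (kernel_mass + 2 * C1)"]) auto
qed

lemma holder_isCont:
  fixes f :: "real \<Rightarrow> real"
  assumes "0 < b" "\<And>x y. \<bar>x - y\<bar> \<le> 1 \<Longrightarrow> \<bar>f x - f y\<bar> \<le> C * \<bar>x - y\<bar> powr b"
  shows "isCont f x"
proof -
  have "((\<lambda>y. C * \<bar>y - x\<bar> powr b) \<longlongrightarrow> C * \<bar>x - x\<bar> powr b) (at x)"
    using assms(1) by (intro tendsto_intros tendsto_powr') (auto intro!: always_eventually tendsto_eq_intros)
  then have "((\<lambda>y. C * \<bar>y - x\<bar> powr b) \<longlongrightarrow> 0) (at x)" using assms(1) by simp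
  moreover have "\<forall>\<^sub>F y in at x. norm (f y - f x) \<le> C * \<bar>y - x\<bar> powr b"
    unfolding eventually_at by (rule exI[of _ 1]) (use assms(2) in \<open>auto simp: dist_real_def\<close>)
  ultimately have "((\<lambda>y. f y - f x) \<longlongrightarrow> 0) (at x)" by (rule Lim_null_comparison[rotated])
  then show ?thesis unfolding isCont_def by (rule LIM_zero_cancel)
qed

lemma Lambda_op_holder:
  assumes f: "bdd_meas f" "\<And>x. f (- x) = - f x" "\<And>x. f (x + 2 * pi) = f x"
  shows "\<exists>D\<ge>0. \<forall>x y. \<bar>Lambda_op 1 f x - Lambda_op 1 f y\<bar> \<le> D * \<bar>x - y\<bar> powr (1/2)"
proof -
  obtain M where M: "0 \<le> M" "\<And>y. y \<in> {0..pi} \<Longrightarrow> \<bar>f y\<bar> \<le> M" using bdd_meas_bound[OF f(1)] by blast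
  obtain C where C0: "0 \<le> C" and C: "\<forall>f M. bdd_meas f \<longrightarrow> (\<forall>x. f (- x) = - f x) \<longrightarrow> (\<forall>x. f (x + 2 * pi) = f x) \<longrightarrow>
     (\<forall>y\<in>{0..pi}. \<bar>f y\<bar> \<le> M) \<longrightarrow> (\<forall>x y. \<bar>Lambda_op 1 f x - Lambda_op 1 f y\<bar> \<le> C * M * \<bar>x - y\<bar> powr (1/2))"
    using Lambda_op_holder_half by blast
  have "\<bar>Lambda_op 1 f x - Lambda_op 1 f y\<bar> \<le> C * M * \<bar>x - y\<bar> powr (1/2)" for x y
    using C[THEN spec[of _ f], THEN spec[of _ M]] f M by auto
  then show ?thesis using C0 M(1) by (intro exI[of _ "C * M"]) auto
qed

lemma isCont_Lambda_op:
  assumes f: "bdd_meas f" "\<And>x. f (- x) = - f x" "\<And>x. f (x + 2 * pi) = f x"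
  shows "isCont (Lambda_op 1 f) x"
proof -
  obtain D where "\<forall>x y. \<bar>Lambda_op 1 f x - Lambda_op 1 f y\<bar> \<le> D * \<bar>x - y\<bar> powr (1/2)"
    using Lambda_op_holder[OF f] by blast
  then show ?thesis by (intro holder_isCont[of "1/2" _ D]) auto
qed

lemma periodic_holder_global:
  fixes w :: "real \<Rightarrow> real"
  assumes b: "0 < b" and C: "0 \<le> C" and per: "\<And>x. w (x + 2 * pi) = w x"
    and loc: "\<And>x y. \<bar>x - y\<bar> \<le> 1 \<Longrightarrow> \<bar>w x - w y\<bar> \<le> C * \<bar>x - y\<bar> powr b"
  shows "\<exists>C. \<forall>x y. \<bar>w x - w y\<bar> \<le> C * \<bar>x - y\<bar> powr b" and "\<exists>B. \<forall>x. \<bar>w x\<bar> \<le> B"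
proof -
  have cont: "isCont w x" for x by (rule holder_isCont[OF b loc])
  have "compact (w ` {0..2 * pi})"
    using cont by (intro compact_continuous_image continuous_at_imp_continuous_on) auto
  then obtain B where B: "\<forall>x\<in>{0..2*pi}. \<bar>w x\<bar> \<le> B"
    using compact_imp_bounded bounded_real by (metis (no_types) imageI)
  have Bx: "\<bar>w x\<bar> \<le> B" for x
  proof -
    define k where "k = \<lfloor>x / (2 * pi)\<rfloor>"
    have "of_int k \<le> x / (2 * pi)" "x / (2 * pi) < of_int k + 1" unfolding k_def by linarith+
    then have "x - of_int k * (2 * pi) \<in> {0..2 * pi}" by (auto simp: field_simps)
    moreover have "w x = w (x - of_int k * (2 * pi))"
      using periodic_integer_shift[of w "2 * pi" "x - of_int k * (2 * pi)" k] per by simp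
    ultimately show ?thesis using B by simp
  qed
  then show "\<exists>B. \<forall>x. \<bar>w x\<bar> \<le> B" by blast
  have "\<bar>w x - w y\<bar> \<le> max C (2 * B) * \<bar>x - y\<bar> powr b" for x y
  proof (cases "\<bar>x - y\<bar> \<le> 1")
    case True
    then have "\<bar>w x - w y\<bar> \<le> C * \<bar>x - y\<bar> powr b" by (rule loc)
    also have "\<dots> \<le> max C (2 * B) * \<bar>x - y\<bar> powr b" by (intro mult_right_mono) auto
    finally show ?thesis .
  next
    case False
    then have "1 \<le> \<bar>x - y\<bar> powr b" using b by (intro ge_one_powr_ge_zero) auto
    then have "max C (2 * B) * 1 \<le> max C (2 * B) * \<bar>x - y\<bar> powr b" using C by (intro mult_left_mono) auto
    moreover have "2 * B \<le> max C (2 * B)" by simp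
    ultimately show ?thesis using Bx[of x] Bx[of y] by linarith
  qed
  then show "\<exists>C. \<forall>x y. \<bar>w x - w y\<bar> \<le> C * \<bar>x - y\<bar> powr b" by blast
qed

lemma Lambda_op_C1:
  assumes f: "bdd_meas f" "\<And>x. f (- x) = - f x" "\<And>x. f (x + 2 * pi) = f x"
    and hol: "\<And>x y. \<bar>f x - f y\<bar> \<le> B * \<bar>x - y\<bar> powr \<gamma>"
    and g: "0 \<le> \<gamma>" and a: "1 < a" "\<gamma> < a / 2" "a - \<gamma> < 1"
  obtains w C where "\<And>x. (Lambda_op 1 f has_real_derivative w x) (at x)"
    and "\<And>x y. \<bar>w x - w y\<bar> \<le> C * \<bar>x - y\<bar> powr (a - 1)"
    and "\<And>x. w (x + 2 * pi) = w x" and "\<exists>B. \<forall>x. \<bar>w x\<bar> \<le> B"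
proof -
  have B: "0 \<le> B" using hol[of 0 1] by simp
  obtain C where C: "0 \<le> C" "\<forall>x. \<forall>h\<in>{0<..1}. \<bar>Lambda_op 1 f (x + h) + Lambda_op 1 f (x - h) - 2 * Lambda_op 1 f x\<bar> \<le> C * B * h powr a"
  proof -
    obtain C where "0 \<le> C" and C: "\<forall>f B. bdd_meas f \<longrightarrow> (\<forall>x. f (- x) = - f x) \<longrightarrow> (\<forall>x. f (x + 2 * pi) = f x) \<longrightarrow>
     (\<forall>x y. \<bar>f x - f y\<bar> \<le> B * \<bar>x - y\<bar> powr \<gamma>) \<longrightarrow>
     (\<forall>x. \<forall>h\<in>{0<..1}. \<bar>Lambda_op 1 f (x + h) + Lambda_op 1 f (x - h) - 2 * Lambda_op 1 f x\<bar> \<le> C * B * h powr a)"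
      using Lambda_op_second_diff[OF g a(2,3)] by blast
    then show ?thesis
      using that[of C] C[THEN spec[of _ f], THEN spec[of _ B]] f hol by auto
  qed
  have "\<exists>w C. (\<forall>x. (Lambda_op 1 f has_real_derivative w x) (at x)) \<and> 0 \<le> C \<and>
            (\<forall>x y. \<bar>x - y\<bar> \<le> 1 \<longrightarrow> \<bar>w x - w y\<bar> \<le> C * \<bar>x - y\<bar> powr (a - 1))"
    by (rule zygmund_C1[where A="C * B"]) (use isCont_Lambda_op[OF f] C B a in auto)
  then obtain w D where w: "\<And>x. (Lambda_op 1 f has_real_derivative w x) (at x)" "0 \<le> D"
    "\<And>x y. \<bar>x - y\<bar> \<le> 1 \<Longrightarrow> \<bar>w x - w y\<bar> \<le> D * \<bar>x - y\<bar> powr (a - 1)" by blast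
  have per: "w (x + 2 * pi) = w x" for x
  proof -
    have "((\<lambda>x. Lambda_op 1 f (x + 2 * pi)) has_real_derivative w (x + 2 * pi)) (at x)"
      using DERIV_shift[of "Lambda_op 1 f" _ x "2 * pi"] w(1) by blast
    then show ?thesis using w(1)[of x] DERIV_unique by simp blast
  qed
  have a1: "0 < a - 1" using a by simp
  note periodic_holder_global[OF a1 w(2) per w(3)]
  then show ?thesis using that w(1) per by blast
qed

section \<open>The energy form\<close>

lemma energy_form_diff_left:
  assumes "bdd_meas g" "bdd_meas h" "bdd_meas k"
  shows "energy_form (\<lambda>x. g x - h x) k = energy_form g k - energy_form h k"
proof -
  have "energy_form (\<lambda>x. g x - h x) k = (LINT x|lebesgue_on {0..pi}. Lambda_op 1 g x * k x - Lambda_op 1 h x * k x)"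
    unfolding energy_form_def using assms
    by (intro Bochner_Integration.integral_cong) (auto simp: Lambda_op_diff left_diff_distrib)
  also have "\<dots> = energy_form g k - energy_form h k"
    unfolding energy_form_def
    by (intro Bochner_Integration.integral_diff bdd_meas_integrable bdd_meas_mult Lambda_op_bdd_meas assms)
  finally show ?thesis .
qed

lemma energy_form_cmult_left: "energy_form (\<lambda>x. c * g x) k = c * energy_form g k"
  unfolding energy_form_def by (simp add: Lambda_op_cmult mult.assoc)

lemma energy_form_quadratic:
  assumes g: "bdd_meas g" and h: "bdd_meas h"
  shows "energy_form (\<lambda>x. g x - t * h x) (\<lambda>x. g x - t * h x) = energy_form g g - 2 * t * energy_form g h + t\<^sup>2 * energy_form h h"
proof -
  have th: "bdd_meas (\<lambda>x. t * h x)" and d: "bdd_meas (\<lambda>x. g x - t * h x)"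
    using g h by (auto intro: bdd_meas_cmult bdd_meas_diff)
  have 1: "energy_form (\<lambda>x. g x - t * h x) k = energy_form g k - t * energy_form h k" if "bdd_meas k" for k
    using energy_form_diff_left[OF g th that] by (simp add: energy_form_cmult_left)
  have "energy_form (\<lambda>x. g x - t * h x) (\<lambda>x. g x - t * h x) = energy_form g (\<lambda>x. g x - t * h x) - t * energy_form h (\<lambda>x. g x - t * h x)"
    by (rule 1[OF d])
  also have "\<dots> = energy_form (\<lambda>x. g x - t * h x) g - t * energy_form (\<lambda>x. g x - t * h x) h"
    using energy_form_commute[OF g d] energy_form_commute[OF h d] by simp
  also have "\<dots> = energy_form g g - t * energy_form h g - t * (energy_form g h - t * energy_form h h)"
    using 1[OF g] 1[OF h] by simp
  finally show ?thesis using energy_form_commute[OF g h] by (simp add: power2_eq_square algebra_simps)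
qed

text \<open>
  The usual discriminant argument, which covers a degenerate form as well.
\<close>

lemma energy_form_Cauchy_Schwarz:
  assumes g: "bdd_meas g" and h: "bdd_meas h"
  shows "(energy_form g h)\<^sup>2 \<le> energy_form g g * energy_form h h"
proof -
  define a where "a = energy_form g g"
  define b where "b = energy_form g h"
  define c where "c = energy_form h h"
  have q: "0 \<le> a - 2 * t * b + t\<^sup>2 * c" for t
    using energy_form_nonneg[of "\<lambda>x. g x - t * h x"] energy_form_quadratic[OF g h, of t] g h
    by (simp add: a_def b_def c_def bdd_meas_cmult bdd_meas_diff)
  have c0: "0 \<le> c" using energy_form_nonneg[OF h] by (simp add: c_def)
  have "b\<^sup>2 \<le> a * c"
  proof (cases "c = 0")
    case True
    have "b = 0"
    proof (rule ccontr)
      assume "b \<noteq> 0"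
      then have "a - 2 * ((a + 1) / (2 * b)) * b = -1" by (simp add: field_simps)
      then show False using q[of "(a + 1) / (2 * b)"] True by simp
    qed
    then show ?thesis using True by simp
  next
    case False
    then have "c > 0" using c0 by simp
    have "a - 2 * (b / c) * b + (b / c)\<^sup>2 * c = (a * c - b\<^sup>2) / c"
      using False by (simp add: power2_eq_square field_simps)
    then have "0 \<le> (a * c - b\<^sup>2) / c" using q[of "b / c"] by simp
    then show ?thesis using \<open>c > 0\<close> by (simp add: zero_le_divide_iff)
  qed
  then show ?thesis by (simp add: a_def b_def c_def)
qed

lemma Lambda_op_tendsto:
  assumes m: "\<And>n. bdd_meas (g n)" "bdd_meas f" and b: "\<And>n y. y \<in> {0..pi} \<Longrightarrow> \<bar>g n y\<bar> \<le> C"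
    and l: "\<And>y. y \<in> {0..pi} \<Longrightarrow> (\<lambda>n. g n y) \<longlonglongrightarrow> f y" and x: "x \<in> {0..pi}"
  shows "(\<lambda>n. Lambda_op 1 (g n) x) \<longlonglongrightarrow> Lambda_op 1 f x"
  unfolding Lambda_op_def
proof (rule integral_dominated_convergence)
  have *: "(\<lambda>y. odd_kernel 1 x y * h y) \<in> borel_measurable (lebesgue_on {0..pi})" if "bdd_meas h" for h
    using odd_kernel_mult_integrable[OF x that, of 1] by auto
  show "(\<lambda>y. odd_kernel 1 x y * f y) \<in> borel_measurable (lebesgue_on {0..pi})" by (rule *[OF m(2)])
  show "(\<lambda>y. odd_kernel 1 x y * g n y) \<in> borel_measurable (lebesgue_on {0..pi})" for n by (rule *[OF m(1)])
  show "integrable (lebesgue_on {0..pi}) (\<lambda>y. odd_kernel 1 x y * C)" using integrable_odd_kernel[OF x] by simp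
  show "AE y in lebesgue_on {0..pi}. (\<lambda>n. odd_kernel 1 x y * g n y) \<longlonglongrightarrow> odd_kernel 1 x y * f y"
    by (rule AE_I2) (auto intro!: tendsto_intros l)
  show "AE y in lebesgue_on {0..pi}. norm (odd_kernel 1 x y * g n y) \<le> odd_kernel 1 x y * C" for n
    using AE_lebesgue_on_neq[of x 0 pi] AE_space
    by eventually_elim (use abs_odd_kernel_mult_le[OF x, of _ 1] b in auto)
qed

lemma integral_tendsto_bdd:
  assumes m: "\<And>n. bdd_meas (g n)" "bdd_meas f" and b: "\<And>n y. y \<in> {0..pi} \<Longrightarrow> \<bar>g n y\<bar> \<le> C"
    and l: "\<And>y. y \<in> {0..pi} \<Longrightarrow> (\<lambda>n. g n y) \<longlonglongrightarrow> f y"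
  shows "(\<lambda>n. LINT x|lebesgue_on {0..pi}. g n x) \<longlonglongrightarrow> (LINT x|lebesgue_on {0..pi}. f x)"
proof (rule integral_dominated_convergence[where w="\<lambda>_. C"])
  show "integrable (lebesgue_on {0..pi}) (\<lambda>_. C)" by (rule finite_measure.integrable_const[OF finite_measure_Icc])
qed (use m b l in \<open>auto simp: bdd_meas_def intro!: AE_I2\<close>)

lemma integral_pos_of_continuous:
  fixes f :: "real \<Rightarrow> real"
  assumes c: "continuous_on {0..pi} f" and n: "\<And>x. x \<in> {0..pi} \<Longrightarrow> 0 \<le> f x" and x: "x \<in> {0..pi}" "f x \<noteq> 0"
  shows "0 < (LINT x|lebesgue_on {0..pi}. f x)"
proof -
  have i: "integrable (lebesgue_on {0..pi}) f" by (intro bdd_meas_integrable continuous_bdd_meas c)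
  have "0 \<le> (LINT x|lebesgue_on {0..pi}. f x)" by (rule integral_nonneg_AE) (use n in \<open>auto intro!: AE_I2\<close>)
  moreover have "(LINT x|lebesgue_on {0..pi}. f x) \<noteq> 0"
  proof
    assume "(LINT x|lebesgue_on {0..pi}. f x) = 0"
    then have "(f has_integral 0) (cbox 0 pi)"
      using has_integral_integral_lebesgue_on[OF i] by simp
    then have "f x = 0"
      by (rule has_integral_0_cbox_imp_0[rotated 2]) (use c n x pi_gt_zero in \<open>auto simp: box_real simp del: pi_gt_zero\<close>)
    then show False using x by simp
  qed
  ultimately show ?thesis by simp
qed

lemma bdd_meas_signed_powr:
  assumes "bdd_meas u" "0 < p"
  shows "bdd_meas (\<lambda>x. signed_powr p (u x))"
proof -
  obtain C where C: "0 \<le> C" "\<And>y. y \<in> {0..pi} \<Longrightarrow> \<bar>u y\<bar> \<le> C" using bdd_meas_bound[OF assms(1)] by blast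
  have "signed_powr p \<in> borel_measurable borel"
    using continuous_on_signed_powr[OF assms(2) continuous_on_id, of UNIV] by (intro borel_measurable_continuous_onI) auto
  then have "(\<lambda>x. signed_powr p (u x)) \<in> borel_measurable (lebesgue_on {0..pi})"
    using assms(1) by (auto simp: bdd_meas_def intro: measurable_compose)
  moreover have "\<bar>signed_powr p (u y)\<bar> \<le> C powr p" if "y \<in> {0..pi}" for y
    unfolding abs_signed_powr using C(2)[OF that] assms(2) by (intro powr_mono2) auto
  ultimately show ?thesis unfolding bdd_meas_def by blast
qed

section \<open>Existence by a nonlinear power iteration\<close>

lemma sin_Lambda_op: "Lambda_op 1 sin x = sin x"
proof (rule odd_periodic_eqI[of "Lambda_op 1 sin" sin])
  show "Lambda_op 1 sin y = sin y" if "y \<in> {0..pi}" for y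
    using Lambda_op_sin[of 1 y] that by simp
qed auto

text \<open>
  The iteration is written for the densities \<open>h\<^sub>n\<close> whose potentials \<open>\<Lambda>\<^sup>-\<^sup>1 h\<^sub>n\<close> are the iterates, since the
  energy form acts on densities.  The start \<open>\<surd>(2/\<pi>) sin\<close> has unit energy.
\<close>

primrec power_iter :: "real \<Rightarrow> nat \<Rightarrow> real \<Rightarrow> real" where
  "power_iter p 0 = (\<lambda>x. sqrt (2 / pi) * sin x)"
| "power_iter p (Suc n) =
     (let g = (\<lambda>x. signed_powr p (Lambda_op 1 (power_iter p n) x)) in (\<lambda>x. (1 / sqrt (energy_form g g)) * g x))"

lemma powr_Suc_convex:
  fixes a b p :: real
  assumes "0 \<le> a" "0 \<le> b" "0 < p"
  shows "(p + 1) * b powr p * (a - b) \<le> a powr (p + 1) - b powr (p + 1)"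
proof -
  have cont: "continuous_on S (\<lambda>x. x powr (p + 1))" if "S \<subseteq> {0..}" for S :: "real set"
    using that assms(3) by (intro continuous_on_powr' continuous_intros) auto
  have deriv: "((\<lambda>x. x powr (p + 1)) has_real_derivative (p + 1) * x powr p) (at x)" if "0 < x" for x
    using has_real_derivative_powr[OF that, of "p + 1"] by simp
  have mvt: "\<exists>z. s < z \<and> z < t \<and> t powr (p + 1) - s powr (p + 1) = (t - s) * ((p + 1) * z powr p)"
    if st: "0 \<le> s" "s < t" for s t
  proof -
    have "\<exists>l z. s < z \<and> z < t \<and> ((\<lambda>x. x powr (p + 1)) has_real_derivative l) (at z) \<and>
        t powr (p + 1) - s powr (p + 1) = (t - s) * l"
    proof (rule MVT[OF st(2) cont])
      show "(\<lambda>x. x powr (p + 1)) differentiable at x" if "s < x" "x < t" for x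
        using deriv[of x] that st unfolding real_differentiable_def by (intro exI) auto
    qed (use st in auto)
    then show ?thesis using st deriv DERIV_unique by (metis order_le_less_trans)
  qed
  consider "a = b" | "a < b" | "b < a" by linarith
  then show ?thesis
  proof cases
    case 2
    obtain z where z: "a < z" "z < b" "b powr (p + 1) - a powr (p + 1) = (b - a) * ((p + 1) * z powr p)"
      using mvt[of a b] 2 assms by blast
    have "(b - a) * ((p + 1) * z powr p) \<le> (b - a) * ((p + 1) * b powr p)"
      using 2 z assms by (intro mult_left_mono powr_mono2) auto
    with z show ?thesis by (simp add: algebra_simps)
  next
    case 3
    obtain z where z: "b < z" "z < a" "a powr (p + 1) - b powr (p + 1) = (a - b) * ((p + 1) * z powr p)"
      using mvt[of b a] 3 assms by blast
    have "(a - b) * ((p + 1) * b powr p) \<le> (a - b) * ((p + 1) * z powr p)"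
      using 3 z assms by (intro mult_left_mono powr_mono2) auto
    with z show ?thesis by (simp add: algebra_simps)
  qed simp
qed

text \<open>
  Young's inequality with crude constants.
\<close>

lemma mult_powr_le_sum:
  fixes a b p :: real
  assumes "0 \<le> a" "0 \<le> b" "0 < p"
  shows "a * b powr p \<le> a powr (p + 1) + b powr (p + 1)"
proof (cases "a \<le> b")
  case True
  then have "a * b powr p \<le> b * b powr p" by (intro mult_right_mono) auto
  also have "\<dots> = b powr (p + 1)" using assms by (simp add: powr_add)
  finally show ?thesis by (smt (verit) powr_ge_zero)
next
  case False
  then have "a * b powr p \<le> a * a powr p" using assms by (intro mult_left_mono powr_mono2) auto
  also have "\<dots> = a powr (p + 1)" using assms by (simp add: powr_add)
  finally show ?thesis by (smt (verit) powr_ge_zero)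
qed

lemma signed_powr_mult_self: "signed_powr p x * x = \<bar>x\<bar> powr (p + 1)"
  by (cases "x = 0") (auto simp: signed_powr_def powr_add sgn_if)

lemma signed_powr_cmult: "0 \<le> c \<Longrightarrow> signed_powr p (c * x) = c powr p * signed_powr p x"
  by (cases "c = 0"; cases "x = 0") (auto simp: signed_powr_def abs_mult powr_mult sgn_mult)

text \<open>
  Notation for one step: the potential \<open>v\<close> of the density \<open>h\<close>, its power \<open>g\<close>, the energy norm \<open>N\<close> of \<open>g\<close>, by
  which \<open>g\<close> is divided to give the next density, and the quantity \<open>I\<close>, which is \<open>\<integral> v\<^bsup>p+1\<^esup>\<close> and increases.
\<close>

locale power_iteration =
  fixes p :: real
  assumes p: "0 < p"
begin

definition h where "h n = power_iter p n"
definition v where "v n = Lambda_op 1 (h n)"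
definition g where "g n = (\<lambda>x. signed_powr p (v n x))"
definition I where "I n = energy_form (h n) (g n)"
definition N where "N n = sqrt (energy_form (g n) (g n))"
definition normalized where "normalized n \<longleftrightarrow> bdd_meas (h n) \<and> (\<forall>x\<in>{0..pi}. 0 \<le> h n x) \<and> (\<forall>x. h n (- x) = - h n x) \<and>
   (\<forall>x. h n (x + 2 * pi) = h n x) \<and> energy_form (h n) (h n) = 1"

lemma h_Suc: "h (Suc n) = (\<lambda>x. (1 / N n) * g n x)"
  by (simp add: h_def g_def N_def v_def Let_def)

lemma v_odd: "v n (- x) = - v n x" and v_per: "v n (x + 2 * pi) = v n x"
  by (simp_all add: v_def)

lemma g_odd: "g n (- x) = - g n x" and g_per: "g n (x + 2 * pi) = g n x"
  by (simp_all add: g_def v_odd v_per)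

lemma normalized_0: "normalized 0" and I_0: "0 < I 0"
proof -
  define c where "c = sqrt (2 / pi)"
  have c: "0 < c" "c * c * (pi / 2) = 1" by (auto simp: c_def)
  have h0: "h 0 = (\<lambda>x. c * sin x)" by (simp add: h_def c_def)
  have v0: "v 0 = (\<lambda>x. c * sin x)" by (auto simp: v_def h0 Lambda_op_cmult sin_Lambda_op)
  have "energy_form (\<lambda>x. c * sin x) (\<lambda>x. c * sin x) = (LINT x|lebesgue_on {0..pi}. c * c * (sin x * sin (real 1 * x)))"
    unfolding energy_form_def by (intro Bochner_Integration.integral_cong) (auto simp: Lambda_op_cmult sin_Lambda_op)
  also have "\<dots> = c * c * sin_coeff sin 1" by (simp add: sin_coeff_def)
  also have "\<dots> = c * c * (pi / 2)" using sin_coeff_sin[of 1 1] by simp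
  also have "\<dots> = 1" by (rule c(2))
  finally have "energy_form (\<lambda>x. c * sin x) (\<lambda>x. c * sin x) = 1" .
  then show "normalized 0"
    using c by (auto simp: normalized_def h0 sin_ge_zero intro!: continuous_bdd_meas continuous_intros)
  have "I 0 = (LINT x|lebesgue_on {0..pi}. (c * sin x) * signed_powr p (c * sin x))"
    by (simp add: I_def energy_form_def v_def[symmetric] v0 g_def)
  moreover have "0 < (LINT x|lebesgue_on {0..pi}. (c * sin x) * signed_powr p (c * sin x))"
  proof (rule integral_pos_of_continuous)
    show "continuous_on {0..pi} (\<lambda>x. (c * sin x) * signed_powr p (c * sin x))"
      by (intro continuous_intros p)
    show "0 \<le> (c * sin x) * signed_powr p (c * sin x)" for x
      using signed_powr_mult_self[of p "c * sin x"] by (simp add: mult.commute)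
    show "pi / 2 \<in> {0..pi}" by auto
    show "(c * sin (pi / 2)) * signed_powr p (c * sin (pi / 2)) \<noteq> 0"
      using c by (simp add: signed_powr_def)
  qed
  ultimately show "0 < I 0" by simp
qed

context
  fixes n assumes A: "normalized n" 
begin

lemma hm: "bdd_meas (h n)" using A by (simp add: normalized_def)
lemma vm: "bdd_meas (v n)" unfolding v_def by (rule Lambda_op_bdd_meas[OF hm])
lemma gm: "bdd_meas (g n)" unfolding g_def by (rule bdd_meas_signed_powr[OF vm p])
lemma v_nonneg: "x \<in> {0..pi} \<Longrightarrow> 0 \<le> v n x"
  unfolding v_def using Lambda_op_nonneg[of x "h n"] A by (auto simp: normalized_def)
lemma g_nonneg: "x \<in> {0..pi} \<Longrightarrow> 0 \<le> g n x"
  using v_nonneg by (simp add: g_def signed_powr_nonneg_eq)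

lemma I_eq: "I n = (LINT x|lebesgue_on {0..pi}. (v n x) powr (p + 1))"
  unfolding I_def energy_form_def v_def[symmetric]
proof (intro Bochner_Integration.integral_cong refl)
  fix x assume "x \<in> space (lebesgue_on {0..pi})"
  then have "0 \<le> v n x" using v_nonneg by simp
  then show "v n x * g n x = v n x powr (p + 1)"
    using signed_powr_mult_self[of p "v n x"] by (simp add: g_def mult.commute)
qed

lemma vp_int: "integrable (lebesgue_on {0..pi}) (\<lambda>x. (v n x) powr (p + 1))"
proof -
  have "integrable (lebesgue_on {0..pi}) (\<lambda>x. v n x * g n x)"
    by (intro bdd_meas_integrable bdd_meas_mult vm gm)
  moreover have "v n x * g n x = v n x powr (p + 1)" if "x \<in> {0..pi}" for x
    using signed_powr_mult_self[of p "v n x"] v_nonneg[OF that] by (simp add: g_def mult.commute)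
  ultimately show ?thesis
    by (subst Bochner_Integration.integrable_cong[OF refl, of _ _ "\<lambda>x. v n x * g n x"]) auto
qed

lemma N_sq: "(N n)\<^sup>2 = energy_form (g n) (g n)" "0 \<le> N n"
  using energy_form_nonneg[OF gm] by (simp_all add: N_def)

lemma I_le_N: "I n \<le> N n"
proof -
  have "(I n)\<^sup>2 \<le> (N n)\<^sup>2"
    using energy_form_Cauchy_Schwarz[OF hm gm] A N_sq by (simp add: I_def normalized_def)
  then show ?thesis using N_sq(2) by (rule power2_le_imp_le)
qed

end

text \<open>
  Write \<open>h'\<close>, \<open>v'\<close> for the next density and potential.  By convexity of \<open>t\<^bsup>p+1\<^esup>\<close>, the increase of \<open>I\<close> is at least
  \<open>(p+1) \<integral> g (v' - v) = (p+1) (N - I)\<close>.  As \<open>h\<close> and \<open>h'\<close> have unit energy and inner product \<open>I/N\<close>, the energy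
  of \<open>h' - h\<close> is \<open>2 - 2 I/N\<close>, and therefore \<open>N - I\<close> is \<open>N/2\<close> times this energy.
\<close>

lemma energy_step:
  assumes A: "normalized n" and I: "0 < I n"
  shows "normalized (Suc n)" and "I n + (p + 1) * N n / 2 * energy_form (\<lambda>x. h (Suc n) x - h n x) (\<lambda>x. h (Suc n) x - h n x) \<le> I (Suc n)"
proof -
  have N: "0 < N n" using I_le_N[OF A] I by simp
  have hm': "bdd_meas (h (Suc n))" unfolding h_Suc by (intro bdd_meas_cmult gm[OF A])
  have b1: "energy_form (h (Suc n)) k = energy_form (g n) k / N n" for k
    unfolding h_Suc by (subst energy_form_cmult_left) simp
  have b2: "energy_form (g n) (h (Suc n)) = N n"
  proof -
    have "energy_form (g n) (h (Suc n)) = (N n)\<^sup>2 / N n"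
      using energy_form_commute[OF gm[OF A] hm'] b1[of "g n"] N_sq(1)[OF A] by simp
    then show ?thesis using N by (simp add: power2_eq_square)
  qed
  have "energy_form (h (Suc n)) (h (Suc n)) = 1" using b1 b2 N by simp
  then show A': "normalized (Suc n)"
    using hm' N g_nonneg[OF A] unfolding normalized_def by (auto simp: h_Suc g_odd g_per)
  note m = hm[OF A] hm' gm[OF A]
  have d: "energy_form (\<lambda>x. h (Suc n) x - h n x) (\<lambda>x. h (Suc n) x - h n x) = 2 - 2 * (I n / N n)"
  proof -
    have "energy_form (h (Suc n)) (h n) = I n / N n"
      using b1[of "h n"] energy_form_commute[OF m(1,3)] by (simp add: I_def)
    then show ?thesis
      using energy_form_quadratic[OF m(2,1), of 1] A A' by (simp add: normalized_def)
  qed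
  have "(p + 1) * (N n - I n) = (LINT x|lebesgue_on {0..pi}. (p + 1) * (v (Suc n) x * g n x - v n x * g n x))"
  proof -
    have "N n = (LINT x|lebesgue_on {0..pi}. v (Suc n) x * g n x)"
      using b2 energy_form_commute[OF m(2,3)] by (simp add: energy_form_def v_def)
    moreover have "I n = (LINT x|lebesgue_on {0..pi}. v n x * g n x)" by (simp add: I_def energy_form_def v_def)
    moreover have "integrable (lebesgue_on {0..pi}) (\<lambda>x. v (Suc n) x * g n x)"
      "integrable (lebesgue_on {0..pi}) (\<lambda>x. v n x * g n x)"
      using vm[OF A] vm[OF A'] gm[OF A] by (auto intro!: bdd_meas_integrable bdd_meas_mult)
    ultimately show ?thesis by simp
  qed
  also have "\<dots> \<le> (LINT x|lebesgue_on {0..pi}. (v (Suc n) x) powr (p + 1) - (v n x) powr (p + 1))"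
  proof (rule integral_mono)
    show "integrable (lebesgue_on {0..pi}) (\<lambda>x. (p + 1) * (v (Suc n) x * g n x - v n x * g n x))"
      using vm[OF A] vm[OF A'] gm[OF A]
      by (intro bdd_meas_integrable bdd_meas_cmult bdd_meas_diff bdd_meas_mult)
    show "integrable (lebesgue_on {0..pi}) (\<lambda>x. (v (Suc n) x) powr (p + 1) - (v n x) powr (p + 1))"
      using vp_int[OF A] vp_int[OF A'] by simp
    fix x assume "x \<in> space (lebesgue_on {0..pi})"
    then have x: "x \<in> {0..pi}" by simp
    have "g n x = v n x powr p" using v_nonneg[OF A x] by (simp add: g_def signed_powr_nonneg_eq)
    then have "(p + 1) * (v (Suc n) x * g n x - v n x * g n x) = (p + 1) * v n x powr p * (v (Suc n) x - v n x)"
      by (simp add: algebra_simps)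
    also have "\<dots> \<le> (v (Suc n) x) powr (p + 1) - (v n x) powr (p + 1)"
      by (rule powr_Suc_convex[OF v_nonneg[OF A' x] v_nonneg[OF A x] p])
    finally show "(p + 1) * (v (Suc n) x * g n x - v n x * g n x) \<le> (v (Suc n) x) powr (p + 1) - (v n x) powr (p + 1)" .
  qed
  also have "\<dots> = I (Suc n) - I n" using I_eq[OF A] I_eq[OF A'] vp_int[OF A] vp_int[OF A'] by simp
  finally have "(p + 1) * (N n - I n) \<le> I (Suc n) - I n" .
  moreover have "(p + 1) * N n / 2 * (2 - 2 * (I n / N n)) = (p + 1) * (N n - I n)"
    using N by (simp add: field_simps)
  ultimately show "I n + (p + 1) * N n / 2 * energy_form (\<lambda>x. h (Suc n) x - h n x) (\<lambda>x. h (Suc n) x - h n x) \<le> I (Suc n)"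
    unfolding d by linarith
qed

lemma invariant: "normalized n \<and> I 0 \<le> I n"
proof (induction n)
  case 0
  then show ?case using normalized_0 by simp
next
  case (Suc n)
  then have A: "normalized n" and I: "0 < I n" using I_0 by auto
  have "0 \<le> energy_form (\<lambda>x. h (Suc n) x - h n x) (\<lambda>x. h (Suc n) x - h n x)"
    by (intro energy_form_nonneg bdd_meas_diff hm A energy_step(1)[OF A I])
  moreover have "0 \<le> (p + 1) * N n / 2" using p N_sq(2)[OF A] by simp
  ultimately have "0 \<le> (p + 1) * N n / 2 * energy_form (\<lambda>x. h (Suc n) x - h n x) (\<lambda>x. h (Suc n) x - h n x)"
    by (rule mult_nonneg_nonneg[rotated])
  then show ?case using energy_step[OF A I] Suc by linarith
qed

lemmas normalized_all = invariant[THEN conjunct1] and I_ge = invariant[THEN conjunct2]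

lemma I_pos: "0 < I n" using I_0 I_ge[of n] by simp
lemma N_ge: "I 0 \<le> N n" using I_ge[of n] I_le_N[OF normalized_all, of n] by simp
lemma N_pos: "0 < N n" using I_0 N_ge[of n] by simp

abbreviation "gap n \<equiv> energy_form (\<lambda>x. h (Suc n) x - h n x) (\<lambda>x. h (Suc n) x - h n x)"

lemma gap_nonneg: "0 \<le> gap n"
  by (intro energy_form_nonneg bdd_meas_diff hm normalized_all)

lemma I_step: "(p + 1) * I 0 / 2 * gap n \<le> I (Suc n) - I n"
proof -
  have "(p + 1) * I 0 / 2 * gap n \<le> (p + 1) * N n / 2 * gap n"
    using p N_ge[of n] gap_nonneg by (intro mult_right_mono) auto
  then show ?thesis using energy_step(2)[OF normalized_all I_pos, of n] by linarith
qed

text \<open>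
  Let \<open>l\<close> be the \<open>L\<^bsup>p+1\<^esup>\<close>-norm of \<open>v\<close>.  Young's inequality for \<open>v/l\<close> bounds \<open>\<Lambda>\<^sup>-\<^sup>1 g\<close> pointwise and \<open>\<integral> g\<close> by
  multiples of \<open>l\<^sup>p\<close>, hence \<open>N \<le> Q l\<^sup>p\<close>.  Since \<open>l\<^bsup>p+1\<^esup> = I \<le> N\<close>, it follows that \<open>l \<le> Q\<close>.
\<close>

lemma energy_bounded:
  shows "\<exists>M. \<forall>n. I n \<le> M" and "\<exists>M. \<forall>n. \<forall>x\<in>{0..pi}. v n x \<le> M"
proof -
  obtain A where A: "0 \<le> A" "\<forall>x\<in>{0..pi}. integrable (lebesgue_on {0..pi}) (\<lambda>y. \<bar>odd_kernel 1 x y\<bar> powr (p + 1)) \<and>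
           (LINT y|lebesgue_on {0..pi}. \<bar>odd_kernel 1 x y\<bar> powr (p + 1)) \<le> A"
    using integral_odd_kernel_powr[of "p + 1"] p by (metis add_pos_pos zero_less_one)
  define Q where "Q = sqrt ((A + 1) * (pi + 1))"
  have Q0: "0 \<le> Q" using A by (simp add: Q_def)
  \<comment> \<open>The \<open>L\<^bsup>p+1\<^esup>\<close>-norm of \<open>v n\<close>.\<close>
  define l where "l n = I n powr (1 / (p + 1))" for n
  have l: "0 < l n" "l n powr (p + 1) = I n" for n
    using I_pos[of n] p by (auto simp: l_def powr_powr)
  have scaled: "(LINT x|lebesgue_on {0..pi}. (v n x / l n) powr (p + 1)) = 1"
    "integrable (lebesgue_on {0..pi}) (\<lambda>x. (v n x / l n) powr (p + 1))" for n
  proof -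
    have e: "(v n x / l n) powr (p + 1) = v n x powr (p + 1) / I n" if "x \<in> {0..pi}" for x
      using v_nonneg[OF normalized_all that] l by (simp add: powr_divide)
    then have "(LINT x|lebesgue_on {0..pi}. (v n x / l n) powr (p + 1)) = (LINT x|lebesgue_on {0..pi}. v n x powr (p + 1) / I n)"
      by (intro Bochner_Integration.integral_cong) auto
    then show "(LINT x|lebesgue_on {0..pi}. (v n x / l n) powr (p + 1)) = 1"
      using I_eq[OF normalized_all, of n] I_pos[of n] by simp
    show "integrable (lebesgue_on {0..pi}) (\<lambda>x. (v n x / l n) powr (p + 1))"
      using vp_int[OF normalized_all, of n] e
      by (subst Bochner_Integration.integrable_cong[OF refl, of _ _ "\<lambda>x. v n x powr (p + 1) / I n"]) auto
  qed
  have geq: "g n x = l n powr p * (v n x / l n) powr p" if "x \<in> {0..pi}" for n x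
    using v_nonneg[OF normalized_all that] l(1)[of n] by (simp add: g_def signed_powr_nonneg_eq powr_divide)
  have Kg: "Lambda_op 1 (g n) x \<le> l n powr p * (A + 1)" if x: "x \<in> {0..pi}" for n x
  proof -
    have "Lambda_op 1 (g n) x \<le> (LINT y|lebesgue_on {0..pi}. l n powr p * (\<bar>odd_kernel 1 x y\<bar> powr (p + 1) + (v n y / l n) powr (p + 1)))"
      unfolding Lambda_op_def
    proof (rule integral_mono_AE)
      show "AE y in lebesgue_on {0..pi}. odd_kernel 1 x y * g n y \<le> l n powr p * (\<bar>odd_kernel 1 x y\<bar> powr (p + 1) + (v n y / l n) powr (p + 1))"
      proof (rule AE_I2)
        fix y assume "y \<in> space (lebesgue_on {0..pi})"
        then have y: "y \<in> {0..pi}" by simp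
        have "odd_kernel 1 x y * g n y \<le> \<bar>odd_kernel 1 x y\<bar> * g n y"
          using g_nonneg[OF normalized_all y] by (intro mult_right_mono) auto
        also have "\<dots> = l n powr p * (\<bar>odd_kernel 1 x y\<bar> * (v n y / l n) powr p)" by (simp add: geq[OF y])
        also have "\<dots> \<le> l n powr p * (\<bar>odd_kernel 1 x y\<bar> powr (p + 1) + (v n y / l n) powr (p + 1))"
          using v_nonneg[OF normalized_all y, of n] l(1)[of n] p by (intro mult_left_mono mult_powr_le_sum) auto
        finally show "odd_kernel 1 x y * g n y \<le> l n powr p * (\<bar>odd_kernel 1 x y\<bar> powr (p + 1) + (v n y / l n) powr (p + 1))" .
      qed
    qed (use A x scaled odd_kernel_mult_integrable[OF x gm[OF normalized_all], of 1] in auto)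
    also have "\<dots> = l n powr p * ((LINT y|lebesgue_on {0..pi}. \<bar>odd_kernel 1 x y\<bar> powr (p + 1)) + 1)"
      using A x scaled by simp
    also have "\<dots> \<le> l n powr p * (A + 1)" using A x by (intro mult_left_mono add_right_mono) auto
    finally show ?thesis .
  qed
  have ig: "(LINT x|lebesgue_on {0..pi}. g n x) \<le> l n powr p * (pi + 1)" for n
  proof -
    have "(LINT x|lebesgue_on {0..pi}. g n x) \<le> (LINT x|lebesgue_on {0..pi}. l n powr p * (1 + (v n x / l n) powr (p + 1)))"
    proof (rule integral_mono)
      fix x assume "x \<in> space (lebesgue_on {0..pi})"
      then have x: "x \<in> {0..pi}" by simp
      have "1 * (v n x / l n) powr p \<le> 1 powr (p + 1) + (v n x / l n) powr (p + 1)"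
        using v_nonneg[OF normalized_all x, of n] l(1)[of n] p by (intro mult_powr_le_sum) auto
      then show "g n x \<le> l n powr p * (1 + (v n x / l n) powr (p + 1))"
        unfolding geq[OF x] by (intro mult_left_mono) auto
    qed (use scaled bdd_meas_integrable[OF gm[OF normalized_all]] finite_measure.integrable_const[OF finite_measure_Icc] in auto)
    also have "\<dots> = l n powr p * (pi + 1)"
      using scaled[of n] finite_measure.integrable_const[OF finite_measure_Icc, of 0 pi "1::real"]
      by (simp add: measure_restrict_space)
    finally show ?thesis .
  qed
  have "N n \<le> Q * l n powr p" for n
  proof -
    have "energy_form (g n) (g n) \<le> (LINT x|lebesgue_on {0..pi}. (l n powr p * (A + 1)) * g n x)"
      unfolding energy_form_def
    proof (rule integral_mono)
      show "Lambda_op 1 (g n) x * g n x \<le> (l n powr p * (A + 1)) * g n x" if "x \<in> space (lebesgue_on {0..pi})" for x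
        using that Kg[of x n] g_nonneg[OF normalized_all, of x n] by (intro mult_right_mono) auto
    qed (use gm[OF normalized_all] in \<open>auto intro!: bdd_meas_integrable bdd_meas_mult Lambda_op_bdd_meas\<close>)
    also have "\<dots> = (l n powr p * (A + 1)) * (LINT x|lebesgue_on {0..pi}. g n x)" by simp
    also have "\<dots> \<le> (l n powr p * (A + 1)) * (l n powr p * (pi + 1))"
      using A ig by (intro mult_left_mono) auto
    also have "\<dots> = (A + 1) * (pi + 1) * (l n powr p)\<^sup>2" by (simp add: power2_eq_square)
    finally have "N n \<le> sqrt ((A + 1) * (pi + 1) * (l n powr p)\<^sup>2)" unfolding N_def by simp
    then show ?thesis by (simp add: real_sqrt_mult Q_def)
  qed
  then have lp: "l n powr (p + 1) \<le> Q * l n powr p" for n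
    using I_le_N[OF normalized_all, of n] l(2)[of n] by (metis order_trans)
  have lQ: "l n \<le> Q" for n
  proof -
    have "l n powr (p + 1) = l n * l n powr p" using l(1)[of n] by (simp add: powr_add)
    then have le: "l n * l n powr p \<le> Q * l n powr p" using lp[of n] by simp
    have "0 < l n powr p" using l(1)[of n] by simp
    then show ?thesis by (rule mult_right_le_imp_le[OF le])
  qed
  have "I n \<le> Q powr (p + 1)" for n
    using powr_mono2[of "p + 1" "l n" Q] lQ[of n] l[of n] p by simp
  then show "\<exists>M. \<forall>n. I n \<le> M" by blast
  obtain B where B: "\<And>y. y \<in> {0..pi} \<Longrightarrow> \<bar>v 0 y\<bar> \<le> B" using bdd_meas_bound[OF vm[OF normalized_0]] by blast
  have "v n x \<le> max B ((1 / I 0) * (Q powr p * (A + 1)))" if x: "x \<in> {0..pi}" for n x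
  proof (cases n)
    case 0
    then show ?thesis using B[OF x] by simp
  next
    case (Suc m)
    have "v n x = (1 / N m) * Lambda_op 1 (g m) x" unfolding Suc v_def h_Suc by (rule Lambda_op_cmult)
    also have "\<dots> \<le> (1 / I 0) * (l m powr p * (A + 1))"
      using Kg[OF x, of m] N_ge[of m] I_0 Lambda_op_nonneg[OF x gm[OF normalized_all] g_nonneg[OF normalized_all], of m] A
      by (intro mult_mono divide_left_mono) (auto intro: mult_pos_pos)
    also have "\<dots> \<le> (1 / I 0) * (Q powr p * (A + 1))"
      using lQ[of m] l(1)[of m] p I_0 A by (intro mult_left_mono mult_right_mono powr_mono2) auto
    finally show ?thesis by simp
  qed
  then show "\<exists>M. \<forall>n. \<forall>x\<in>{0..pi}. v n x \<le> M" by blast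
qed


lemma I_converges: "\<exists>L. (\<lambda>n. I n) \<longlonglongrightarrow> L"
proof -
  obtain M where M: "\<forall>n. I n \<le> M" using energy_bounded(1) by blast
  have "I n \<le> I (Suc n)" for n
  proof -
    have "0 \<le> (p + 1) * I 0 / 2 * gap n"
      using p I_0 gap_nonneg[of n] by (intro mult_nonneg_nonneg divide_nonneg_nonneg) auto
    then show ?thesis using I_step[of n] by linarith
  qed
  then have "incseq I" by (rule incseq_SucI)
  then show ?thesis using incseq_convergent[of I M] M by metis
qed

lemma gap_tendsto_0: "(\<lambda>n. gap n) \<longlonglongrightarrow> 0"
proof (rule tendsto_sandwich[of "\<lambda>_. 0"])
  obtain L where L: "(\<lambda>n. I n) \<longlonglongrightarrow> L" using I_converges by blast
  have "(\<lambda>n. 2 / ((p + 1) * I 0) * (I (Suc n) - I n)) \<longlonglongrightarrow> 2 / ((p + 1) * I 0) * (L - L)"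
    by (intro tendsto_intros L LIMSEQ_Suc)
  then show "(\<lambda>n. 2 / ((p + 1) * I 0) * (I (Suc n) - I n)) \<longlonglongrightarrow> 0" by simp
  have "0 < (p + 1) * I 0" using p I_0 by simp
  then show "\<forall>\<^sub>F n in sequentially. gap n \<le> 2 / ((p + 1) * I 0) * (I (Suc n) - I n)"
    using I_step by (intro always_eventually allI) (simp add: field_simps)
qed (use gap_nonneg in auto)

lemma v_holder: "\<exists>D\<ge>0. \<forall>n x y. \<bar>v n x - v n y\<bar> \<le> D * \<bar>x - y\<bar> powr (1/2)"
proof -
  obtain M where M: "\<forall>n. \<forall>x\<in>{0..pi}. v n x \<le> M" using energy_bounded(2) by blast
  have M0: "0 \<le> M" using M[rule_format, of 0 0] v_nonneg[OF normalized_all, of 0 0] by simp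
  obtain B where B: "0 \<le> B" "\<And>y. y \<in> {0..pi} \<Longrightarrow> \<bar>h 0 y\<bar> \<le> B" using bdd_meas_bound[OF hm[OF normalized_0]] by blast
  define H where "H = max B (M powr p / I 0)"
  have H: "0 \<le> H" using B by (simp add: H_def)
  have hb: "\<bar>h n y\<bar> \<le> H" if y: "y \<in> {0..pi}" for n y
  proof (cases n)
    case 0
    then show ?thesis using B(2)[OF y] by (simp add: H_def)
  next
    case (Suc m)
    have "\<bar>g m y\<bar> \<le> M powr p"
      unfolding g_def abs_signed_powr using M y v_nonneg[OF normalized_all y, of m] p by (intro powr_mono2) auto
    then have "\<bar>g m y\<bar> / N m \<le> M powr p / I 0"
      using N_ge[of m] I_0 by (intro frac_le) auto
    moreover have "\<bar>h n y\<bar> = \<bar>g m y\<bar> / N m" unfolding Suc h_Suc using N_pos[of m] by (simp add: abs_mult)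
    ultimately show ?thesis by (simp add: H_def)
  qed
  obtain C where C0: "0 \<le> C" and C: "\<forall>f M. bdd_meas f \<longrightarrow> (\<forall>x. f (- x) = - f x) \<longrightarrow> (\<forall>x. f (x + 2 * pi) = f x) \<longrightarrow>
     (\<forall>y\<in>{0..pi}. \<bar>f y\<bar> \<le> M) \<longrightarrow> (\<forall>x y. \<bar>Lambda_op 1 f x - Lambda_op 1 f y\<bar> \<le> C * M * \<bar>x - y\<bar> powr (1/2))"
    using Lambda_op_holder_half by blast
  have hol: "\<bar>v n x - v n y\<bar> \<le> C * H * \<bar>x - y\<bar> powr (1/2)" for n x y
    using C[THEN spec[of _ "h n"], THEN spec[of _ H]] hb[THEN order_trans[OF abs_ge_self], of _ n] normalized_all[of n]
    unfolding v_def normalized_def by simp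
  then show ?thesis using C0 H by (intro exI[of _ "C * H"]) auto
qed

lemma subsequential_limit:
  obtains k w where "strict_mono (k :: nat \<Rightarrow> nat)" "continuous_on {0..pi} w"
    "\<And>x. x \<in> {0..pi} \<Longrightarrow> (\<lambda>n. v (k n) x) \<longlonglongrightarrow> w x"
proof -
  obtain M where M: "\<forall>n. \<forall>x\<in>{0..pi}. v n x \<le> M" using energy_bounded(2) by blast
  obtain D where D: "0 \<le> D" and hol: "\<forall>n x y. \<bar>v n x - v n y\<bar> \<le> D * \<bar>x - y\<bar> powr (1/2)"
    using v_holder by blast
  show ?thesis
  proof (rule Arzela_Ascoli[of "{0..pi}" v M])
    show "norm (v n x) \<le> M" if "x \<in> {0..pi}" for n x
      using M that v_nonneg[OF normalized_all that] by auto
    show "\<exists>d>0. \<forall>n y. y \<in> {0..pi} \<and> norm (x - y) < d \<longrightarrow> norm (v n x - v n y) < e" if "0 < e" for x e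
    proof (intro exI[of _ "(e / (D + 1))\<^sup>2"] conjI allI impI)
      show "0 < (e / (D + 1))\<^sup>2" using that D by simp
      fix n y assume y: "y \<in> {0..pi} \<and> norm (x - y) < (e / (D + 1))\<^sup>2"
      have "sqrt \<bar>x - y\<bar> < e / (D + 1)"
        using y that D by (intro real_less_lsqrt) auto
      then have "D * sqrt \<bar>x - y\<bar> \<le> D * (e / (D + 1))" using D by (intro mult_left_mono) auto
      also have "\<dots> < e" using D that by (simp add: field_simps)
      finally show "norm (v n x - v n y) < e"
        using hol[rule_format, of n x y] by (simp add: powr_half_sqrt)
    qed
    fix w k
    assume w: "continuous_on {0..pi} w" and k: "strict_mono (k :: nat \<Rightarrow> nat)"
      and u: "\<And>e. 0 < e \<Longrightarrow> \<exists>N. \<forall>n x. N \<le> n \<and> x \<in> {0..pi} \<longrightarrow> norm (v (k n) x - w x) < e"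
    show ?thesis
    proof (rule that[OF k w])
      fix x assume "x \<in> {0..pi}"
      then show "(\<lambda>n. v (k n) x) \<longlonglongrightarrow> w x"
        using u unfolding LIMSEQ_iff by blast
    qed
  qed auto
qed

text \<open>
  Along the subsequence, \<open>v (k n)\<close> tends to \<open>w\<close> and its successor \<open>v (Suc (k n))\<close> tends to
  \<open>z = \<Lambda>\<^sup>-\<^sup>1 (w\<^sup>p) / N'\<close>.  The energy of the difference of the densities tends to zero, so by the
  Cauchy-Schwarz inequality \<open>\<integral> (z - w) f = 0\<close> for every bounded \<open>f\<close>; the choice \<open>f = z - w\<close> gives \<open>z = w\<close>.
\<close>

lemma eigenfunction:
  obtains w N' where "continuous_on {0..pi} w" "\<And>x. x \<in> {0..pi} \<Longrightarrow> 0 \<le> w x" "\<exists>x\<in>{0..pi}. w x \<noteq> 0"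
    "0 < N'" "\<And>x. x \<in> {0..pi} \<Longrightarrow> Lambda_op 1 (\<lambda>y. signed_powr p (w y)) x = N' * w x"
proof -
  obtain k w where k: "strict_mono (k :: nat \<Rightarrow> nat)" and w: "continuous_on {0..pi} w"
    and lim: "\<And>x. x \<in> {0..pi} \<Longrightarrow> (\<lambda>n. v (k n) x) \<longlonglongrightarrow> w x" by (rule subsequential_limit) blast
  obtain M where M: "\<forall>n. \<forall>x\<in>{0..pi}. v n x \<le> M" using energy_bounded(2) by blast
  define G where "G y = signed_powr p (w y)" for y
  have wn: "0 \<le> w x" if "x \<in> {0..pi}" for x
    using LIMSEQ_le_const[OF lim[OF that]] v_nonneg[OF normalized_all that] by blast
  have wm: "bdd_meas w" by (rule continuous_bdd_meas[OF w])
  have Gm: "bdd_meas G" unfolding G_def by (rule bdd_meas_signed_powr[OF wm p])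
  have vb: "\<bar>v n y\<bar> \<le> M" if "y \<in> {0..pi}" for n y using M v_nonneg[OF normalized_all that, of n] that by auto
  have gb: "\<bar>g n y\<bar> \<le> M powr p" if "y \<in> {0..pi}" for n y
    unfolding g_def abs_signed_powr using vb[OF that] p by (intro powr_mono2) auto
  have gl: "(\<lambda>n. g (k n) x) \<longlonglongrightarrow> G x" if "x \<in> {0..pi}" for x
    unfolding g_def G_def by (rule isCont_tendsto_compose[OF isCont_signed_powr[OF p] lim[OF that]])
  have Kl: "(\<lambda>n. Lambda_op 1 (g (k n)) x) \<longlonglongrightarrow> Lambda_op 1 G x" if "x \<in> {0..pi}" for x
    by (rule Lambda_op_tendsto[OF gm[OF normalized_all] Gm gb gl that])
  have Kb: "\<bar>Lambda_op 1 (g n) x\<bar> \<le> kernel_mass * M powr p" if "x \<in> {0..pi}" for n x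
    using abs_Lambda_op_le[OF _ _ gm[OF normalized_all] gb that, of 1] by simp
  have bl: "(\<lambda>n. energy_form (g (k n)) (g (k n))) \<longlonglongrightarrow> energy_form G G"
    unfolding energy_form_def
  proof (rule integral_tendsto_bdd)
    show "bdd_meas (\<lambda>x. Lambda_op 1 (g (k n)) x * g (k n) x)" for n
      by (intro bdd_meas_mult Lambda_op_bdd_meas gm normalized_all)
    show "bdd_meas (\<lambda>x. Lambda_op 1 G x * G x)" by (intro bdd_meas_mult Lambda_op_bdd_meas Gm)
    show "(\<lambda>n. Lambda_op 1 (g (k n)) x * g (k n) x) \<longlonglongrightarrow> Lambda_op 1 G x * G x" if "x \<in> {0..pi}" for x
      by (intro tendsto_mult Kl gl that)
    show "\<bar>Lambda_op 1 (g (k n)) x * g (k n) x\<bar> \<le> (kernel_mass * M powr p) * M powr p" if "x \<in> {0..pi}" for n x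
      unfolding abs_mult using Kb[OF that, of "k n"] gb[OF that, of "k n"] by (intro mult_mono) auto
  qed
  define N' where "N' = sqrt (energy_form G G)"
  have Nl: "(\<lambda>n. N (k n)) \<longlonglongrightarrow> N'" unfolding N_def N'_def by (intro tendsto_real_sqrt bl)
  have N'0: "0 < N'"
  proof -
    have "I 0 \<le> N'" using LIMSEQ_le_const[OF Nl] N_ge by blast
    then show ?thesis using I_0 by simp
  qed
  define z where "z x = (1 / N') * Lambda_op 1 G x" for x
  have zl: "(\<lambda>n. v (Suc (k n)) x) \<longlonglongrightarrow> z x" if "x \<in> {0..pi}" for x
  proof -
    have "v (Suc (k n)) x = (1 / N (k n)) * Lambda_op 1 (g (k n)) x" for n
      unfolding v_def[of "Suc _"] h_Suc by (rule Lambda_op_cmult)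
    moreover have "(\<lambda>n. (1 / N (k n)) * Lambda_op 1 (g (k n)) x) \<longlonglongrightarrow> z x"
      unfolding z_def by (intro tendsto_intros Nl Kl that) (use N'0 in auto)
    ultimately show ?thesis by simp
  qed
  have zm: "bdd_meas z" unfolding z_def by (intro bdd_meas_cmult Lambda_op_bdd_meas Gm)
  define f where "f x = z x - w x" for x
  have fm: "bdd_meas f" unfolding f_def by (intro bdd_meas_diff zm wm)
  obtain B where B: "0 \<le> B" "\<And>y. y \<in> {0..pi} \<Longrightarrow> \<bar>f y\<bar> \<le> B" using bdd_meas_bound[OF fm] by blast
  have l1: "(\<lambda>n. LINT x|lebesgue_on {0..pi}. (v (Suc (k n)) x - v (k n) x) * f x) \<longlonglongrightarrow> (LINT x|lebesgue_on {0..pi}. f x * f x)"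
  proof (rule integral_tendsto_bdd)
    show "bdd_meas (\<lambda>x. (v (Suc (k n)) x - v (k n) x) * f x)" for n
      by (intro bdd_meas_mult bdd_meas_diff vm normalized_all fm)
    show "(\<lambda>n. (v (Suc (k n)) x - v (k n) x) * f x) \<longlonglongrightarrow> f x * f x" if "x \<in> {0..pi}" for x
      using tendsto_mult[OF tendsto_diff[OF zl[OF that] lim[OF that]] tendsto_const[of "f x"]] by (simp add: f_def)
    show "\<bar>(v (Suc (k n)) x - v (k n) x) * f x\<bar> \<le> (2 * M) * B" if "x \<in> {0..pi}" for n x
    proof -
      have "\<bar>v (Suc (k n)) x - v (k n) x\<bar> \<le> 2 * M"
        using vb[OF that, of "k n"] vb[OF that, of "Suc (k n)"] by linarith
      then show ?thesis
        unfolding abs_mult by (rule mult_mono[OF _ B(2)[OF that]]) (use vb[OF that, of 0] in auto)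
    qed
  qed (intro bdd_meas_mult fm)
  have "(\<lambda>n. LINT x|lebesgue_on {0..pi}. (v (Suc (k n)) x - v (k n) x) * f x) \<longlonglongrightarrow> 0"
  proof -
    let ?d = "\<lambda>n x. h (Suc n) x - h n x"
    have eq: "(LINT x|lebesgue_on {0..pi}. (v (Suc n) x - v n x) * f x) = energy_form (?d n) f" for n
      unfolding energy_form_def v_def
      by (intro Bochner_Integration.integral_cong) (auto simp: Lambda_op_diff hm[OF normalized_all])
    have "(energy_form (?d n) f)\<^sup>2 \<le> gap n * energy_form f f" for n
      by (intro energy_form_Cauchy_Schwarz bdd_meas_diff hm normalized_all fm)
    then have le: "\<bar>energy_form (?d n) f\<bar> \<le> sqrt (gap n * energy_form f f)" for n
      using real_sqrt_le_mono[of "(energy_form (?d n) f)\<^sup>2" "gap n * energy_form f f"] by simp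
    have "(\<lambda>n. sqrt (gap n * energy_form f f)) \<longlonglongrightarrow> sqrt (0 * energy_form f f)"
      by (intro tendsto_intros gap_tendsto_0)
    then have "(\<lambda>n. energy_form (?d n) f) \<longlonglongrightarrow> 0"
      using le by (intro Lim_null_comparison[of "\<lambda>n. energy_form (?d n) f" "\<lambda>n. sqrt (gap n * energy_form f f)"]) auto
    from LIMSEQ_subseq_LIMSEQ[OF this k] show ?thesis by (simp add: eq o_def)
  qed
  with l1 have int0: "(LINT x|lebesgue_on {0..pi}. f x * f x) = 0" using LIMSEQ_unique by blast
  have zc: "continuous_on {0..pi} z"
  proof -
    obtain D where D: "0 \<le> D" "\<forall>n x y. \<bar>v n x - v n y\<bar> \<le> D * \<bar>x - y\<bar> powr (1/2)"
      using v_holder by blast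
    have hol: "\<bar>z x - z y\<bar> \<le> D * sqrt \<bar>x - y\<bar>" if "x \<in> {0..pi}" "y \<in> {0..pi}" for x y
    proof (rule LIMSEQ_le_const2)
      show "(\<lambda>n. \<bar>v (Suc (k n)) x - v (Suc (k n)) y\<bar>) \<longlonglongrightarrow> \<bar>z x - z y\<bar>"
        by (intro tendsto_intros zl that)
      show "\<exists>N. \<forall>n\<ge>N. \<bar>v (Suc (k n)) x - v (Suc (k n)) y\<bar> \<le> D * sqrt \<bar>x - y\<bar>"
        using D(2) by (auto simp: powr_half_sqrt)
    qed
    show ?thesis unfolding continuous_on_def
    proof (intro ballI)
      fix x assume x: "x \<in> {0..pi}"
      have "((\<lambda>y. D * sqrt \<bar>y - x\<bar>) \<longlongrightarrow> D * sqrt \<bar>x - x\<bar>) (at x within {0..pi})"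
        by (intro tendsto_intros)
      then have "((\<lambda>y. D * sqrt \<bar>y - x\<bar>) \<longlongrightarrow> 0) (at x within {0..pi})" by simp
      moreover have "\<forall>\<^sub>F y in at x within {0..pi}. norm (z y - z x) \<le> D * sqrt \<bar>y - x\<bar>"
        using hol x by (auto simp: eventually_at_filter)
      ultimately have "((\<lambda>y. z y - z x) \<longlongrightarrow> 0) (at x within {0..pi})" by (rule Lim_null_comparison[rotated])
      then show "(z \<longlongrightarrow> z x) (at x within {0..pi})" by (rule LIM_zero_cancel)
    qed
  qed
  have fc: "continuous_on {0..pi} f" unfolding f_def by (intro continuous_intros zc w)
  have f0: "f x = 0" if "x \<in> {0..pi}" for x
  proof (rule ccontr)
    assume "f x \<noteq> 0"
    then have "0 < (LINT x|lebesgue_on {0..pi}. f x * f x)"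
      by (intro integral_pos_of_continuous[of _ x] continuous_intros fc that) auto
    then show False using int0 by simp
  qed
  show ?thesis
  proof (rule that[of w N'])
    show "Lambda_op 1 (\<lambda>y. signed_powr p (w y)) x = N' * w x" if "x \<in> {0..pi}" for x
      using f0[OF that] N'0 by (simp add: f_def z_def G_def[abs_def] field_simps)
    show "\<exists>x\<in>{0..pi}. w x \<noteq> 0"
    proof (rule ccontr)
      assume "\<not> (\<exists>x\<in>{0..pi}. w x \<noteq> 0)"
      then have "energy_form G G = 0" unfolding energy_form_def
        by (intro integral_eq_zero_AE AE_I2) (auto simp: G_def)
      then show False using N'0 by (simp add: N'_def)
    qed
  qed (use w wn N'0 in auto)
qed

end

definition is_solution :: "real \<Rightarrow> (real \<Rightarrow> real) \<Rightarrow> bool" where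
  "is_solution p u \<longleftrightarrow> (\<forall>x. u x = Lambda_op 1 (\<lambda>y. signed_powr p (u y)) x) \<and> bdd_meas u \<and>
     (\<forall>x\<in>{0..pi}. 0 \<le> u x) \<and> (\<exists>x\<in>{0..pi}. u x \<noteq> 0)"

text \<open>
  Replacing \<open>w\<close> by \<open>c w\<close> multiplies the left-hand side of \<open>\<Lambda>\<^sup>-\<^sup>1 (w\<^sup>p) = N w\<close> by \<open>c\<^sup>p\<close> and the right-hand side by
  \<open>c\<close>, so for \<open>p \<noteq> 1\<close> the eigenvalue can be scaled away.  For \<open>p = 1\<close> the equation is linear, and the sine is a
  solution.
\<close>

theorem solution_exists:
  assumes p: "0 < p"
  shows "\<exists>u. is_solution p u"
proof (cases "p = 1")
  case True
  have "signed_powr 1 (sin y) = sin y" for y :: real by (simp add: signed_powr_def sgn_mult_abs)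
  then have e: "sin x = Lambda_op 1 (\<lambda>y. signed_powr p (sin y)) x" for x using sin_Lambda_op True by simp
  show ?thesis unfolding is_solution_def
  proof (intro exI[of _ sin] conjI allI ballI)
    show "bdd_meas sin" using bdd_meas_sin[of 1] by simp
    show "\<exists>x\<in>{0..pi}. sin x \<noteq> 0" by (rule bexI[of _ "pi / 2"]) auto
    show "0 \<le> sin x" if "x \<in> {0..pi}" for x using that by (auto intro: sin_ge_zero)
  qed (rule e)
next
  case False
  interpret power_iteration p by unfold_locales (rule p)
  obtain w N' where w: "continuous_on {0..pi} w" "\<And>x. x \<in> {0..pi} \<Longrightarrow> 0 \<le> w x" "\<exists>x\<in>{0..pi}. w x \<noteq> 0"
    "0 < N'" "\<And>x. x \<in> {0..pi} \<Longrightarrow> Lambda_op 1 (\<lambda>y. signed_powr p (w y)) x = N' * w x" by (rule eigenfunction) blast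
  \<comment> \<open>The solution of \<open>c\<^sup>p N' = c\<close>.\<close>
  define c where "c = (1 / N') powr (1 / (p - 1))"
  have c: "0 < c" using w(4) by (simp add: c_def)
  have cp: "c powr p * N' = c"
  proof -
    have "c powr (p - 1) = 1 / N'" using w(4) False by (simp add: c_def powr_powr)
    moreover have "c powr p = c powr (p - 1) * c" using c by (simp add: powr_diff)
    ultimately show ?thesis using w(4) by simp
  qed
  define u where "u = Lambda_op 1 (\<lambda>y. signed_powr p (c * w y))"
  have u: "u x = c * w x" if "x \<in> {0..pi}" for x
  proof -
    have "u x = c powr p * Lambda_op 1 (\<lambda>y. signed_powr p (w y)) x"
      using c by (simp add: u_def signed_powr_cmult Lambda_op_cmult)
    also have "\<dots> = (c powr p * N') * w x" using w(5)[OF that] by simp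
    finally show ?thesis using cp by simp
  qed
  have e: "u x = Lambda_op 1 (\<lambda>y. signed_powr p (u y)) x" for x
    by (subst u_def, rule Lambda_op_cong) (simp add: u)
  show ?thesis unfolding is_solution_def
  proof (intro exI[of _ u] conjI allI ballI)
    show "bdd_meas u"
      unfolding u_def by (intro Lambda_op_bdd_meas bdd_meas_signed_powr p bdd_meas_cmult continuous_bdd_meas w)
    show "0 \<le> u x" if "x \<in> {0..pi}" for x using u[OF that] w(2)[OF that] c by simp
    show "\<exists>x\<in>{0..pi}. u x \<noteq> 0" using u w(3) c by fastforce
  qed (rule e)
qed

section \<open>Regularity and uniqueness of solutions\<close>

lemma holder_lower_exponent:
  fixes f :: "real \<Rightarrow> real"
  assumes per: "\<And>x. f (x + 2 * pi) = f x" and C: "0 \<le> C" and e: "0 < b" "b \<le> c"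
    and hol: "\<And>x y. \<bar>f x - f y\<bar> \<le> C * \<bar>x - y\<bar> powr c"
  shows "\<exists>C. \<forall>x y. \<bar>f x - f y\<bar> \<le> C * \<bar>x - y\<bar> powr b"
proof (rule periodic_holder_global(1)[where w=f and b=b and C=C])
  fix x y :: real assume "\<bar>x - y\<bar> \<le> 1"
  then have "\<bar>x - y\<bar> powr c \<le> \<bar>x - y\<bar> powr b"
    using e by (cases "x = y") (auto intro: powr_mono')
  then show "\<bar>f x - f y\<bar> \<le> C * \<bar>x - y\<bar> powr b"
    using hol[of x y] C by (meson mult_left_mono order_trans)
qed (use e C per in auto)

lemma lipschitz_of_bounded_derivative:
  fixes u w :: "real \<Rightarrow> real"
  assumes "\<And>x. (u has_real_derivative w x) (at x)" "\<And>x. \<bar>w x\<bar> \<le> B"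
  shows "\<bar>u x - u y\<bar> \<le> B * \<bar>x - y\<bar>"
  using field_differentiable_bound[of UNIV u w B x y] assms
  by (simp add: has_field_derivative_at_within)

lemma signed_powr_local_lipschitz:
  assumes p: "1 < p" and a: "\<bar>a\<bar> \<le> M" "\<bar>b\<bar> \<le> M"
  shows "\<bar>signed_powr p a - signed_powr p b\<bar> \<le> p * M powr (p - 1) * \<bar>a - b\<bar>"
proof -
  have "norm (signed_powr p a - signed_powr p b) \<le> p * M powr (p - 1) * norm (a - b)"
  proof (rule field_differentiable_bound[of "{-M..M}" _ "\<lambda>x. p * \<bar>x\<bar> powr (p - 1)"])
    show "(signed_powr p has_field_derivative p * \<bar>x\<bar> powr (p - 1)) (at x within {-M..M})" for x
      by (rule has_field_derivative_at_within[OF DERIV_signed_powr[OF p]])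
    show "norm (p * \<bar>x\<bar> powr (p - 1)) \<le> p * M powr (p - 1)" if "x \<in> {-M..M}" for x
      using p that by (auto intro!: mult_left_mono powr_mono2)
  qed (use a in auto)
  then show ?thesis by simp
qed

text \<open>
  With \<open>D = sin\<^sup>2 ((x-y)/2) \<le> 1\<close> the kernel is \<open>ln (1 + sin x sin y / D) / (2\<pi>)\<close>, and \<open>ln (1 + z) \<ge> z/2\<close> on
  \<open>[0,1]\<close>.
\<close>

lemma odd_kernel_ge_sin:
  assumes "x \<in> {0..pi}" "y \<in> {0..pi}" "x \<noteq> y"
  shows "sin x * sin y / (4 * pi) \<le> odd_kernel 1 x y"
proof -
  define S where "S = (sin ((x + y) / 2))\<^sup>2"
  define D where "D = (sin ((x - y) / 2))\<^sup>2"
  define z where "z = sin x * sin y"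
  have D: "0 < D" "D \<le> S" using sin_half_facts[OF assms(1-3)] by (auto simp: S_def D_def)
  have D1: "D \<le> 1" by (simp add: D_def abs_square_le_1)
  have z: "0 \<le> z" "z \<le> 1"
    using assms mult_mono[of "sin x" 1 "sin y" 1] by (auto simp: z_def sin_ge_zero)
  have SD: "S = D + z" using sin_half_squared_diff[of x y] by (simp add: S_def D_def z_def)
  have "z / 2 \<le> z / (1 + z)" using z by (intro divide_left_mono) auto
  also have "\<dots> = 1 - 1 / (1 + z)" using z by (simp add: field_simps)
  also have "\<dots> \<le> - ln (1 / (1 + z))" using ln_le_minus_one[of "1 / (1 + z)"] z by simp
  also have "\<dots> = ln (1 + z)" using z by (simp add: ln_div)
  also have "\<dots> \<le> ln (S / D)"
  proof (rule ln_mono)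
    have "D * z \<le> z" using D D1 z by (simp add: mult_left_le_one_le)
    then show "1 + z \<le> S / D" using D SD by (simp add: field_simps)
  qed (use z in auto)
  finally have "z / 2 \<le> ln S - ln D" using D by (simp add: ln_div)
  moreover have "odd_kernel 1 x y = (ln S - ln D) / (2 * pi)"
    using odd_kernel_eq_ln[OF assms] by (simp add: S_def D_def)
  moreover have "z / 2 / (2 * pi) \<le> (ln S - ln D) / (2 * pi)"
    using \<open>z / 2 \<le> ln S - ln D\<close> by (rule divide_right_mono) simp
  ultimately have "z / 2 / (2 * pi) \<le> odd_kernel 1 x y" by simp
  then show ?thesis by (simp add: z_def)
qed

locale solution =
  fixes p :: real and u :: "real \<Rightarrow> real"
  assumes p: "0 < p" "p < 2" and sol: "is_solution p u"
begin

abbreviation "f \<equiv> \<lambda>y. signed_powr p (u y)"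

lemma u_eq: "u x = Lambda_op 1 f x" and u_eq': "u = Lambda_op 1 f" and um: "bdd_meas u"
  and u_nonneg: "x \<in> {0..pi} \<Longrightarrow> 0 \<le> u x"
  using sol unfolding is_solution_def by blast+

lemma u_odd: "u (- x) = - u x"
  using u_eq[of x] u_eq[of "- x"] by (simp only: Lambda_op_minus)

lemma u_per: "u (x + 2 * pi) = u x"
  using u_eq[of x] u_eq[of "x + 2 * pi"] by (simp only: Lambda_op_periodic)

lemma fm: "bdd_meas f" by (rule bdd_meas_signed_powr[OF um p(1)])
lemma f_odd: "f (- x) = - f x" and f_per: "f (x + 2 * pi) = f x"
  by (simp_all add: u_odd u_per)

lemma u_0: "u 0 = 0" and u_pi: "u pi = 0"
  using u_eq[of 0] u_eq[of pi] by (simp_all only: Lambda_op_0 Lambda_op_pi)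

lemma u_bounded: "\<exists>M\<ge>0. \<forall>x. \<bar>u x\<bar> \<le> M"
proof -
  obtain M where M: "0 \<le> M" "\<And>y. y \<in> {0..pi} \<Longrightarrow> \<bar>u y\<bar> \<le> M" using bdd_meas_bound[OF um] by blast
  have "\<bar>u x\<bar> \<le> M" for x by (rule odd_periodic_bound[OF u_odd u_per M(2)])
  then show ?thesis using M(1) by blast
qed

lemma u_isCont: "isCont u x"
  by (subst u_eq') (rule isCont_Lambda_op[OF fm f_odd f_per])

lemma u_holder_half: "\<exists>D\<ge>0. \<forall>x y. \<bar>u x - u y\<bar> \<le> D * \<bar>x - y\<bar> powr (1/2)"
proof -
  obtain D where "0 \<le> D" "\<forall>x y. \<bar>Lambda_op 1 f x - Lambda_op 1 f y\<bar> \<le> D * \<bar>x - y\<bar> powr (1/2)"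
    using Lambda_op_holder[OF fm f_odd f_per] by blast
  then show ?thesis unfolding u_eq'[symmetric] by blast
qed

lemma f_holder: "\<exists>B \<gamma>. 0 < \<gamma> \<and> \<gamma> \<le> 1/2 \<and> (\<forall>x y. \<bar>f x - f y\<bar> \<le> B * \<bar>x - y\<bar> powr \<gamma>)"
proof -
  obtain D where D: "0 \<le> D" "\<forall>x y. \<bar>u x - u y\<bar> \<le> D * \<bar>x - y\<bar> powr (1/2)" using u_holder_half by blast
  show ?thesis
  proof (cases "p \<le> 1")
    case True
    have "\<bar>f x - f y\<bar> \<le> (2 * D powr p) * \<bar>x - y\<bar> powr (p / 2)" for x y
    proof -
      have "\<bar>f x - f y\<bar> \<le> 2 * \<bar>u x - u y\<bar> powr p" by (rule signed_powr_holder[OF p(1) True])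
      also have "\<dots> \<le> 2 * (D * \<bar>x - y\<bar> powr (1/2)) powr p"
        using D p by (intro mult_left_mono powr_mono2) auto
      also have "\<dots> = (2 * D powr p) * \<bar>x - y\<bar> powr (p / 2)"
        using D by (simp add: powr_mult powr_powr)
      finally show ?thesis .
    qed
    then show ?thesis using p True by (intro exI[of _ "2 * D powr p"] exI[of _ "p / 2"]) auto
  next
    case False
    obtain M where M: "0 \<le> M" "\<forall>x. \<bar>u x\<bar> \<le> M" using u_bounded by blast
    have "\<bar>f x - f y\<bar> \<le> (p * M powr (p - 1) * D) * \<bar>x - y\<bar> powr (1/2)" for x y
    proof -
      have "\<bar>f x - f y\<bar> \<le> p * M powr (p - 1) * \<bar>u x - u y\<bar>"
        using M False by (intro signed_powr_local_lipschitz) auto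
      also have "\<dots> \<le> p * M powr (p - 1) * (D * \<bar>x - y\<bar> powr (1/2))"
        using D p by (intro mult_left_mono) auto
      finally show ?thesis by (simp add: mult.assoc)
    qed
    then show ?thesis by (intro exI[of _ "p * M powr (p - 1) * D"] exI[of _ "1/2"]) auto
  qed
qed

text \<open>
  Bootstrap.  The first pass uses that the density \<open>f\<close> is \<open>\<gamma>\<close>-Hoelder for some \<open>\<gamma> \<le> 1/2\<close>, which makes \<open>a = 1 + \<gamma>/2\<close>
  admissible and \<open>u\<close> continuously differentiable.  If \<open>p > 1\<close>, then \<open>f\<close> is even Lipschitz, and a second pass with
  \<open>a = p\<close> gives the exponent \<open>p - 1\<close> for the derivative.
\<close>

lemma u_C1:
  obtains w where "\<And>x. (u has_real_derivative w x) (at x)" "\<And>x. isCont w x"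
    "\<And>x. w (x + 2 * pi) = w x" "\<exists>B\<ge>0. \<forall>x. \<bar>w x\<bar> \<le> B"
    "1 < p \<Longrightarrow> \<exists>C. \<forall>x y. \<bar>w x - w y\<bar> \<le> C * \<bar>x - y\<bar> powr (p - 1)"
proof -
  obtain B \<gamma> where \<gamma>: "0 < \<gamma>" "\<gamma> \<le> 1/2" and B: "\<forall>x y. \<bar>f x - f y\<bar> \<le> B * \<bar>x - y\<bar> powr \<gamma>"
    using f_holder by blast
  define a where "a = 1 + \<gamma> / 2"
  \<comment> \<open>The second condition holds because \<open>\<gamma> \<le> 1/2\<close>.\<close>
  have a: "1 < a" "\<gamma> < a / 2" "a - \<gamma> < 1" using \<gamma> by (auto simp: a_def)
  obtain w C where w: "\<And>x. (Lambda_op 1 f has_real_derivative w x) (at x)"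
    "\<And>x y. \<bar>w x - w y\<bar> \<le> C * \<bar>x - y\<bar> powr (a - 1)" "\<And>x. w (x + 2 * pi) = w x" "\<exists>B. \<forall>x. \<bar>w x\<bar> \<le> B"
    by (rule Lambda_op_C1[OF fm f_odd f_per B[rule_format] less_imp_le[OF \<gamma>(1)] a]) blast
  have wu: "(u has_real_derivative w x) (at x)" for x using w(1) unfolding u_eq'[symmetric] .
  obtain L where L: "\<forall>x. \<bar>w x\<bar> \<le> L" using w(4) by blast
  have L0: "0 \<le> L" using L abs_ge_zero order_trans by blast
  have wc: "isCont w x" for x
    by (rule holder_isCont[of "a - 1" _ C]) (use a w(2) in auto)
  have "\<exists>C. \<forall>x y. \<bar>w x - w y\<bar> \<le> C * \<bar>x - y\<bar> powr (p - 1)" if p1: "1 < p"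
  proof -
    obtain M where M: "0 \<le> M" "\<forall>x. \<bar>u x\<bar> \<le> M" using u_bounded by blast
    define E where "E = p * M powr (p - 1) * L"
    have E0: "0 \<le> E" using p L0 by (simp add: E_def)
    have lip: "\<bar>f x - f y\<bar> \<le> E * \<bar>x - y\<bar> powr 1" for x y
    proof -
      have "\<bar>f x - f y\<bar> \<le> p * M powr (p - 1) * \<bar>u x - u y\<bar>"
        using M p1 by (intro signed_powr_local_lipschitz) auto
      also have "\<dots> \<le> p * M powr (p - 1) * (L * \<bar>x - y\<bar>)"
        using lipschitz_of_bounded_derivative[OF wu L[rule_format], of x y] p by (intro mult_left_mono) auto
      finally show ?thesis by (simp add: E_def mult.assoc)
    qed
    \<comment> \<open>The exponent \<open>\<delta>\<close> has to satisfy \<open>p - 1 < \<delta> < p/2\<close>; there is room for it because \<open>p < 2\<close>.\<close>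
    define \<delta> where "\<delta> = (p - 1 + p / 2) / 2"
    have \<delta>: "0 < \<delta>" "\<delta> \<le> 1" "\<delta> < p / 2" "p - \<delta> < 1" using p p1 by (auto simp: \<delta>_def field_simps)
    obtain B' where B': "\<forall>x y. \<bar>f x - f y\<bar> \<le> B' * \<bar>x - y\<bar> powr \<delta>"
      using holder_lower_exponent[OF f_per E0 \<delta>(1,2) lip] by blast
    obtain w' C' where w': "\<And>x. (Lambda_op 1 f has_real_derivative w' x) (at x)"
      "\<And>x y. \<bar>w' x - w' y\<bar> \<le> C' * \<bar>x - y\<bar> powr (p - 1)"
      by (rule Lambda_op_C1[OF fm f_odd f_per B'[rule_format] less_imp_le[OF \<delta>(1)] p1 \<delta>(3,4)]) blast
    have "w' = w" using DERIV_unique[OF w'(1) w(1)] by blast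
    then show ?thesis using w'(2) by blast
  qed
  then show ?thesis using that[of w] wu wc w(3) L L0 by blast
qed

lemma u_lipschitz: "\<exists>L\<ge>0. \<forall>x y. \<bar>u x - u y\<bar> \<le> L * \<bar>x - y\<bar>"
proof -
  obtain w where w: "\<And>x. (u has_real_derivative w x) (at x)" "\<exists>B\<ge>0. \<forall>x. \<bar>w x\<bar> \<le> B"
    by (rule u_C1) blast
  then show ?thesis using lipschitz_of_bounded_derivative[OF w(1)] by blast
qed

lemma integral_f_sin_pos: "0 < sin_coeff f 1"
proof -
  obtain x where x: "x \<in> {0..pi}" "u x \<noteq> 0" using sol unfolding is_solution_def by blast
  have "x \<noteq> 0" "x \<noteq> pi" using x u_0 u_pi by metis+
  then have s: "0 < sin x" using x by (intro sin_gt_zero) auto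
  have uc: "continuous_on {0..pi} u" using u_isCont by (intro continuous_at_imp_continuous_on) auto
  have "0 < (LINT y|lebesgue_on {0..pi}. f y * sin y)"
  proof (rule integral_pos_of_continuous)
    show "continuous_on {0..pi} (\<lambda>y. f y * sin y)" by (intro continuous_intros uc p)
    show "0 \<le> f y * sin y" if "y \<in> {0..pi}" for y
      using that u_nonneg[OF that] by (intro mult_nonneg_nonneg) (auto simp: signed_powr_nonneg_eq sin_ge_zero)
    show "f x * sin x \<noteq> 0" using s x by (auto simp: signed_powr_def sgn_if)
  qed (rule x)
  then show ?thesis by (simp add: sin_coeff_def)
qed

lemma lower_bound: "\<exists>c>0. \<forall>x\<in>{0..pi}. c * sin x \<le> u x"
proof (intro exI[of _ "sin_coeff f 1 / (4 * pi)"] conjI ballI)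
  show "0 < sin_coeff f 1 / (4 * pi)" using integral_f_sin_pos by simp
  fix x assume x: "x \<in> {0..pi}"
  have "sin_coeff f 1 / (4 * pi) * sin x = (LINT y|lebesgue_on {0..pi}. sin x / (4 * pi) * (f y * sin (1 * y)))"
    unfolding sin_coeff_def by simp
  also have "\<dots> \<le> Lambda_op 1 f x"
    unfolding Lambda_op_def
  proof (rule integral_mono_AE)
    show "integrable (lebesgue_on {0..pi}) (\<lambda>y. sin x / (4 * pi) * (f y * sin (1 * y)))"
      by (intro bdd_meas_integrable bdd_meas_cmult bdd_meas_mult fm bdd_meas_sin)
    show "integrable (lebesgue_on {0..pi}) (\<lambda>y. odd_kernel 1 x y * f y)"
      by (rule odd_kernel_mult_integrable[OF x fm]) auto
    show "AE y in lebesgue_on {0..pi}. sin x / (4 * pi) * (f y * sin (1 * y)) \<le> odd_kernel 1 x y * f y"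
      using AE_lebesgue_on_neq[of x 0 pi] AE_space
    proof eventually_elim
      case (elim y)
      then have y: "y \<in> {0..pi}" "x \<noteq> y" by auto
      have "sin x * sin y / (4 * pi) * f y \<le> odd_kernel 1 x y * f y"
        using odd_kernel_ge_sin[OF x y] u_nonneg[OF y(1)] by (intro mult_right_mono) (auto simp: signed_powr_nonneg_eq)
      then show ?case by (simp add: mult_ac)
    qed
  qed
  finally show "sin_coeff f 1 / (4 * pi) * sin x \<le> u x" unfolding u_eq'[symmetric] .
qed

text \<open>
  A solution is Lipschitz and vanishes at \<open>0\<close> and \<open>\<pi>\<close>.
\<close>

lemma upper_bound: "\<exists>C>0. \<forall>x\<in>{0..pi}. u x \<le> C * sin x"
proof -
  obtain L where L: "0 \<le> L" "\<forall>x y. \<bar>u x - u y\<bar> \<le> L * \<bar>x - y\<bar>" using u_lipschitz by blast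
  have s: "t \<le> 10 * sin t" if "0 \<le> t" "t \<le> pi / 2" for t
  proof -
    have "\<bar>t\<bar> / 10 \<le> \<bar>sin t\<bar>" by (rule abs_sin_ge) (use that pi_less_4 in auto)
    moreover have "0 \<le> sin t" using that by (intro sin_ge_zero) auto
    ultimately show ?thesis using that by simp
  qed
  have "u x \<le> (10 * L + 1) * sin x" if x: "x \<in> {0..pi}" for x
  proof -
    have "u x \<le> L * (10 * sin x)"
    proof (cases "x \<le> pi / 2")
      case True
      have "u x \<le> L * x" using L(2)[rule_format, of x 0] x by (simp add: u_0)
      also have "\<dots> \<le> L * (10 * sin x)" using s[of x] True x L by (intro mult_left_mono) auto
      finally show ?thesis .
    next
      case False
      have "u x \<le> L * (pi - x)" using L(2)[rule_format, of x pi] x by (simp add: u_pi)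
      also have "\<dots> \<le> L * (10 * sin (pi - x))" using s[of "pi - x"] False x L by (intro mult_left_mono) auto
      finally show ?thesis by simp
    qed
    moreover have "0 \<le> sin x" using x by (auto intro: sin_ge_zero)
    ultimately show ?thesis by (simp add: algebra_simps)
  qed
  then show ?thesis using L(1) by (intro exI[of _ "10 * L + 1"]) auto
qed

end

text \<open>
  Sublinearity: \<open>s w \<le> u\<close> implies \<open>s\<^sup>p w = \<Lambda>\<^sup>-\<^sup>1 ((s w)\<^sup>p) \<le> \<Lambda>\<^sup>-\<^sup>1 (u\<^sup>p) = u\<close>.  The comparison with the sine provides
  some \<open>s = t > 0\<close> to start from, and the exponents \<open>p\<^sup>n\<close> of \<open>t\<close> tend to \<open>0\<close>.
\<close>

lemma solution_le:
  assumes p: "0 < p" "p < 1" and u: "is_solution p u" and w: "is_solution p w" and x: "x \<in> {0..pi}"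
  shows "w x \<le> u x"
proof -
  interpret u: solution p u using p u by unfold_locales auto
  interpret w: solution p w using p w by unfold_locales auto
  obtain c where c: "0 < c" "\<forall>x\<in>{0..pi}. c * sin x \<le> u x" using u.lower_bound by blast
  obtain C where C: "0 < C" "\<forall>x\<in>{0..pi}. w x \<le> C * sin x" using w.upper_bound by blast
  define t where "t = c / C"
  have t: "0 < t" using c C by (simp add: t_def)
  have base: "t * w y \<le> u y" if "y \<in> {0..pi}" for y
  proof -
    have "t * w y \<le> t * (C * sin y)" using C(2) that t by (intro mult_left_mono) auto
    also have "\<dots> = c * sin y" using C(1) by (simp add: t_def)
    also have "\<dots> \<le> u y" using c(2) that by blast
    finally show ?thesis .
  qed
  have step: "s powr p * w y \<le> u y" if s: "0 < s" and le: "\<And>y. y \<in> {0..pi} \<Longrightarrow> s * w y \<le> u y" and y: "y \<in> {0..pi}" for s y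
  proof -
    have "s powr p * w y = s powr p * Lambda_op 1 (\<lambda>y. signed_powr p (w y)) y" by (subst w.u_eq) simp
    also have "\<dots> = Lambda_op 1 (\<lambda>y. s powr p * signed_powr p (w y)) y" by (simp add: Lambda_op_cmult)
    also have "\<dots> \<le> Lambda_op 1 (\<lambda>y. signed_powr p (u y)) y"
    proof (rule Lambda_op_mono[OF y bdd_meas_cmult[OF w.fm] u.fm])
      fix z assume z: "z \<in> {0..pi}"
      have "(s * w z) powr p \<le> u z powr p"
        using le[OF z] w.u_nonneg[OF z] s p by (intro powr_mono2) auto
      then show "s powr p * signed_powr p (w z) \<le> signed_powr p (u z)"
        using w.u_nonneg[OF z] u.u_nonneg[OF z] s by (simp add: signed_powr_nonneg_eq powr_mult)
    qed
    also have "\<dots> = u y" by (rule u.u_eq[symmetric])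
    finally show ?thesis .
  qed
  have iter: "\<forall>y\<in>{0..pi}. t powr (p ^ n) * w y \<le> u y" for n
  proof (induction n)
    case 0
    then show ?case using base t by simp
  next
    case (Suc n)
    have "(t powr (p ^ n)) powr p * w y \<le> u y" if "y \<in> {0..pi}" for y
      by (rule step) (use t Suc that in auto)
    then show ?case by (simp add: powr_powr mult.commute)
  qed
  have "(\<lambda>n. p ^ n) \<longlonglongrightarrow> 0" using p by (intro LIMSEQ_power_zero) auto
  then have "(\<lambda>n. t powr (p ^ n) * w x) \<longlonglongrightarrow> t powr 0 * w x"
    using t by (intro tendsto_mult tendsto_powr tendsto_const) auto
  then have "t powr 0 * w x \<le> u x" using iter x by (intro LIMSEQ_le_const2) auto
  then show ?thesis using t by simp
qed

section \<open>Fourier coefficients\<close>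

lemma set_LINT_Icc:
  fixes F :: "real \<Rightarrow> 'a::{banach, second_countable_topology}"
  shows "(LINT x:{a..b}|lebesgue. F x) = (LINT x|lebesgue_on {a..b}. F x)"
  by (simp add: set_lebesgue_integral_def integral_restrict_space)

lemma integrable_mult_bounded:
  fixes f g :: "real \<Rightarrow> real"
  assumes f: "integrable M f" and g: "g \<in> borel_measurable M" and b: "\<And>x. \<bar>g x\<bar> \<le> 1"
  shows "integrable M (\<lambda>x. f x * g x)"
proof (rule Bochner_Integration.integrable_bound[OF f])
  show "(\<lambda>x. f x * g x) \<in> borel_measurable M" using f g by (intro borel_measurable_times) auto
  show "AE x in M. norm (f x * g x) \<le> norm (f x)"
    using b by (intro AE_I2) (simp add: abs_mult mult_left_le)
qed

lemma fourier_coeff_real: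
  assumes f: "integrable (lebesgue_on {-pi..pi}) f"
  shows "fourier_coeff f k =
    Complex (LINT x|lebesgue_on {-pi..pi}. f x * cos (of_int k * x))
            (- (LINT x|lebesgue_on {-pi..pi}. f x * sin (of_int k * x))) / (2 * pi)"
proof -
  have i: "integrable (lebesgue_on {-pi..pi}) (\<lambda>x. f x * cos (of_int k * x))"
    "integrable (lebesgue_on {-pi..pi}) (\<lambda>x. f x * sin (of_int k * x))"
    by (rule integrable_mult_bounded[OF f sin_cos_measurable(2)], simp)
       (rule integrable_mult_bounded[OF f sin_cos_measurable(1)], simp)
  have "complex_of_real (f x) * cis (- (of_int k * x)) =
      of_real (f x * cos (of_int k * x)) - \<i> * of_real (f x * sin (of_int k * x))" for x
    by (simp add: complex_eq_iff)
  then have "(LINT x|lebesgue_on {-pi..pi}. complex_of_real (f x) * cis (- (of_int k * x)))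
     = (LINT x|lebesgue_on {-pi..pi}. of_real (f x * cos (of_int k * x)) - \<i> * of_real (f x * sin (of_int k * x)))"
    by simp
  also have "\<dots> = of_real (LINT x|lebesgue_on {-pi..pi}. f x * cos (of_int k * x))
       - \<i> * of_real (LINT x|lebesgue_on {-pi..pi}. f x * sin (of_int k * x))"
    using i by (simp del: of_real_mult)
  also have "\<dots> = Complex (LINT x|lebesgue_on {-pi..pi}. f x * cos (of_int k * x))
            (- (LINT x|lebesgue_on {-pi..pi}. f x * sin (of_int k * x)))"
    by (simp add: complex_eq_iff)
  finally show ?thesis by (simp add: fourier_coeff_def set_LINT_Icc)
qed

lemma fourier_coeff_diff:
  assumes "integrable (lebesgue_on {-pi..pi}) f" "integrable (lebesgue_on {-pi..pi}) g"
  shows "fourier_coeff (\<lambda>x. f x - g x) k = fourier_coeff f k - fourier_coeff g k"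
proof -
  have i: "integrable (lebesgue_on {-pi..pi}) (\<lambda>x. h x * cos (of_int k * x))"
    "integrable (lebesgue_on {-pi..pi}) (\<lambda>x. h x * sin (of_int k * x))"
    if "integrable (lebesgue_on {-pi..pi}) h" for h
    by (rule integrable_mult_bounded[OF that sin_cos_measurable(2)], simp)
       (rule integrable_mult_bounded[OF that sin_cos_measurable(1)], simp)
  show ?thesis
    using assms i[OF assms(1)] i[OF assms(2)]
    by (simp add: fourier_coeff_real left_diff_distrib diff_divide_distrib complex_eq_iff)
qed

lemma odd_integrals:
  assumes f: "bdd_meas f" and odd: "\<And>x. f (- x) = - f x"
  shows "integrable (lebesgue_on {-pi..pi}) f"
    and "(LINT x|lebesgue_on {-pi..pi}. f x * cos (c * x)) = 0"
    and "(LINT x|lebesgue_on {-pi..pi}. f x * sin (c * x)) = 2 * (LINT x|lebesgue_on {0..pi}. f x * sin (c * x))"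
proof -
  have c: "bdd_meas (\<lambda>x. f x * cos (c * x))" "bdd_meas (\<lambda>x. f x * sin (c * x))"
    by (intro bdd_meas_mult f continuous_bdd_meas continuous_intros)+
  have e: "integrable (lebesgue_on {-pi..pi}) F \<and>
      (LINT x|lebesgue_on {-pi..pi}. F x) = (LINT x|lebesgue_on {0..pi}. F (- x)) + (LINT x|lebesgue_on {0..pi}. F x)"
    if "bdd_meas F" "bdd_meas (\<lambda>x. F (- x))" for F
  proof -
    note r = integral_reflect_lebesgue_on[OF bdd_meas_integrable[OF that(2)]]
    show ?thesis
      using integral_combine_lebesgue_on[OF _ _ r(1) bdd_meas_integrable[OF that(1)]] r(2) by simp
  qed
  have m: "bdd_meas (\<lambda>x. - g x)" if "bdd_meas g" for g using bdd_meas_cmult[OF that, of "-1"] by simp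
  show "integrable (lebesgue_on {-pi..pi}) f"
    using e[of f] f m[OF f] by (simp add: odd)
  show "(LINT x|lebesgue_on {-pi..pi}. f x * cos (c * x)) = 0"
    using e[of "\<lambda>x. f x * cos (c * x)"] c(1) m[OF c(1)] by (simp add: odd)
  show "(LINT x|lebesgue_on {-pi..pi}. f x * sin (c * x)) = 2 * (LINT x|lebesgue_on {0..pi}. f x * sin (c * x))"
    using e[of "\<lambda>x. f x * sin (c * x)"] c(2) by (simp add: odd)
qed

lemma fourier_coeff_odd:
  assumes f: "bdd_meas f" and odd: "\<And>x. f (- x) = - f x"
  shows "fourier_coeff f k = - \<i> * of_int (sgn k) * of_real (sin_coeff f (nat \<bar>k\<bar>) / pi)"
proof -
  have "(LINT x|lebesgue_on {0..pi}. f x * sin (of_int k * x)) = of_int (sgn k) * sin_coeff f (nat \<bar>k\<bar>)"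
    unfolding sin_coeff_def by (cases "k > 0"; cases "k = 0") auto
  then show ?thesis
    unfolding fourier_coeff_real[OF odd_integrals(1)[OF f odd]] odd_integrals(2,3)[OF f odd]
    by (simp add: complex_eq_iff)
qed

lemma L2_continuous:
  assumes "\<And>x. isCont f x" "\<And>x. f (x + 2 * pi) = f x"
  shows "f \<in> L2_torus"
proof -
  have c: "continuous_on S f" for S using assms(1) by (simp add: continuous_at_imp_continuous_on)
  have "f \<in> borel_measurable lebesgue"
    using borel_measurable_continuous_onI[OF c] by (simp add: measurable_completion)
  moreover have "set_integrable lebesgue {-pi..pi} (\<lambda>x. (f x)\<^sup>2)"
    by (intro absolutely_integrable_continuous_real continuous_intros c)
  ultimately show ?thesis using assms(2) by (simp add: L2_torus_def)
qed

lemma L2_integrable: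
  assumes "f \<in> L2_torus"
  shows "integrable (lebesgue_on {-pi..pi}) f"
proof -
  have i: "integrable (lebesgue_on {-pi..pi}) (\<lambda>x. (f x)\<^sup>2 + 1)"
    using assms finite_measure.integrable_const[OF finite_measure_Icc]
    by (intro Bochner_Integration.integrable_add) (auto simp: L2_torus_def set_integrable_def integrable_restrict_space)
  show ?thesis
  proof (rule Bochner_Integration.integrable_bound[OF i])
    show "f \<in> borel_measurable (lebesgue_on {-pi..pi})"
      using assms by (simp add: L2_torus_def measurable_restrict_space1)
    have "\<bar>y\<bar> \<le> y\<^sup>2 + 1" for y :: real
      using zero_le_power2[of "\<bar>y\<bar> - 1"] zero_le_power2[of y] by (simp add: power2_eq_square algebra_simps) 
    then show "AE x in lebesgue_on {-pi..pi}. norm (f x) \<le> norm ((f x)\<^sup>2 + 1)"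
      by (intro AE_I2) (auto intro: order_trans[OF _ abs_ge_self])
  qed
qed

context solution
begin

lemma f_isCont: "isCont f x"
  using isCont_o2[OF u_isCont isCont_signed_powr[OF p(1)]] .

lemma fourier_coeff_u: "k \<noteq> 0 \<Longrightarrow> fourier_coeff u k = fourier_coeff f k / of_int \<bar>k\<bar>"
proof -
  assume k: "k \<noteq> 0"
  have "sin_coeff u (nat \<bar>k\<bar>) = sin_coeff f (nat \<bar>k\<bar>) / real (nat \<bar>k\<bar>)"
    by (subst u_eq') (rule sin_coeff_Lambda_op[OF fm], use k in auto)
  moreover have "complex_of_real \<bar>real_of_int k\<bar> = complex_of_int \<bar>k\<bar>"
    by (simp flip: of_int_abs)
  ultimately show ?thesis
    using k by (simp add: fourier_coeff_odd[OF um u_odd] fourier_coeff_odd[OF fm f_odd])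
qed

lemma Lambda_inv_u: "is_Lambda_inv f u"
  unfolding is_Lambda_inv_def fourier_multiplier_def
  using L2_continuous[OF f_isCont f_per] L2_continuous[OF u_isCont u_per] fourier_coeff_u
  by (simp add: fourier_coeff_odd[OF um u_odd] fourier_coeff_odd[OF fm f_odd])

end

section \<open>Vanishing Fourier coefficients\<close>

text \<open>
  For \<open>r = 1\<close> this is the function with jump \<open>\<pi>\<close> at the multiples of \<open>2\<pi>\<close> and slope \<open>-1/2\<close> elsewhere; its Abel
  means are bounded and are sums of sines.
\<close>

definition sawtooth :: "real \<Rightarrow> real \<Rightarrow> real" where
  "sawtooth r t = - Im (Ln (1 - of_real r * cis t))"

lemma sawtooth_eq:
  assumes "0 < t" "t < 2 * pi"
  shows "sawtooth 1 t = (pi - t) / 2"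
proof -
  have s: "0 < sin (t / 2)" using assms by (intro sin_gt_zero) auto
  define z where "z = Complex (ln (2 * sin (t / 2))) ((t - pi) / 2)"
  have c: "cos ((t - pi) / 2) = sin (t / 2)" "sin ((t - pi) / 2) = - cos (t / 2)"
    by (simp_all add: diff_divide_distrib cos_diff sin_diff)
  have "exp z = 1 - of_real 1 * cis t"
    using s cos_double_sin[of "t / 2"] sin_double[of "t / 2"]
    by (simp add: complex_eq_iff Re_exp Im_exp z_def c power2_eq_square)
  then have "Ln (1 - of_real 1 * cis t) = z"
    using Ln_exp[of z] assms by (simp add: z_def)
  then show ?thesis by (simp add: sawtooth_def z_def field_simps)
qed

lemma sawtooth_neg:
  assumes "- 2 * pi < t" "t < 0"
  shows "sawtooth 1 t = (- pi - t) / 2"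
proof -
  have "cis (t + 2 * pi) = cis t" by (simp add: complex_eq_iff)
  then have "sawtooth 1 t = sawtooth 1 (t + 2 * pi)" by (simp add: sawtooth_def)
  also have "\<dots> = (pi - (t + 2 * pi)) / 2" by (rule sawtooth_eq) (use assms in auto)
  finally show ?thesis by simp
qed

lemma one_minus_rcis_nonzero:
  assumes "0 \<le> r" "r < 1" shows "1 - of_real r * cis t \<noteq> 0"
proof
  assume "1 - of_real r * cis t = 0"
  then have "cmod 1 = cmod (of_real r * cis t)" by simp
  then show False using assms by (simp add: norm_mult)
qed

lemma sawtooth_sums:
  assumes "0 \<le> r" "r < 1"
  shows "(\<lambda>j. r ^ j / real j * sin (real j * t)) sums sawtooth r t"
  using sums_Im[OF Ln_one_minus_sums[OF assms, of t]] by (simp add: sawtooth_def)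

lemma sawtooth_bound:
  assumes "0 \<le> r" "r < 1"
  shows "\<bar>sawtooth r t\<bar> \<le> pi"
  using Im_Ln_le_pi[OF one_minus_rcis_nonzero[OF assms, of t]] mpi_less_Im_Ln[OF one_minus_rcis_nonzero[OF assms, of t]]
  by (simp add: sawtooth_def)

lemma sawtooth_lim:
  assumes "cos t \<noteq> 1"
  shows "(\<lambda>m. sawtooth (abel_radius m) t) \<longlonglongrightarrow> sawtooth 1 t"
  unfolding sawtooth_def
proof (intro tendsto_intros abel_lim)
  have "cos t < 1" using assms cos_le_one[of t] by linarith
  then show "1 - complex_of_real 1 * cis t \<notin> \<real>\<^sub>\<le>\<^sub>0"
    by (auto simp: complex_nonpos_Reals_iff)
qed

text \<open>
  The series of an Abel mean of the translated sawtooth can be integrated termwise against \<open>d\<close>, and each term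
  is a combination of Fourier coefficients of \<open>d\<close>.  The Abel means are bounded by \<open>\<pi>\<close>, so the limit \<open>r \<rightarrow> 1\<close> follows
  by dominated convergence.
\<close>

lemma integral_sawtooth_zero:
  assumes d: "integrable (lebesgue_on {-pi..pi}) d" and z: "\<And>k. fourier_coeff d k = 0"
    and a: "\<bar>a\<bar> \<le> pi"
  shows "integrable (lebesgue_on {-pi..pi}) (\<lambda>y. d y * sawtooth 1 (y - a))"
    and "(LINT y|lebesgue_on {-pi..pi}. d y * sawtooth 1 (y - a)) = 0"
proof -
  let ?M = "lebesgue_on {-pi..pi}"
  have i: "integrable ?M (\<lambda>x. d x * cos (c * x))" "integrable ?M (\<lambda>x. d x * sin (c * x))" for c
    by (rule integrable_mult_bounded[OF d sin_cos_measurable(2)], simp)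
       (rule integrable_mult_bounded[OF d sin_cos_measurable(1)], simp)
  have cs: "(LINT x|?M. d x * cos (real j * x)) = 0" "(LINT x|?M. d x * sin (real j * x)) = 0" for j
    using z[of "int j"] unfolding fourier_coeff_real[OF d] by (simp_all add: complex_eq_iff)
  have term0: "(LINT y|?M. r ^ j / real j * (d y * sin (real j * (y - a)))) = 0" for r j
  proof -
    have "(LINT y|?M. d y * sin (real j * (y - a)))
      = (LINT y|?M. cos (real j * a) * (d y * sin (real j * y)) - sin (real j * a) * (d y * cos (real j * y)))"
      by (intro Bochner_Integration.integral_cong) (auto simp: right_diff_distrib sin_diff)
    also have "\<dots> = 0" using i[of "real j"] cs[of j] by simp
    finally show ?thesis by simp
  qed
  have sm: "(\<lambda>y. sin (real j * (y - a))) \<in> borel_measurable ?M" for j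
    by (intro borel_imp_lebesgue_on borel_measurable_continuous_onI continuous_intros)
  have r: "(LINT y|?M. d y * sawtooth r (y - a)) = 0" "(\<lambda>y. d y * sawtooth r (y - a)) \<in> borel_measurable ?M"
    if r: "0 \<le> r" "r < 1" for r
  proof -
    have fm: "(\<lambda>y. r ^ j / real j * (d y * sin (real j * (y - a)))) \<in> borel_measurable ?M" for j
      using d by (intro borel_measurable_times borel_measurable_const sm) auto
    have fb: "\<bar>r ^ j / real j * (d y * sin (real j * (y - a)))\<bar> \<le> \<bar>d y\<bar> * r ^ j" for j y
    proof -
      have "r ^ j / real j \<le> r ^ j"
        using r by (cases "j = 0") (auto simp: divide_simps mult_le_cancel_left1)
      then have "(r ^ j / real j) * (\<bar>d y\<bar> * \<bar>sin (real j * (y - a))\<bar>) \<le> r ^ j * (\<bar>d y\<bar> * 1)"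
        using r by (intro mult_mono mult_left_mono) auto
      then show ?thesis using r by (simp add: abs_mult mult.commute)
    qed
    have fs: "(\<lambda>j. r ^ j / real j * (d y * sin (real j * (y - a)))) sums (d y * sawtooth r (y - a))" for y
      using sums_mult[OF sawtooth_sums[OF r, of "y - a"], of "d y"] by (simp add: mult_ac)
    note * = sums_integral_geometric[OF integrable_abs[OF d] fm fb r fs]
    show "(LINT y|?M. d y * sawtooth r (y - a)) = 0"
      using *(1) unfolding term0 using sums_unique2 sums_zero by blast
    show "(\<lambda>y. d y * sawtooth r (y - a)) \<in> borel_measurable ?M" by (rule *(2))
  qed
  have ptw: "AE y in ?M. (\<lambda>m. d y * sawtooth (abel_radius m) (y - a)) \<longlonglongrightarrow> d y * sawtooth 1 (y - a)"
    using AE_lebesgue_on_neq[of a "-pi" pi] AE_lebesgue_on_neq[of pi "-pi" pi] AE_lebesgue_on_neq[of "-pi" "-pi" pi] AE_space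
  proof eventually_elim
    case (elim y)
    have "cos (y - a) \<noteq> 1"
    proof
      assume "cos (y - a) = 1"
      then obtain k where k: "y - a = of_int k * 2 * pi" using cos_one_2pi_int by blast
      have "\<bar>y - a\<bar> < 2 * pi" using elim a by auto
      then have "\<bar>of_int k\<bar> < (1::real)" unfolding k by (simp add: abs_mult)
      then have "k = 0" by linarith
      then show False using k elim by simp
    qed
    then show ?case by (intro tendsto_intros sawtooth_lim)
  qed
  have dom: "AE y in ?M. norm (d y * sawtooth (abel_radius m) (y - a)) \<le> \<bar>d y\<bar> * pi" for m
    using sawtooth_bound[OF abel_bounds] by (intro AE_I2) (auto simp: abs_mult intro!: mult_left_mono)
  have lm: "(\<lambda>y. d y * sawtooth 1 (y - a)) \<in> borel_measurable ?M"
  proof -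
    have "sawtooth 1 \<in> borel_measurable borel"
      unfolding sawtooth_def[abs_def] cis_conv_exp by measurable
    then have "(\<lambda>y. sawtooth 1 (y - a)) \<in> borel_measurable borel"
      by (rule measurable_compose[rotated]) simp
    then have "(\<lambda>y. sawtooth 1 (y - a)) \<in> borel_measurable ?M" by (rule borel_imp_lebesgue_on)
    then show ?thesis using d by (intro borel_measurable_times) auto
  qed
  have iw: "integrable ?M (\<lambda>y. \<bar>d y\<bar> * pi)" using d by simp
  show "integrable ?M (\<lambda>y. d y * sawtooth 1 (y - a))"
    by (rule integrable_dominated_convergence[OF lm r(2)[OF abel_bounds] iw ptw dom])
  have "(\<lambda>m. LINT y|?M. d y * sawtooth (abel_radius m) (y - a)) \<longlonglongrightarrow> (LINT y|?M. d y * sawtooth 1 (y - a))"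
    by (rule integral_dominated_convergence[OF lm r(2)[OF abel_bounds] iw ptw dom])
  then show "(LINT y|?M. d y * sawtooth 1 (y - a)) = 0"
    using r(1)[OF abel_bounds] by (simp add: LIMSEQ_const_iff)
qed

text \<open>
  The difference of two sawtooth functions with jumps at \<open>a\<close> and \<open>b\<close> is a constant plus \<open>\<pi>\<close> times the
  indicator function of \<open>[a,b]\<close>.
\<close>

lemma integral_zero_of_fourier_coeff_zero:
  assumes d: "integrable (lebesgue_on {-pi..pi}) d" and z: "\<And>k. fourier_coeff d k = 0"
    and ab: "0 \<le> a" "a < b" "b \<le> pi"
  shows "(LINT y|lebesgue_on {a..b}. d y) = 0"
proof -
  let ?M = "lebesgue_on {-pi..pi}"
  note A = integral_sawtooth_zero[OF d z, of a]
  note B = integral_sawtooth_zero[OF d z, of b]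
  have d0: "(LINT y|?M. d y) = 0"
    using z[of 0] unfolding fourier_coeff_real[OF d] by (simp add: complex_eq_iff)
  have "(LINT y|?M. d y * sawtooth 1 (y - a) - d y * sawtooth 1 (y - b)) = 0"
    using A B ab by simp
  moreover have "(LINT y|?M. d y * sawtooth 1 (y - a) - d y * sawtooth 1 (y - b))
     = (LINT y|?M. (a - b) / 2 * d y + pi * (indicator {a..b} y * d y))"
  proof (rule integral_cong_AE)
    show "(\<lambda>y. d y * sawtooth 1 (y - a) - d y * sawtooth 1 (y - b)) \<in> borel_measurable ?M"
      using A(1) B(1) ab by (intro borel_measurable_diff) auto
    have "(\<lambda>y. indicator {a..b} y :: real) \<in> borel_measurable ?M"
      by (intro borel_imp_lebesgue_on) measurable
    then show "(\<lambda>y. (a - b) / 2 * d y + pi * (indicator {a..b} y * d y)) \<in> borel_measurable ?M"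
      using d by (intro borel_measurable_add borel_measurable_times borel_measurable_const) auto
    \<comment> \<open>Besides the jumps at \<open>a\<close> and \<open>b\<close>, the point \<open>-\<pi>\<close> is left out, where \<open>y - b = -2\<pi>\<close> if \<open>b = \<pi>\<close>.\<close>
    show "AE y in ?M. d y * sawtooth 1 (y - a) - d y * sawtooth 1 (y - b) = (a - b) / 2 * d y + pi * (indicator {a..b} y * d y)"
      using AE_lebesgue_on_neq[of a "-pi" pi] AE_lebesgue_on_neq[of b "-pi" pi] AE_lebesgue_on_neq[of "-pi" "-pi" pi] AE_space
    proof eventually_elim
      case (elim y)
      then have y: "-pi < y" "y \<le> pi" "y \<noteq> a" "y \<noteq> b" by auto
      have "sawtooth 1 (y - a) - sawtooth 1 (y - b) = (a - b) / 2 + pi * indicator {a..b} y"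
      proof -
        consider "y < a" | "a < y" "y < b" | "b < y" using y by linarith
        then show ?thesis
        proof cases
          case 1
          have "sawtooth 1 (y - a) = (- pi - (y - a)) / 2" "sawtooth 1 (y - b) = (- pi - (y - b)) / 2"
            by (rule sawtooth_neg; use y ab 1 in simp)+
          then show ?thesis using 1 ab by (simp add: field_simps)
        next
          case 2
          have "sawtooth 1 (y - a) = (pi - (y - a)) / 2" by (rule sawtooth_eq; use y ab 2 in simp)
          moreover have "sawtooth 1 (y - b) = (- pi - (y - b)) / 2" by (rule sawtooth_neg; use y ab 2 in simp)
          ultimately show ?thesis using 2 ab by (simp add: field_simps)
        next
          case 3
          have "sawtooth 1 (y - a) = (pi - (y - a)) / 2" "sawtooth 1 (y - b) = (pi - (y - b)) / 2"
            by (rule sawtooth_eq; use y ab 3 in simp)+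
          then show ?thesis using 3 ab by (simp add: field_simps)
        qed
      qed
      then have "d y * (sawtooth 1 (y - a) - sawtooth 1 (y - b)) = d y * ((a - b) / 2 + pi * indicator {a..b} y)" by simp
      also have "\<dots> = (a - b) / 2 * d y + pi * (indicator {a..b} y * d y)" by (simp add: distrib_left)
      finally show ?case by (simp add: right_diff_distrib)
    qed
  qed
  moreover have ii: "integrable ?M (\<lambda>y. indicator {a..b} y * d y)"
    using integrable_mult_bounded[OF d, of "indicator {a..b}"] by (simp add: mult.commute borel_imp_lebesgue_on indicator_def)
  ultimately have "(LINT y|?M. indicator {a..b} y * d y) = 0"
    using d d0 by simp
  moreover have "(LINT y|?M. indicator {a..b} y * d y) = (LINT y|lebesgue_on {a..b}. d y)"
    using ab by (simp add: integral_restrict_space mult.assoc[symmetric] indicator_inter_arith[symmetric] Int_absorb1)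
  ultimately show ?thesis by simp
qed

lemma continuous_zero_of_integrals_zero:
  fixes d :: "real \<Rightarrow> real"
  assumes c: "continuous_on {0..pi} d" and z: "\<And>a b. 0 \<le> a \<Longrightarrow> a < b \<Longrightarrow> b \<le> pi \<Longrightarrow> (LINT y|lebesgue_on {a..b}. d y) = 0"
    and x: "x \<in> {0..pi}"
  shows "d x = 0"
proof (rule vector_derivative_unique_within_closed_interval[of 0 pi x "\<lambda>u. integral {0..u} d"])
  show "((\<lambda>u. integral {0..u} d) has_vector_derivative d x) (at x within cbox 0 pi)"
    using integral_has_vector_derivative[OF c x] by simp
  have "integral {0..u} d = 0" if u: "u \<in> {0..pi}" for u
  proof (cases "u = 0")
    case False
    have "integrable (lebesgue_on {0..u}) d"
      by (rule integrable_subinterval_lebesgue_on[OF bdd_meas_integrable[OF continuous_bdd_meas[OF c]]]) (use u in auto)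
    then show ?thesis using z[of 0 u] u False lebesgue_integral_eq_integral[of "{0..u}" d] by simp
  qed simp
  then show "((\<lambda>u. integral {0..u} d) has_vector_derivative 0) (at x within cbox 0 pi)"
    using x by (intro has_vector_derivative_transform[OF _ _ has_vector_derivative_const[of 0]]) auto
qed (use x in auto)

section \<open>Odd extensions and fixed points\<close>

lemma torus_rep_range: "- pi < torus_rep x" "torus_rep x \<le> pi"
proof -
  define k where "k = \<lceil>(x - pi) / (2 * pi)\<rceil>"
  have "of_int k - 1 < (x - pi) / (2 * pi)" "(x - pi) / (2 * pi) \<le> of_int k"
    unfolding k_def by linarith+
  then show "- pi < torus_rep x" "torus_rep x \<le> pi"
    unfolding torus_rep_def k_def[symmetric] by (simp_all add: field_simps)
qed

lemma torus_rep_decomp: "\<exists>k. x = torus_rep x + of_int k * (2 * pi)"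
  by (rule exI[of _ "\<lceil>(x - pi) / (2 * pi)\<rceil>"]) (simp add: torus_rep_def)

lemma torus_rep_eq:
  assumes "- pi < y" "y \<le> pi"
  shows "torus_rep (y + of_int k * (2 * pi)) = y"
proof -
  have "\<lceil>(y + of_int k * (2 * pi) - pi) / (2 * pi)\<rceil> = k"
    by (rule ceiling_unique) (use assms in \<open>auto simp: field_simps\<close>)
  then show ?thesis by (simp add: torus_rep_def)
qed

lemma torus_rep_periodic: "torus_rep (x + 2 * pi) = torus_rep x"
proof -
  obtain k where k: "x = torus_rep x + of_int k * (2 * pi)" using torus_rep_decomp by blast
  have "torus_rep (torus_rep x + of_int (k + 1) * (2 * pi)) = torus_rep x"
    by (rule torus_rep_eq) (rule torus_rep_range)+
  moreover have "x + 2 * pi = torus_rep x + of_int (k + 1) * (2 * pi)" using k by (simp add: algebra_simps)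
  ultimately show ?thesis by simp
qed

lemma odd_ext_periodic: "odd_ext w (x + 2 * pi) = odd_ext w x"
  by (simp add: odd_ext_def torus_rep_periodic)

lemma odd_ext_Icc:
  assumes "x \<in> {0..pi}" shows "odd_ext w x = w x"
proof -
  have "torus_rep x = x" using torus_rep_eq[of x 0] assms pi_gt_zero by (simp del: pi_gt_zero)
  then show ?thesis using assms by (simp add: odd_ext_def)
qed

lemma odd_ext_minus:
  assumes "sin x \<noteq> 0" shows "odd_ext w (- x) = - odd_ext w x"
proof -
  define y where "y = torus_rep x"
  obtain k where k: "x = y + of_int k * (2 * pi)" using torus_rep_decomp y_def by blast
  have "sin x = sin y" unfolding k using sin_int_times_real periodic_integer_shift[of sin "2 * pi" y k] by simp
  then have y: "y \<noteq> 0" "y \<noteq> pi" using assms by auto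
  have r: "- pi < y" "y < pi" using torus_rep_range[of x] y by (auto simp: y_def)
  have "torus_rep (- y + of_int (- k) * (2 * pi)) = - y" by (rule torus_rep_eq) (use r in auto)
  moreover have "- x = - y + of_int (- k) * (2 * pi)" using k by simp
  ultimately have "torus_rep (- x) = - y" by simp
  then show ?thesis using y by (auto simp: odd_ext_def y_def[symmetric] Let_def)
qed

lemma odd_ext_of_odd_periodic:
  assumes odd: "\<And>x. F (- x) = - F x" and per: "\<And>x. F (x + 2 * pi) = F x"
    and w: "\<And>y. y \<in> {0..pi} \<Longrightarrow> w y = F y"
  shows "odd_ext w x = F x"
proof -
  define y where "y = torus_rep x"
  obtain k where k: "x = y + of_int k * (2 * pi)" using torus_rep_decomp y_def by blast
  have "F x = F y" unfolding k by (rule periodic_integer_shift) (rule per)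
  then show ?thesis
    using torus_rep_range[of x] w[of y] w[of "- y"] odd[of y]
    by (auto simp: odd_ext_def y_def[symmetric] Let_def)
qed

text \<open>
  The function \<open>V\<close> has the same Fourier coefficients as \<open>u = \<Lambda>\<^sup>-\<^sup>1 (w\<^sup>p)\<close>, so \<open>V - u\<close> has vanishing integrals
  over the subintervals of \<open>[0,\<pi>]\<close>, and there it is the continuous function \<open>w - u\<close>.  At the multiples of \<open>\<pi>\<close> the
  extension \<open>f\<close> of \<open>w\<^sup>p\<close> need not be odd, as \<open>w 0 = w \<pi> = 0\<close> is only a consequence; the function \<open>f'\<close> corrects the
  values on this null set.
\<close>

lemma fixed_point_imp_solution:
  assumes p: "0 < p" and w: "continuous_on {0..pi} w" "\<And>x. x \<in> {0..pi} \<Longrightarrow> 0 \<le> w x" "\<exists>x\<in>{0..pi}. w x \<noteq> 0"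
    and V: "is_Lambda_inv (odd_ext (\<lambda>x. w x powr p)) V" "\<And>x. x \<in> {0..pi} \<Longrightarrow> w x = V x"
  shows "\<exists>u. is_solution p u \<and> (\<forall>x\<in>{0..pi}. w x = u x)"
proof -
  define g where "g y = w y powr p" for y
  define f where "f = odd_ext g"
  define f' where "f' x = (if sin x \<noteq> 0 then f x else 0)" for x
  define u where "u = Lambda_op 1 g"
  have gc: "continuous_on {0..pi} g"
    unfolding g_def using p w(2) by (intro continuous_on_powr' w(1) continuous_on_const) auto
  have gm: "bdd_meas g" by (rule continuous_bdd_meas[OF gc])
  have fL: "f \<in> L2_torus" "fourier_coeff f 0 = 0" and VL: "V \<in> L2_torus" "fourier_coeff V 0 = 0"
    and Vk: "\<And>k. k \<noteq> 0 \<Longrightarrow> fourier_coeff V k = 1 / of_int \<bar>k\<bar> * fourier_coeff f k"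
    using V(1) unfolding is_Lambda_inv_def fourier_multiplier_def f_def g_def by auto
  have f'_eq: "f' x = (if sin x \<noteq> 0 then g x else 0)" if "x \<in> {0..pi}" for x
    using odd_ext_Icc[OF that] by (simp add: f'_def f_def)
  have f'_odd: "f' (- x) = - f' x" for x using odd_ext_minus[of x g] by (simp add: f'_def f_def)
  have f'_per: "f' (x + 2 * pi) = f' x" for x by (simp add: f'_def f_def odd_ext_periodic)
  have "open {x::real. sin x \<noteq> 0}" by (intro open_Collect_neq continuous_intros)
  then have "(indicator {x::real. sin x \<noteq> 0} :: real \<Rightarrow> real) \<in> borel_measurable borel" by simp
  moreover have "indicator {x::real. sin x \<noteq> 0} = (\<lambda>x. if sin x \<noteq> 0 then 1 else 0 :: real)"
    by (auto simp: indicator_def)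
  ultimately have jm: "(\<lambda>x::real. if sin x \<noteq> 0 then 1 else 0 :: real) \<in> borel_measurable borel" by simp
  have f'_alt: "f' = (\<lambda>x. f x * (if sin x \<noteq> 0 then 1 else 0))" by (auto simp: f'_def)
  have f'_meas: "f' \<in> borel_measurable (lebesgue_on S)" for S
    unfolding f'_alt using fL(1)
    by (intro borel_measurable_times borel_imp_lebesgue_on[OF jm]) (simp add: L2_torus_def measurable_restrict_space1)
  have f'm: "bdd_meas f'"
  proof -
    obtain M where M: "0 \<le> M" "\<And>y. y \<in> {0..pi} \<Longrightarrow> \<bar>g y\<bar> \<le> M" using bdd_meas_bound[OF gm] by blast
    then have "\<forall>y\<in>{0..pi}. \<bar>f' y\<bar> \<le> M" by (simp add: f'_eq)
    then show ?thesis using f'_meas unfolding bdd_meas_def by blast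
  qed
  have sin0: "AE x in lebesgue_on {a..b}. sin x \<noteq> 0" if "-pi \<le> a" "b \<le> pi" for a b
    using AE_lebesgue_on_neq[of 0 a b] AE_lebesgue_on_neq[of pi a b] AE_lebesgue_on_neq[of "-pi" a b] AE_space
  proof eventually_elim
    case (elim x)
    then have "x \<noteq> 0" "\<bar>x\<bar> < pi" using that by auto
    then show ?case using sin_gt_zero[of x] sin_gt_zero[of "- x"] by (cases "x > 0") auto
  qed
  have u': "u = Lambda_op 1 f'"
  proof
    have r: "Lambda_op 1 g x = Lambda_op 1 f' x" if x: "x \<in> {0..pi}" for x
      unfolding Lambda_op_def
    proof (rule integral_cong_AE)
      have s0: "AE y in lebesgue_on {0..pi}. sin y \<noteq> 0" by (rule sin0) auto
      show "AE y in lebesgue_on {0..pi}. odd_kernel 1 x y * g y = odd_kernel 1 x y * f' y"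
        using s0 AE_space by eventually_elim (auto simp: f'_eq)
    qed (use odd_kernel_mult_integrable[OF x gm, of 1] odd_kernel_mult_integrable[OF x f'm, of 1] in auto)
    show "u x = Lambda_op 1 f' x" for x
      unfolding u_def by (rule odd_periodic_eqI) (use r in auto)
  qed
  have u_cont: "isCont u x" for x unfolding u' by (rule isCont_Lambda_op[OF f'm f'_odd f'_per])
  have um: "bdd_meas u" unfolding u_def by (rule Lambda_op_bdd_meas[OF gm])
  have u_odd: "u (- x) = - u x" for x by (simp add: u_def)
  have u_int: "integrable (lebesgue_on {-pi..pi}) u" by (rule odd_integrals(1)[OF um u_odd])
  have V_int: "integrable (lebesgue_on {-pi..pi}) V" by (rule L2_integrable[OF VL(1)])
  have ff': "fourier_coeff f k = fourier_coeff f' k" for k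
    unfolding fourier_coeff_def set_LINT_Icc
  proof (rule arg_cong[where f="\<lambda>z. z / _"], rule integral_cong_AE)
    have s0: "AE y in lebesgue_on {-pi..pi}. sin y \<noteq> 0" by (rule sin0) auto
    have om: "complex_of_real \<in> borel_measurable borel"
      by (intro borel_measurable_continuous_onI continuous_intros)
    show "AE x in lebesgue_on {-pi..pi}. complex_of_real (f x) * cis (- (of_int k * x)) = complex_of_real (f' x) * cis (- (of_int k * x))"
      using s0 by eventually_elim (auto simp: f'_def)
    have cm: "(\<lambda>x. cis (- (of_int k * x))) \<in> borel_measurable (lebesgue_on {-pi..pi})"
      unfolding cis_conv_exp
      by (intro borel_imp_lebesgue_on borel_measurable_continuous_onI continuous_intros)
    have "f \<in> borel_measurable (lebesgue_on {-pi..pi})"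
      using fL(1) by (simp add: L2_torus_def measurable_restrict_space1)
    then show "(\<lambda>x. complex_of_real (f x) * cis (- (of_int k * x))) \<in> borel_measurable (lebesgue_on {-pi..pi})"
      by (intro borel_measurable_times cm measurable_compose[OF _ om])
    show "(\<lambda>x. complex_of_real (f' x) * cis (- (of_int k * x))) \<in> borel_measurable (lebesgue_on {-pi..pi})"
      by (intro borel_measurable_times cm measurable_compose[OF _ om] f'_meas)
  qed
  have sc: "sin_coeff f' j = sin_coeff g j" for j
    unfolding sin_coeff_def
  proof (intro Bochner_Integration.integral_cong refl)
    fix x assume "x \<in> space (lebesgue_on {0..pi})"
    then have x: "x \<in> {0..pi}" by simp
    show "f' x * sin (real j * x) = g x * sin (real j * x)"
    proof (cases "sin x = 0")
      case True
      then have "x = 0 \<or> x = pi" using x sin_gt_zero[of x] by force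
      then have "sin (real j * x) = 0" by (auto simp: sin_npi)
      then show ?thesis by simp
    qed (simp add: f'_eq[OF x])
  qed
  have d0: "fourier_coeff (\<lambda>x. V x - u x) k = 0" for k
  proof (cases "k = 0")
    case True
    then show ?thesis
      using VL(2) by (simp add: fourier_coeff_diff[OF V_int u_int] fourier_coeff_odd[OF um u_odd])
  next
    case False
    have "sin_coeff u (nat \<bar>k\<bar>) = sin_coeff g (nat \<bar>k\<bar>) / real (nat \<bar>k\<bar>)"
      unfolding u_def by (rule sin_coeff_Lambda_op[OF gm]) (use False in auto)
    moreover have "complex_of_real \<bar>real_of_int k\<bar> = complex_of_int \<bar>k\<bar>"
      by (simp flip: of_int_abs)
    ultimately show ?thesis
      using Vk[OF False] False
      by (simp add: fourier_coeff_diff[OF V_int u_int] fourier_coeff_odd[OF um u_odd] ff' fourier_coeff_odd[OF f'm f'_odd] sc)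
  qed
  have wu: "w x = u x" if x: "x \<in> {0..pi}" for x
  proof -
    have "w x - u x = 0"
    proof (rule continuous_zero_of_integrals_zero[OF _ _ x])
      show "continuous_on {0..pi} (\<lambda>x. w x - u x)"
        by (intro continuous_intros w(1) continuous_at_imp_continuous_on) (use u_cont in auto)
      fix a b :: real assume ab: "0 \<le> a" "a < b" "b \<le> pi"
      have "(LINT y|lebesgue_on {a..b}. w y - u y) = (LINT y|lebesgue_on {a..b}. V y - u y)"
        using ab V(2) by (intro Bochner_Integration.integral_cong) auto
      also have "\<dots> = 0"
        by (rule integral_zero_of_fourier_coeff_zero[OF _ d0 ab]) (use V_int u_int in simp)
      finally show "(LINT y|lebesgue_on {a..b}. w y - u y) = 0" .
    qed
    then show ?thesis by simp
  qed
  have "is_solution p u"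
    unfolding is_solution_def
  proof (intro conjI allI ballI um)
    fix x
    show "u x = Lambda_op 1 (\<lambda>y. signed_powr p (u y)) x"
    proof (subst u_def, rule Lambda_op_cong)
      fix y assume y: "y \<in> {0..pi}"
      show "g y = signed_powr p (u y)" using wu[OF y] w(2)[OF y] by (simp add: g_def signed_powr_nonneg_eq)
    qed
  next
    show "0 \<le> u x" if "x \<in> {0..pi}" for x using wu[OF that] w(2)[OF that] by simp
    show "\<exists>x\<in>{0..pi}. u x \<noteq> 0" using wu w(3) by auto
  qed
  then show ?thesis using wu by blast
qed

section \<open>Rescaling and integration by parts\<close>

lemma fourier_coeff_HK:
  assumes "\<And>x. isCont \<psi> x"
  shows "((\<lambda>x. of_real (\<psi> x) * cis (- (of_int k * x))) has_integral fourier_coeff \<psi> k * (2 * pi)) {-pi..pi}"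
proof -
  have c: "continuous_on S \<psi>" for S using assms by (simp add: continuous_at_imp_continuous_on)
  have "(\<lambda>x. complex_of_real (\<psi> x) * cis (- (of_int k * x))) absolutely_integrable_on {-pi..pi}"
    by (intro absolutely_integrable_continuous_real continuous_intros c)
  then have "integrable (lebesgue_on {-pi..pi}) (\<lambda>x. complex_of_real (\<psi> x) * cis (- (of_int k * x)))"
    by (simp add: integrable_restrict_space set_integrable_def)
  from has_integral_integral_lebesgue_on[OF this] show ?thesis
    by (simp add: fourier_coeff_def set_LINT_Icc)
qed

text \<open>
  Translation by \<open>2\<pi>/n\<close> does not change \<open>\<psi>(n x)\<close>, but multiplies its \<open>k\<close>-th Fourier coefficient by a root of
  unity, which differs from \<open>1\<close> unless \<open>n\<close> divides \<open>k\<close>.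
\<close>

lemma fourier_coeff_scale_not_dvd:
  assumes c: "\<And>x. isCont \<psi> x" and per: "\<And>x. \<psi> (x + 2 * pi) = \<psi> x" and n: "n \<ge> 1" and k: "\<not> int n dvd k"
  shows "fourier_coeff (\<lambda>x. \<psi> (real n * x)) k = 0"
proof -
  define E where "E x = complex_of_real (\<psi> (real n * x)) * cis (- (of_int k * x))" for x
  define I where "I = fourier_coeff (\<lambda>x. \<psi> (real n * x)) k * (2 * pi)"
  define a where "a = 2 * pi / real n"
  have cn: "isCont (\<lambda>x. \<psi> (real n * x)) x" for x
    by (intro isCont_o2[OF _ c] continuous_intros)
  have per_n: "\<psi> (y + of_int m * (2 * pi)) = \<psi> y" for y m by (rule periodic_integer_shift) (rule per)
  have E: "(E has_integral I) {-pi..pi}" using fourier_coeff_HK[OF cn, of k] by (simp add: E_def[abs_def] I_def)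
  have Eper: "E (x + 2 * pi) = E x" for x
  proof -
    have "\<psi> (real n * (x + 2 * pi)) = \<psi> (real n * x)"
      using per_n[of "real n * x" "int n"] by (simp add: algebra_simps)
    moreover have "cis (- (of_int k * (x + 2 * pi))) = cis (- (of_int k * x))"
    proof -
      have "cis (- (of_int k * (x + 2 * pi))) = cis (- (of_int k * x)) * cis (2 * pi * of_int (- k))"
        by (simp add: cis_mult algebra_simps)
      also have "cis (2 * pi * of_int (- k)) = 1" by (rule cis_multiple_2pi) simp
      finally show ?thesis by simp
    qed
    ultimately show ?thesis by (simp add: E_def)
  qed
  have Ea: "E (x + a) = cis (- (of_int k * a)) * E x" for x
  proof -
    have "real n * (x + a) = real n * x + of_int 1 * (2 * pi)" using n by (simp add: a_def field_simps)
    then have "\<psi> (real n * (x + a)) = \<psi> (real n * x)" using per_n by metis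
    then show ?thesis by (simp add: E_def cis_mult algebra_simps)
  qed
  have "(E has_integral I) {-pi + a..-pi + a + 2 * pi}"
    by (rule has_integral_periodic_shift[where a="-pi"]) (use Eper E in auto)
  from has_integral_shift_real_ivl[OF this, of a]
  have "((\<lambda>x. E (x + a)) has_integral I) {-pi..pi}" by simp
  moreover have "((\<lambda>x. E (x + a)) has_integral cis (- (of_int k * a)) * I) {-pi..pi}"
    unfolding Ea by (rule has_integral_mult_right[OF E])
  ultimately have "cis (- (of_int k * a)) * I = I" using has_integral_unique by blast
  moreover have "cis (- (of_int k * a)) \<noteq> 1"
  proof
    assume "cis (- (of_int k * a)) = 1"
    then have "cos (of_int k * a) = 1" by (simp add: complex_eq_iff)
    then obtain m where "of_int k * a = of_int m * 2 * pi" using cos_one_2pi_int by blast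
    then have "of_int k = of_int m * real n" using n by (simp add: a_def field_simps)
    then have "of_int k = (of_int (m * int n) :: real)" by simp
    then have "k = m * int n" by (simp only: of_int_eq_iff)
    then show False using k by simp
  qed
  ultimately have "I = 0" by (metis mult_cancel_right1)
  then show ?thesis by (simp add: I_def)
qed

lemma fourier_coeff_scale_mult:
  assumes c: "\<And>x. isCont \<psi> x" and per: "\<And>x. \<psi> (x + 2 * pi) = \<psi> x" and n: "n \<ge> 1"
  shows "fourier_coeff (\<lambda>x. \<psi> (real n * x)) (int n * m) = fourier_coeff \<psi> m"
proof -
  define E where "E x = complex_of_real (\<psi> x) * cis (- (of_int m * x))" for x
  define I where "I = fourier_coeff \<psi> m * (2 * pi)"
  have cn: "isCont (\<lambda>x. \<psi> (real n * x)) x" for x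
    by (intro isCont_o2[OF _ c] continuous_intros)
  have E: "(E has_integral I) {-pi..pi}" using fourier_coeff_HK[OF c, of m] by (simp add: E_def[abs_def] I_def)
  have Eper: "E (x + 2 * pi) = E x" for x
  proof -
    have "cis (- (of_int m * (x + 2 * pi))) = cis (- (of_int m * x)) * cis (2 * pi * of_int (- m))"
      by (simp add: cis_mult algebra_simps)
    also have "cis (2 * pi * of_int (- m)) = 1" by (rule cis_multiple_2pi) simp
    finally show ?thesis by (simp add: E_def per)
  qed
  have E1: "(E has_integral I) {a..a + 2 * pi}" for a
    by (rule has_integral_periodic_shift[where a="-pi"]) (use Eper E in auto)
  have "(E has_integral of_nat j * I) {a..a + real j * (2 * pi)}" for j a
  proof (induction j)
    case (Suc j)
    have "(E has_integral of_nat j * I + I) {a..(a + real j * (2 * pi)) + 2 * pi}"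
      by (rule has_integral_combine[OF _ _ Suc E1]) auto
    then show ?case by (simp add: algebra_simps)
  qed (simp add: has_integral_refl)
  from this[of n "- real n * pi"] have "(E has_integral of_nat n * I) (cbox (- real n * pi) (real n * pi))"
    by (simp add: mult.commute)
  from has_integral_affinity'[OF this, of "real n" 0] n
  have "((\<lambda>x. E (real n *\<^sub>R x + 0)) has_integral (of_nat n * I) /\<^sub>R real n ^ DIM(real))
      (cbox ((- real n * pi - 0) /\<^sub>R real n) ((real n * pi - 0) /\<^sub>R real n))" by auto
  moreover have e: "(- real n * pi - 0) /\<^sub>R real n = - pi" "(real n * pi - 0) /\<^sub>R real n = pi"
    "(of_nat n * I) /\<^sub>R real n ^ DIM(real) = I"
    using n by (auto simp: scaleR_conv_of_real field_simps)
  ultimately have "((\<lambda>x. E (real n * x)) has_integral I) {-pi..pi}"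
    by (simp only: e real_scaleR_def add_0_right cbox_interval)
  moreover have "E (real n * x) = complex_of_real (\<psi> (real n * x)) * cis (- (of_int (int n * m) * x))" for x
    by (simp add: E_def mult_ac)
  ultimately have "((\<lambda>x. complex_of_real (\<psi> (real n * x)) * cis (- (of_int (int n * m) * x))) has_integral I) {-pi..pi}" by simp
  from has_integral_unique[OF this fourier_coeff_HK[OF cn]] show ?thesis by (simp add: I_def)
qed

lemma fourier_coeff_cmult: "fourier_coeff (\<lambda>x. c * f x) k = of_real c * fourier_coeff f k"
  unfolding fourier_coeff_def set_LINT_Icc by (simp add: mult.assoc)

lemma integral_deriv_periodic:
  fixes F :: "real \<Rightarrow> 'a::euclidean_space"
  assumes "\<And>x. (F has_vector_derivative F' x) (at x)" "continuous_on {-pi..pi} F'" "F pi = F (- pi)"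
  shows "integrable (lebesgue_on {-pi..pi}) F'" "(LINT x|lebesgue_on {-pi..pi}. F' x) = 0"
proof -
  have "F' absolutely_integrable_on {-pi..pi}" by (rule absolutely_integrable_continuous_real[OF assms(2)])
  then show i: "integrable (lebesgue_on {-pi..pi}) F'"
    by (simp add: integrable_restrict_space set_integrable_def)
  have "(F' has_integral F pi - F (- pi)) {-pi..pi}"
    by (rule fundamental_theorem_of_calculus) (auto intro: has_vector_derivative_at_within assms)
  then show "(LINT x|lebesgue_on {-pi..pi}. F' x) = 0"
    using has_integral_integral_lebesgue_on[OF i] assms(3) has_integral_unique by auto
qed

lemma integrable_continuous_Icc:
  fixes F :: "real \<Rightarrow> 'a::euclidean_space"
  assumes "continuous_on {a..b} F" shows "integrable (lebesgue_on {a..b}) F"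
  using absolutely_integrable_continuous_real[OF assms]
  by (simp add: integrable_restrict_space set_integrable_def)

lemma integration_by_parts_periodic:
  fixes G \<psi> G' :: "real \<Rightarrow> real"
  assumes G: "\<And>x. (G has_real_derivative G' x) (at x)" "\<And>x. isCont G' x" "\<And>x. G (x + 2 * pi) = G x"
    and \<psi>: "\<psi> \<in> smooth_torus"
  shows "(LINT x:{-pi..pi}|lebesgue. G x * deriv \<psi> x) = - (LINT x:{-pi..pi}|lebesgue. G' x * \<psi> x)"
proof -
  have d: "\<psi> differentiable at x" "deriv \<psi> differentiable at x" for x
    using \<psi> unfolding smooth_torus_def by (force dest: spec[of _ "0::nat"] spec[of _ "1::nat"])+
  have D: "(\<psi> has_real_derivative deriv \<psi> x) (at x)" for x
    using d(1) by (simp add: DERIV_deriv_iff_real_differentiable)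
  have con: "isCont \<psi> x" "isCont (deriv \<psi>) x" "isCont G x" for x
    using d G(1)[of x] by (auto simp: differentiable_imp_continuous_within DERIV_isCont)
  have ci: "continuous_on S \<psi>" "continuous_on S (deriv \<psi>)" "continuous_on S G" "continuous_on S G'" for S
    using con G(2) by (auto intro: continuous_at_imp_continuous_on)
  have "((\<lambda>x. G x * \<psi> x) has_vector_derivative G x * deriv \<psi> x + G' x * \<psi> x) (at x)" for x
    using DERIV_mult[OF G(1) D, of x] by (simp add: has_real_derivative_iff_has_vector_derivative add.commute mult.commute)
  moreover have "G pi * \<psi> pi = G (- pi) * \<psi> (- pi)"
    using G(3)[of "-pi"] \<psi> unfolding smooth_torus_def by (auto dest: spec[of _ "-pi"])
  ultimately have "(LINT x|lebesgue_on {-pi..pi}. G x * deriv \<psi> x + G' x * \<psi> x) = 0"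
    by (intro integral_deriv_periodic(2)[of "\<lambda>x. G x * \<psi> x"] continuous_intros ci)
  moreover have "integrable (lebesgue_on {-pi..pi}) (\<lambda>x. G x * deriv \<psi> x)" "integrable (lebesgue_on {-pi..pi}) (\<lambda>x. G' x * \<psi> x)"
    by (intro integrable_continuous_Icc continuous_intros ci)+
  ultimately show ?thesis by (simp add: set_LINT_Icc)
qed

lemma fourier_coeff_deriv:
  assumes G: "\<And>x. (G has_real_derivative G' x) (at x)" "\<And>x. isCont G' x" "\<And>x. G (x + 2 * pi) = G x"
  shows "fourier_coeff G' k = \<i> * of_int k * fourier_coeff G k"
proof -
  have ci: "continuous_on S G" "continuous_on S G'" for S
    using DERIV_isCont[OF G(1)] G(2) by (auto intro: continuous_at_imp_continuous_on)
  define e where "e x = cis (- (of_int k * x))" for x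
  have e_cont: "continuous_on S e" for S unfolding e_def by (intro continuous_intros)
  have e': "(e has_vector_derivative (- \<i> * of_int k) * e x) (at x)" for x
  proof -
    have "((\<lambda>z. exp (- (\<i> * of_int k * z))) has_field_derivative
        (- \<i> * of_int k) * exp (- (\<i> * of_int k * of_real x))) (at (of_real x))"
      by (auto intro!: derivative_eq_intros)
    from has_vector_derivative_real_field[OF this]
    have "((\<lambda>x. exp (- (\<i> * of_int k * complex_of_real x))) has_vector_derivative
        (- \<i> * of_int k) * exp (- (\<i> * of_int k * of_real x))) (at x)" .
    moreover have "e = (\<lambda>x. exp (- (\<i> * of_int k * complex_of_real x)))"
      by (simp add: e_def[abs_def] cis_conv_exp mult_ac)
    ultimately show ?thesis by simp
  qed
  have G': "((\<lambda>x. complex_of_real (G x)) has_vector_derivative of_real (G' x)) (at x)" for x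
    using G(1)[of x] by (auto intro!: has_vector_derivative_of_real simp: has_real_derivative_iff_has_vector_derivative)
  have "((\<lambda>x. of_real (G x) * e x) has_vector_derivative
      of_real (G x) * ((- \<i> * of_int k) * e x) + of_real (G' x) * e x) (at x)" for x
    by (rule has_vector_derivative_mult[OF G' e'])
  moreover have "of_real (G pi) * e pi = of_real (G (- pi)) * e (- pi)"
  proof -
    have "e (- pi) = e pi * cis (2 * pi * of_int k)" by (simp add: e_def cis_mult algebra_simps)
    also have "cis (2 * pi * of_int k) = 1" by (rule cis_multiple_2pi) simp
    finally show ?thesis using G(3)[of "-pi"] by simp
  qed
  ultimately have "(LINT x|lebesgue_on {-pi..pi}. of_real (G x) * ((- \<i> * of_int k) * e x) + of_real (G' x) * e x) = 0"
    by (intro integral_deriv_periodic(2)[of "\<lambda>x. of_real (G x) * e x"] continuous_intros ci e_cont)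
  moreover have "of_real (G x) * ((- \<i> * of_int k) * e x) + of_real (G' x) * e x
      = (- \<i> * of_int k) * (of_real (G x) * e x) + of_real (G' x) * e x" for x
    by (simp add: mult_ac)
  ultimately have z: "(LINT x|lebesgue_on {-pi..pi}. (- \<i> * of_int k) * (of_real (G x) * e x) + of_real (G' x) * e x) = 0"
    by (simp only:)
  have i: "integrable (lebesgue_on {-pi..pi}) (\<lambda>x. of_real (G x) * e x)" "integrable (lebesgue_on {-pi..pi}) (\<lambda>x. of_real (G' x) * e x)"
    by (intro integrable_continuous_Icc continuous_intros ci e_cont)+
  have "(LINT x|lebesgue_on {-pi..pi}. (- \<i> * of_int k) * (of_real (G x) * e x) + of_real (G' x) * e x)
      = (- \<i> * of_int k) * (LINT x|lebesgue_on {-pi..pi}. of_real (G x) * e x) + (LINT x|lebesgue_on {-pi..pi}. of_real (G' x) * e x)"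
    using i by (subst Bochner_Integration.integral_add) auto
  with z have "(- \<i> * of_int k) * (LINT x|lebesgue_on {-pi..pi}. of_real (G x) * e x) + (LINT x|lebesgue_on {-pi..pi}. of_real (G' x) * e x) = 0"
    by simp
  then have "(LINT x|lebesgue_on {-pi..pi}. of_real (G' x) * e x) = \<i> * of_int k * (LINT x|lebesgue_on {-pi..pi}. of_real (G x) * e x)"
    by (simp add: eq_neg_iff_add_eq_0 add.commute)
  then show ?thesis by (simp add: fourier_coeff_def set_LINT_Icc e_def)
qed

section \<open>The stationary profile\<close>

lemma DERIV_signed_powr_mult_self:
  assumes "0 < p"
  shows "((\<lambda>z. signed_powr p z * z) has_real_derivative (p + 1) * signed_powr p z) (at z)"
proof (cases "z = 0")
  case False
  have e: "\<bar>z\<bar> powr (p - 1) * z = signed_powr p z"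
    using False by (simp add: signed_powr_def powr_diff sgn_if)
  have "p * \<bar>z\<bar> powr (p - 1) * z + 1 * signed_powr p z = (p + 1) * signed_powr p z"
    by (simp add: e mult.assoc distrib_right)
  with DERIV_mult[OF DERIV_signed_powr_nonzero[OF False, of p] DERIV_ident] show ?thesis
    by (simp only:)
next
  case True
  have "(signed_powr p \<longlongrightarrow> 0) (at 0)" using isCont_signed_powr[OF assms, of 0] by (simp add: isCont_def)
  moreover have "\<forall>\<^sub>F y in at 0. signed_powr p y = (signed_powr p y * y - signed_powr p 0 * 0) / (y - 0)"
    by (auto simp: eventually_at_filter)
  ultimately have "((\<lambda>y. (signed_powr p y * y - signed_powr p 0 * 0) / (y - 0)) \<longlongrightarrow> 0) (at 0)"
    by (rule Lim_transform_eventually)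
  then show ?thesis using True by (simp add: has_field_derivative_iff)
qed

context solution
begin

context
  fixes n :: nat
  assumes n: "n \<ge> 1"
begin

lemma scale_periodic:
  assumes "\<And>x. F (x + 2 * pi) = (F x :: real)"
  shows "F (real n * (x + 2 * pi)) = F (real n * x)" "F (real n * (x + 2 * pi / real n)) = F (real n * x)"
proof -
  show "F (real n * (x + 2 * pi)) = F (real n * x)"
    using periodic_integer_shift[of F "2 * pi" "real n * x" "int n"] assms by (simp add: algebra_simps)
  have "real n * (x + 2 * pi / real n) = real n * x + 2 * pi" using n by (simp add: field_simps)
  then show "F (real n * (x + 2 * pi / real n)) = F (real n * x)" using assms by simp
qed

lemma scale_isCont: "(\<And>x. isCont F x) \<Longrightarrow> isCont (\<lambda>x. F (real n * x) :: real) x"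
  by (rule isCont_o2[of x "\<lambda>x. real n * x" F]) (auto intro!: continuous_intros)

lemma fourier_coeff_scaled_u:
  assumes k: "k \<noteq> 0"
  shows "fourier_coeff (\<lambda>x. u (real n * x)) k = of_nat n / of_int \<bar>k\<bar> * fourier_coeff (\<lambda>x. f (real n * x)) k"
proof (cases "int n dvd k")
  case False
  show ?thesis
    using fourier_coeff_scale_not_dvd[of u n k, OF u_isCont u_per n False]
      fourier_coeff_scale_not_dvd[of f n k, OF f_isCont f_per n False] by simp
next
  case True
  then obtain m where m: "k = int n * m" by (auto simp: dvd_def)
  have "m \<noteq> 0" using k m by auto
  then have "fourier_coeff u m = fourier_coeff f m / of_int \<bar>m\<bar>" by (rule fourier_coeff_u)
  moreover have "complex_of_int \<bar>k\<bar> = of_nat n * of_int \<bar>m\<bar>"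
    by (simp add: m abs_mult)
  ultimately show ?thesis
    unfolding m using n \<open>m \<noteq> 0\<close>
    by (simp add: fourier_coeff_scale_mult[of u, OF u_isCont u_per n] fourier_coeff_scale_mult[of f, OF f_isCont f_per n] abs_mult)
qed

lemma fourier_coeff_scaled_0:
  "fourier_coeff (\<lambda>x. u (real n * x)) 0 = 0" "fourier_coeff (\<lambda>x. f (real n * x)) 0 = 0"
  using fourier_coeff_scale_mult[of u n 0, OF u_isCont u_per n] fourier_coeff_scale_mult[of f n 0, OF f_isCont f_per n]
  by (simp_all add: fourier_coeff_odd[OF um u_odd] fourier_coeff_odd[OF fm f_odd])

text \<open>
  Here \<open>F U = - \<bar>u(n x)\<bar>\<^bsup>p+1\<^esup> / n\<close> has the derivative \<open>(p+1) F dU\<close>, and one integration by parts gives the weak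
  equation.
\<close>

lemma scaled_weak_solution: "weak_stationary_De_Gregorio (1 / p) (\<lambda>x. - f (real n * x))"
proof -
  obtain w where w: "\<And>x. (u has_real_derivative w x) (at x)" "\<And>x. isCont w x" "\<And>x. w (x + 2 * pi) = w x"
    by (rule u_C1) blast
  define F where "F x = - f (real n * x)" for x
  define U where "U x = u (real n * x) / real n" for x
  define dU where "dU x = w (real n * x)" for x
  have n0: "real n \<noteq> 0" using n by simp
  have lin: "((\<lambda>x. real n * x) has_real_derivative real n) (at x)" for x
    by (auto intro!: derivative_eq_intros)
  have F_cont: "isCont F x" for x unfolding F_def by (rule isCont_minus[OF scale_isCont[of f, OF f_isCont]])
  have U_cont: "isCont U x" for x unfolding U_def
    by (rule isCont_divide[OF scale_isCont[of u, OF u_isCont] continuous_const n0])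
  have dU_cont: "isCont dU x" for x unfolding dU_def by (rule scale_isCont[of w, OF w(2)])
  have F_per: "F (x + 2 * pi) = F x" for x
    using scale_periodic(1)[of f x, OF f_per] by (simp only: F_def)
  have U_per: "U (x + 2 * pi) = U x" for x
    using scale_periodic(1)[of u x, OF u_per] by (simp only: U_def)
  have dU_per: "dU (x + 2 * pi) = dU x" for x
    using scale_periodic(1)[of w x, OF w(3)] by (simp only: dU_def)
  have U_deriv: "(U has_real_derivative dU x) (at x)" for x
  proof -
    have "((\<lambda>x. u (real n * x)) has_real_derivative w (real n * x) * real n) (at x)"
      by (rule DERIV_chain2[OF w(1) lin])
    from DERIV_cdivide[OF this, of "real n"] show ?thesis
      using n0 by (simp add: U_def[abs_def] dU_def)
  qed
  have F_coeff: "fourier_coeff F k = - fourier_coeff (\<lambda>x. f (real n * x)) k" for k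
    using fourier_coeff_cmult[of "-1" "\<lambda>x. f (real n * x)" k] by (simp add: F_def[abs_def])
  have U_coeff: "fourier_coeff U k = fourier_coeff (\<lambda>x. u (real n * x)) k / of_nat n" for k
    using fourier_coeff_cmult[of "1 / real n" "\<lambda>x. u (real n * x)" k] by (simp add: U_def[abs_def])
  have mU_coeff: "fourier_coeff (\<lambda>x. - U x) k = - fourier_coeff U k" for k
    using fourier_coeff_cmult[of "-1" U k] by simp
  have FL: "F \<in> L2_torus" by (rule L2_continuous[OF F_cont F_per])
  have UL: "U \<in> L2_torus" by (rule L2_continuous[OF U_cont U_per])
  have mUL: "(\<lambda>x. - U x) \<in> L2_torus" by (rule L2_continuous) (use U_cont U_per in auto)
  have dUL: "dU \<in> L2_torus" by (rule L2_continuous[OF dU_cont dU_per])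
  have 1: "is_Lambda_inv F (\<lambda>x. - U x)"
    unfolding is_Lambda_inv_def fourier_multiplier_def
    using FL mUL n by (simp add: F_coeff U_coeff mU_coeff fourier_coeff_scaled_0 fourier_coeff_scaled_u)
  have 2: "is_weak_deriv U dU"
    unfolding is_weak_deriv_def
    using UL dUL integration_by_parts_periodic[OF U_deriv dU_cont U_per] by blast
  have 3: "is_hilbert F dU"
    unfolding is_hilbert_def fourier_multiplier_def
  proof (intro conjI allI impI FL dUL)
    show "fourier_coeff F 0 = 0" by (simp add: F_coeff fourier_coeff_scaled_0)
    note d = fourier_coeff_deriv[OF U_deriv dU_cont U_per]
    show "fourier_coeff dU 0 = 0" using d[of 0] by simp
    fix k :: int assume k: "k \<noteq> 0"
    have "of_int k / of_int \<bar>k\<bar> = (of_int (sgn k) :: complex)"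
      using k by (cases "k > 0") (auto simp: sgn_if)
    define Z where "Z = fourier_coeff (\<lambda>x. f (real n * x)) k"
    have "fourier_coeff dU k = \<i> * of_int k * (of_nat n / of_int \<bar>k\<bar> * Z / of_nat n)"
      unfolding d U_coeff fourier_coeff_scaled_u[OF k] Z_def ..
    also have "\<dots> = \<i> * (of_int k / of_int \<bar>k\<bar>) * Z" using n by simp
    also have "\<dots> = - \<i> * of_int (sgn k) * fourier_coeff F k"
      unfolding \<open>of_int k / of_int \<bar>k\<bar> = _\<close> F_coeff Z_def by simp
    finally show "fourier_coeff dU k = - \<i> * of_int (sgn k) * fourier_coeff F k" .
  qed
  have 4: "- (1 / p) * (LINT x:{-pi..pi}|lebesgue. F x * U x * deriv \<psi> x) =
        (1 / p + 1) * (LINT x:{-pi..pi}|lebesgue. F x * dU x * \<psi> x)" if \<psi>: "\<psi> \<in> smooth_torus" for \<psi>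
  proof -
    have G: "((\<lambda>x. F x * U x) has_real_derivative (p + 1) * (F x * dU x)) (at x)" for x
    proof -
      have "((\<lambda>x. signed_powr p (u (real n * x)) * u (real n * x)) has_real_derivative
          (p + 1) * signed_powr p (u (real n * x)) * (w (real n * x) * real n)) (at x)"
        by (rule DERIV_chain2[OF DERIV_signed_powr_mult_self[OF p(1)] DERIV_chain2[OF w(1) lin]])
      from DERIV_cmult[OF this, of "- 1 / real n"]
      have "((\<lambda>x. (- 1 / real n) * (f (real n * x) * u (real n * x))) has_real_derivative
          (- 1 / real n) * ((p + 1) * f (real n * x) * (w (real n * x) * real n))) (at x)" .
      moreover have "(\<lambda>x. (- 1 / real n) * (f (real n * x) * u (real n * x))) = (\<lambda>x. F x * U x)"
        by (simp add: F_def U_def)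
      moreover have "(- 1 / real n) * ((p + 1) * f (real n * x) * (w (real n * x) * real n)) = (p + 1) * (F x * dU x)"
        using n0 by (simp add: F_def dU_def)
      ultimately show ?thesis by (simp only:)
    qed
    have "(LINT x:{-pi..pi}|lebesgue. (F x * U x) * deriv \<psi> x) = - (LINT x:{-pi..pi}|lebesgue. (p + 1) * (F x * dU x) * \<psi> x)"
      by (rule integration_by_parts_periodic[OF G _ _ \<psi>])
         (auto intro!: continuous_intros F_cont dU_cont simp: F_per U_per)
    also have "\<dots> = - ((p + 1) * (LINT x:{-pi..pi}|lebesgue. F x * dU x * \<psi> x))"
      by (simp add: set_LINT_Icc mult.assoc)
    finally show ?thesis using p by (simp add: field_simps)
  qed
  show ?thesis
    unfolding weak_stationary_De_Gregorio_def F_def[symmetric]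
    using 1 2 3 4 by blast
qed

lemma scaled_holder:
  assumes "p < 1"
  shows "(\<lambda>x. - f (real n * x)) \<in> C_holder_torus p"
proof -
  obtain L where L: "0 \<le> L" "\<forall>x y. \<bar>u x - u y\<bar> \<le> L * \<bar>x - y\<bar>" using u_lipschitz by blast
  have "\<bar>- f (real n * x) - - f (real n * y)\<bar> \<le> (2 * (L * real n) powr p) * \<bar>x - y\<bar> powr p" for x y
  proof -
    have "\<bar>f (real n * x) - f (real n * y)\<bar> \<le> 2 * \<bar>u (real n * x) - u (real n * y)\<bar> powr p"
      by (rule signed_powr_holder) (use p assms in auto)
    also have "\<dots> \<le> 2 * (L * \<bar>real n * x - real n * y\<bar>) powr p"
      using L p by (intro mult_left_mono powr_mono2) auto
    also have "L * \<bar>real n * x - real n * y\<bar> = (L * real n) * \<bar>x - y\<bar>"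
      by (simp add: abs_mult flip: right_diff_distrib)
    also have "2 * \<dots> powr p = (2 * (L * real n) powr p) * \<bar>x - y\<bar> powr p"
      using L by (subst powr_mult) auto
    finally show ?thesis by (simp add: abs_minus_commute)
  qed
  moreover have "- f (real n * (x + 2 * pi)) = - f (real n * x)" for x
    using scale_periodic(1)[of f x, OF f_per] by (simp only:)
  ultimately show ?thesis unfolding C_holder_torus_def holder_def by blast
qed

text \<open>
  The derivative is a multiple of \<open>q(n x)\<close> with \<open>q = \<bar>u\<bar>\<^bsup>p-1\<^esup> u'\<close>, where both factors are bounded and Hoelder
  continuous with exponent \<open>p - 1\<close>.
\<close>

lemma scaled_C1_holder:
  assumes p1: "1 < p"
  shows "(\<lambda>x. - f (real n * x)) \<in> C1_holder_torus (p - 1)"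
proof -
  obtain w where w: "\<And>x. (u has_real_derivative w x) (at x)" "\<exists>B\<ge>0. \<forall>x. \<bar>w x\<bar> \<le> B"
    "\<exists>C. \<forall>x y. \<bar>w x - w y\<bar> \<le> C * \<bar>x - y\<bar> powr (p - 1)"
    by (rule u_C1) (use p1 in blast)
  obtain B where B: "0 \<le> B" "\<forall>x. \<bar>w x\<bar> \<le> B" using w(2) by blast
  obtain C where C: "\<forall>x y. \<bar>w x - w y\<bar> \<le> C * \<bar>x - y\<bar> powr (p - 1)" using w(3) by blast
  obtain L where L: "0 \<le> L" "\<forall>x y. \<bar>u x - u y\<bar> \<le> L * \<bar>x - y\<bar>" using u_lipschitz by blast
  obtain M where M: "0 \<le> M" "\<forall>x. \<bar>u x\<bar> \<le> M" using u_bounded by blast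
  define q where "q x = \<bar>u x\<bar> powr (p - 1) * w x" for x
  define K where "K = M powr (p - 1) * C + B * L powr (p - 1)"
  have q: "\<bar>q x - q y\<bar> \<le> K * \<bar>x - y\<bar> powr (p - 1)" for x y
  proof -
    have "q x - q y = \<bar>u x\<bar> powr (p - 1) * (w x - w y) + w y * (\<bar>u x\<bar> powr (p - 1) - \<bar>u y\<bar> powr (p - 1))"
      by (simp add: q_def algebra_simps)
    then have "\<bar>q x - q y\<bar> \<le> \<bar>u x\<bar> powr (p - 1) * \<bar>w x - w y\<bar> + \<bar>w y\<bar> * \<bar>\<bar>u x\<bar> powr (p - 1) - \<bar>u y\<bar> powr (p - 1)\<bar>"
      using abs_triangle_ineq[of "\<bar>u x\<bar> powr (p - 1) * (w x - w y)" "w y * (\<bar>u x\<bar> powr (p - 1) - \<bar>u y\<bar> powr (p - 1))"]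
      by (simp add: abs_mult)
    also have "\<dots> \<le> M powr (p - 1) * (C * \<bar>x - y\<bar> powr (p - 1)) + B * (L * \<bar>x - y\<bar>) powr (p - 1)"
    proof (intro add_mono mult_mono)
      show "\<bar>u x\<bar> powr (p - 1) \<le> M powr (p - 1)" using M p1 by (intro powr_mono2) auto
      have "\<bar>\<bar>u x\<bar> powr (p - 1) - \<bar>u y\<bar> powr (p - 1)\<bar> \<le> \<bar>u x - u y\<bar> powr (p - 1)"
        by (rule abs_powr_diff_le) (use p p1 in auto)
      also have "\<dots> \<le> (L * \<bar>x - y\<bar>) powr (p - 1)" using L p1 by (intro powr_mono2) auto
      finally show "\<bar>\<bar>u x\<bar> powr (p - 1) - \<bar>u y\<bar> powr (p - 1)\<bar> \<le> (L * \<bar>x - y\<bar>) powr (p - 1)" .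
    qed (use B C in auto)
    also have "\<dots> = K * \<bar>x - y\<bar> powr (p - 1)"
      using L by (simp add: K_def powr_mult algebra_simps)
    finally show ?thesis .
  qed
  have d: "((\<lambda>x. - f (real n * x)) has_real_derivative - (p * real n * q (real n * x))) (at x)" for x
  proof -
    have "((\<lambda>x. real n * x) has_real_derivative real n) (at x)" by (auto intro!: derivative_eq_intros)
    from DERIV_minus[OF DERIV_chain2[OF DERIV_signed_powr[OF p1] DERIV_chain2[OF w(1) this]]]
    show ?thesis by (simp add: q_def mult_ac)
  qed
  have dd: "deriv (\<lambda>x. - f (real n * x)) = (\<lambda>x. - (p * real n * q (real n * x)))"
    using DERIV_imp_deriv[OF d] by blast
  have "\<bar>- (p * real n * q (real n * x)) - - (p * real n * q (real n * y))\<bar>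
      \<le> (p * real n * (K * real n powr (p - 1))) * \<bar>x - y\<bar> powr (p - 1)" for x y
  proof -
    have "- (p * real n * q (real n * x)) - - (p * real n * q (real n * y)) = (p * real n) * (q (real n * y) - q (real n * x))"
      by (simp add: algebra_simps)
    then have "\<bar>- (p * real n * q (real n * x)) - - (p * real n * q (real n * y))\<bar> = (p * real n) * \<bar>q (real n * x) - q (real n * y)\<bar>"
      using p by (simp add: abs_mult abs_minus_commute)
    also have "\<dots> \<le> (p * real n) * (K * \<bar>real n * x - real n * y\<bar> powr (p - 1))"
      using p q by (intro mult_left_mono) auto
    also have "\<bar>real n * x - real n * y\<bar> = real n * \<bar>x - y\<bar>"
      by (simp add: abs_mult flip: right_diff_distrib)
    also have "(real n * \<bar>x - y\<bar>) powr (p - 1) = real n powr (p - 1) * \<bar>x - y\<bar> powr (p - 1)"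
      by (subst powr_mult) auto
    finally show ?thesis by (simp add: mult_ac)
  qed
  then have "holder (p - 1) (deriv (\<lambda>x. - f (real n * x)))" unfolding holder_def dd by blast
  moreover have "- f (real n * (x + 2 * pi)) = - f (real n * x)" for x
    using scale_periodic(1)[of f x, OF f_per] by (simp only:)
  moreover have "(\<lambda>x. - f (real n * x)) differentiable at x" for x
    using d[of x] real_differentiable_def by blast
  ultimately show ?thesis unfolding C1_holder_torus_def by blast
qed

lemma scaled_stationary_profile: "stationary_profile (1 / p) n (\<lambda>x. - f (real n * x))"
  unfolding stationary_profile_def
proof (intro conjI allI impI)
  show "- f (real n * (- x)) = - (- f (real n * x))" for x
    using f_odd[of "real n * x"] by simp
  show "- f (real n * (x + 2 * pi / real n)) = - f (real n * x)" for x
    using scale_periodic(2)[of f x, OF f_per] by (simp only:)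
  show "(\<lambda>x. - f (real n * x)) \<in> C_holder_torus (1 / (1 / p))" if "1 < 1 / p"
    using scaled_holder that p by simp
  show "(\<lambda>x. - f (real n * x)) \<in> C1_holder_torus (1 / (1 / p) - 1)" if "1 / p < 1"
    using scaled_C1_holder that p by simp
  have "fourier_coeff (\<lambda>x. - f (real n * x)) (int n) = - fourier_coeff f 1"
    using fourier_coeff_cmult[of "-1" "\<lambda>x. f (real n * x)" "int n"]
      fourier_coeff_scale_mult[of f n 1, OF f_isCont f_per n] by simp
  also have "\<dots> \<noteq> 0"
    using integral_f_sin_pos by (simp add: fourier_coeff_odd[OF fm f_odd])
  finally show "fourier_coeff (\<lambda>x. - f (real n * x)) (int n) \<noteq> 0" .
qed (rule scaled_weak_solution)

end

lemma odd_ext_powr: "odd_ext (\<lambda>y. u y powr p) = f"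
  by (rule ext, rule odd_ext_of_odd_periodic[of f, OF f_odd f_per]) (simp add: u_nonneg signed_powr_nonneg_eq)

lemma odd_ext_minus_powr: "odd_ext (\<lambda>y. - (u y powr p)) = (\<lambda>x. - f x)"
  by (rule ext, rule odd_ext_of_odd_periodic[of "\<lambda>x. - f x"])
     (simp_all add: u_odd u_per u_nonneg signed_powr_nonneg_eq)

lemma is_nonneg_fixed_point: "nonneg_fixed_point (1 / p) u"
  unfolding nonneg_fixed_point_def
proof (intro conjI)
  show "continuous_on {0..pi} u" using u_isCont by (intro continuous_at_imp_continuous_on) auto
  show "\<exists>x\<in>{0..pi}. u x \<noteq> 0" using sol unfolding is_solution_def by blast
  show "\<exists>V. is_Lambda_inv (odd_ext (\<lambda>x. u x powr (1 / (1 / p)))) V \<and> (\<forall>x\<in>{0..pi}. u x = V x)"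
    using Lambda_inv_u by (intro exI[of _ u]) (simp add: odd_ext_powr)
qed (use u_nonneg in blast)

end

theorem theorem3p3:
  fixes \<alpha> :: real and n :: nat
  assumes "\<alpha> > 1 / 2" and "n \<ge> 1"
  shows "(\<exists>f. stationary_profile \<alpha> n f) \<and>
    (\<alpha> > 1 \<longrightarrow>
      (\<exists>v. nonneg_fixed_point \<alpha> v \<and>
           (\<forall>w. nonneg_fixed_point \<alpha> w \<longrightarrow> (\<forall>x\<in>{0..pi}. w x = v x)) \<and>
           stationary_profile \<alpha> n
             (\<lambda>x. odd_ext (\<lambda>y. - (v y powr (1 / \<alpha>))) (real n * x))))"
proof -
  define p where "p = 1 / \<alpha>"
  have p: "0 < p" "p < 2" and \<alpha>: "\<alpha> = 1 / p" using assms(1) by (auto simp: p_def field_simps)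
  obtain u where u: "is_solution p u"
    using solution_exists[OF p(1)] by blast
  interpret solution p u by unfold_locales (use p u in auto)
  note profile = scaled_stationary_profile[OF assms(2)]
  have exists: "\<exists>f. stationary_profile \<alpha> n f" using profile unfolding \<alpha> by blast
  have fixed_point: "nonneg_fixed_point \<alpha> u" using is_nonneg_fixed_point unfolding \<alpha> .
  have odd_extension: "stationary_profile \<alpha> n (\<lambda>x. odd_ext (\<lambda>y. - (u y powr (1 / \<alpha>))) (real n * x))"
    using profile by (simp add: \<alpha> odd_ext_minus_powr)
  have unique: "w x = u x" if "1 < \<alpha>" and w: "nonneg_fixed_point \<alpha> w" and x: "x \<in> {0..pi}" for w x
  proof -
    have p1: "p < 1" using that(1) by (simp add: p_def)
    obtain V where V: "is_Lambda_inv (odd_ext (\<lambda>x. w x powr p)) V" "\<forall>x\<in>{0..pi}. w x = V x"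
      using w unfolding nonneg_fixed_point_def p_def by blast
    have "\<exists>u'. is_solution p u' \<and> (\<forall>x\<in>{0..pi}. w x = u' x)"
      by (rule fixed_point_imp_solution[OF p(1) _ _ _ V(1)])
         (use w V(2) in \<open>auto simp: nonneg_fixed_point_def\<close>)
    then obtain u' where u': "is_solution p u'" "\<forall>x\<in>{0..pi}. w x = u' x" by blast
    show "w x = u x"
      using solution_le[OF p(1) p1 u u'(1) x] solution_le[OF p(1) p1 u'(1) u x] u'(2) x by simp
  qed
  show ?thesis using exists fixed_point odd_extension unique by blast
qed

end
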